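(* Let $0<n_1\le\dots\le n_m$, $\bar n=(n_1,\dots,n_m)$, let $r=\#\mathrm{St}_{\bar n}$ and let $\lambda$ be a partition. (1) If $l(\lambda)>r$, then $\mathrm{DL}_{\bar n}(\lambda)=\emptyset$. (2) If $\lambda=(\lambda_1>\dots>\lambda_r)$ is a regular partition of length $r$, then the poset $\mathrm{DL}_{\bar n}(\lambda)$ does not depend on $\lambda$ (up to the isomorphism replacing the $l$-th largest value by the $l$-th largest value); it is denoted $\mathrm{DL}_{\bar n}$, and it is bounded, graded and $\mathrm{EL}$-shellable. (3) If $l(\lambda)\le r$, then: (a) the covering relations of the Bruhat partial order on $\mathrm{DL}_{\bar n}(\lambda)$ are determined by transpositions in minimal disorders: the partial order on $\mathrm{DL}_{\bar n}(\lambda)$ is generated by the relations $A\prec A'$, where $A'$ is obtained from $A$ by exchanging the values at the two cells of a minimal $DL$-disorder for $A$; (b) the bubble-sort map $\mathrm{bs}_{\bar n}$ defines a nonincreasing monotone idempotent on the interval $[\lambda_+^{\bar n},\lambda_-]$ of the Bruhat poset $\mathbb S_m\lambda$, with image $\mathrm{vrt}(\mathrm{DL}_{\bar n}(\lambda))\cong \mathrm{DL}_{\bar n}(\lambda)$; (c) there is a monotone idempotent $\pi_\lambda:\mathrm{DL}_{\bar n}\twoheadrightarrow \mathrm{DL}_{\bar n}(\lambda)$, namely the order-preserving surjection replacing the $l$-th largest value of an array by $\lambda_l$ (with $\lambda_l=0$ for $l>l(\lambda)$), which admits an order-preserving section, so that $\mathrm{DL}_{\bar n}(\lambda)$ is identified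 with the image of a monotone idempotent of $\mathrm{DL}_{\bar n}$.
   Context: Staircase corners. $Y_{\bar n}=\{(i,j):1\le j\le m,\ 1\le i\le n_j\}$. $\mathrm{St}_{\bar n}\subset Y_{\bar n}$ is the set with at most one cell in each row and column, containing every cell $(n_j,j)$ with $n_j>n_{j-1}$ ($n_0=0$), and such that for each $(i,j)\in \mathrm{St}_{\bar n}$ the remaining elements are exactly the staircase corners of the diagram obtained by deleting row $i$ and column $j$. Concretely: process the columns $j=1,\dots,m$ in order; in column $j$ choose the largest $i\le n_j$ such that row $i$ contains no previously chosen cell (choose nothing if there is none). Partial order: $(i,j)\succeq(i',j')$ iff $i\ge i'$ and $j\le j'$. Let $\mathrm{vrt}(i,j)=j$. $DL$-dense arrays. $\mathrm{DL}_{\bar n}(\lambda)$ is the set of functions $A:Y_{\bar n}\to\mathbb Z_{\ge0}$ vanishing outside $\mathrm{St}_{\bar n}$, with $A_s\le A_t$ whenever $s\prec t$ in $\mathrm{St}_{\bar n}$, whose multiset of nonzero values is the multiset of nonzero parts of $\lambda$. $\mathrm{vrt}(A)\in\mathbb Z_{\ge0}^m$ is the vector of column sums; $A\mapsto\mathrm{vrt}(A)$ is injective. Bruhat order. Partitions are padded by zeros. On $\mathbb S_m\lambda$, $\preceq$ is the reflexive transitive closure of $a\prec(ij)a$ whenever $i<j$, $a_i>a_j$ (strong Bruhat order on $\mathbb S_m/\mathrm{Stab}(\lambda)$); its maximum is the weakly increasing rearrangement $\lambda_-$. On $\mathrm{DL}_{\bar n}(\lambda)$: $A\preceq B$ iff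 $\mathrm{vrt}(A)\preceq\mathrm{vrt}(B)$. With $p_1<\dots<p_r$ the elements of $\mathrm{vrt}(\mathrm{St}_{\bar n})$, $\lambda_+^{\bar n}\in\mathbb S_m\lambda$ has $p_l$-th entry $\lambda_l$ for $l\le r$, other entries $0$. Minimal $DL$-disorder for $A$: a pair $(i,j),(i',j')\in \mathrm{St}_{\bar n}$ with $i<i'$, $j<j'$, $A_{ij}>A_{i'j'}$, such that for all $(k,l)\in \mathrm{St}_{\bar n}$: if ($k>i$ and $l<j$) or ($k>i'$ and $l<j'$) then $A_{kl}\ge A_{ij}$; if ($k<i$ and $l>j$) or ($k<i'$ and $l>j'$) then $A_{kl}\le A_{i'j'}$; if $i<k<i'$ and $j<l<j'$ then $A_{kl}\notin[A_{i'j'},A_{ij}]$. Bubble sort. Write $S=\mathrm{St}_{\bar n}$, $v=\mathrm{vrt}$, $S_{\le k}=v^{-1}([1,k])$, $S_{<k}=v^{-1}([1,k-1])$. A composition $d\in\mathbb Z_{\ge0}^m$ is admissible if $\#\{j\le k:d_j>0\}\le\#S_{\le k}$ for all $k\le m$ (for $d\in\mathbb S_m\lambda$ this is equivalent to $d\in[\lambda_+^{\bar n},\lambda_-]$). It is $S[l]$-dominant if: $l\notin v(S)$ implies $d_l=0$; $l\in v(S)$ implies $d_{v(s)}\ge d_l$ for all $s\succ v^{-1}(l)$. For an admissible $d$ which is $S[l]$-dominant for all $l<k$, $\mathrm{bs}^k(d)$ is the output of: while $d$ is not $S[k]$-dominant, let $M$ be the set of $\preceq$-maximal elements of $\{s\in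 S_{<k}:d_{v(s)}<d_k\}$, let $j=\max v(M)$, and exchange $d_j$ and $d_k$. Then $\mathrm{bs}_{\bar n}=\mathrm{bs}^m\circ\dots\circ\mathrm{bs}^1$. Poset terms. A self-map $F$ is nonincreasing if $F(x)\le x$, monotone if order-preserving, idempotent if $F\circ F=F$. Bounded: having a minimum and a maximum. Graded: all maximal chains between two comparable elements have the same length. $\mathrm{EL}$-shellable: the edges (covering relations) of the Hasse diagram can be labelled by elements of a poset so that for any $x<y$ there is a unique maximal chain from $x$ to $y$ with strictly increasing labels (read from $x$ to $y$), and its label word is lexicographically minimal among maximal chains from $x$ to $y$. *)

theory Defs
  imports
    "HOL-Library.Multiset"
    "HOL-Library.While_Combinator"
    "HOL-Library.FuncSet"
    "HOL-Combinatorics.Combinatorics"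
begin

section \<open>Posets given by a carrier and an order predicate\<close>

definition poset_on :: "'a set \<Rightarrow> ('a \<Rightarrow> 'a \<Rightarrow> bool) \<Rightarrow> bool" where
  "poset_on P le \<longleftrightarrow> reflp_on P le \<and> antisymp_on P le \<and> transp_on P le"

definition bounded_poset :: "'a set \<Rightarrow> ('a \<Rightarrow> 'a \<Rightarrow> bool) \<Rightarrow> bool" where
  "bounded_poset P le \<longleftrightarrow> (\<exists>b\<in>P. \<forall>x\<in>P. le b x) \<and> (\<exists>t\<in>P. \<forall>x\<in>P. le x t)"

definition covers :: "'a set \<Rightarrow> ('a \<Rightarrow> 'a \<Rightarrow> bool) \<Rightarrow> 'a \<Rightarrow> 'a \<Rightarrow> bool" where
  "covers P le x y \<longleftrightarrow> x \<in> P \<and> y \<in> P \<and> le x y \<and> x \<noteq> y \<and>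
     \<not> (\<exists>z\<in>P. z \<noteq> x \<and> z \<noteq> y \<and> le x z \<and> le z y)"

text \<open>
  Maximal chains from \<open>x\<close> to \<open>y\<close> are listed upwards as paths in the Hasse diagram; all
  posets below are finite, where these are exactly the inclusion-maximal chains of the
  interval.
\<close>

definition maximal_chain :: "'a set \<Rightarrow> ('a \<Rightarrow> 'a \<Rightarrow> bool) \<Rightarrow> 'a \<Rightarrow> 'a \<Rightarrow> 'a list \<Rightarrow> bool" where
  "maximal_chain P le x y c \<longleftrightarrow>
     c \<noteq> [] \<and> set c \<subseteq> P \<and> hd c = x \<and> last c = y \<and> successively (covers P le) c"

definition graded_poset :: "'a set \<Rightarrow> ('a \<Rightarrow> 'a \<Rightarrow> bool) \<Rightarrow> bool" where
  "graded_poset P le \<longleftrightarrow>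
     (\<forall>x\<in>P. \<forall>y\<in>P. \<forall>c c'. le x y \<and> maximal_chain P le x y c \<and> maximal_chain P le x y c'
        \<longrightarrow> length c = length c')"

definition label_word :: "('a \<Rightarrow> 'a \<Rightarrow> 'l) \<Rightarrow> 'a list \<Rightarrow> 'l list" where
  "label_word f c = map2 f (butlast c) (tl c)"

text \<open>
  \<open>L\<close> is the strict order of the poset of labels. Lexicographic minimality is required in
  the strong form: the increasing chain precedes every other maximal chain.
\<close>

definition EL_labelling ::
  "'a set \<Rightarrow> ('a \<Rightarrow> 'a \<Rightarrow> bool) \<Rightarrow> 'l rel \<Rightarrow> ('a \<Rightarrow> 'a \<Rightarrow> 'l) \<Rightarrow> bool" where
  "EL_labelling P le L f \<longleftrightarrow> irrefl L \<and> trans L \<and>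
     (\<forall>x\<in>P. \<forall>y\<in>P. le x y \<and> x \<noteq> y \<longrightarrow>
        (\<exists>c. maximal_chain P le x y c \<and>
             sorted_wrt (\<lambda>a b. (a, b) \<in> L) (label_word f c) \<and>
             (\<forall>c'. maximal_chain P le x y c' \<and> c' \<noteq> c \<longrightarrow>
                \<not> sorted_wrt (\<lambda>a b. (a, b) \<in> L) (label_word f c') \<and>
                (label_word f c, label_word f c') \<in> lexord L)))"

text \<open>
  A finite poset has finitely many edges, so labels in an arbitrary poset can be replaced
  by labels in a poset on \<^typ>\<open>nat\<close>; \<open>L\<close> need not be the usual order.
\<close>

definition EL_shellable :: "'a set \<Rightarrow> ('a \<Rightarrow> 'a \<Rightarrow> bool) \<Rightarrow> bool" where
  "EL_shellable P le \<longleftrightarrow> (\<exists>(L :: nat rel) f. EL_labelling P le L f)"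

definition order_iso_on ::
  "'a set \<Rightarrow> ('a \<Rightarrow> 'a \<Rightarrow> bool) \<Rightarrow> 'b set \<Rightarrow> ('b \<Rightarrow> 'b \<Rightarrow> bool) \<Rightarrow> ('a \<Rightarrow> 'b) \<Rightarrow> bool" where
  "order_iso_on P leP Q leQ f \<longleftrightarrow>
     bij_betw f P Q \<and> (\<forall>x\<in>P. \<forall>y\<in>P. leP x y \<longleftrightarrow> leQ (f x) (f y))"

definition monotone_idempotent_on :: "'a set \<Rightarrow> ('a \<Rightarrow> 'a \<Rightarrow> bool) \<Rightarrow> ('a \<Rightarrow> 'a) \<Rightarrow> bool" where
  "monotone_idempotent_on P le F \<longleftrightarrow>
     F \<in> P \<rightarrow> P \<and> monotone_on P le le F \<and> (\<forall>x\<in>P. F (F x) = F x)"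


section \<open>Partitions and the Bruhat order on their rearrangements\<close>

definition is_partition :: "nat list \<Rightarrow> bool" where
  "is_partition lam \<longleftrightarrow> sorted_wrt (\<ge>) lam \<and> 0 \<notin> set lam"

definition regular_partition :: "nat list \<Rightarrow> bool" where
  "regular_partition lam \<longleftrightarrow> is_partition lam \<and> sorted_wrt (>) lam"

text \<open>The part \<open>\<lambda>\<^sub>l\<close> for \<open>l \<ge> 1\<close>, padded by zeros.\<close>

definition part :: "nat list \<Rightarrow> nat \<Rightarrow> nat" where
  "part lam l = (if 1 \<le> l \<and> l \<le> length lam then lam ! (l - 1) else 0)"

text \<open>
  Vectors indexed by \<open>1, \<dots>, m\<close> are functions on \<^typ>\<open>nat\<close> vanishing outside \<open>{1..m}\<close>. The
  orbit below is used only for partitions with at most \<open>m\<close> parts, and then consists of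
  such functions.
\<close>

definition rearrangements :: "nat \<Rightarrow> nat list \<Rightarrow> (nat \<Rightarrow> nat) set" where
  "rearrangements m lam = {part lam \<circ> \<sigma> |\<sigma>. \<sigma> permutes {1..m}}"

definition bruhat_step :: "nat \<Rightarrow> (nat \<Rightarrow> nat) \<Rightarrow> (nat \<Rightarrow> nat) \<Rightarrow> bool" where
  "bruhat_step m a b \<longleftrightarrow>
     (\<exists>i j. 1 \<le> i \<and> i < j \<and> j \<le> m \<and> a i > a j \<and> b = a \<circ> transpose i j)"

definition bruhat :: "nat \<Rightarrow> (nat \<Rightarrow> nat) \<Rightarrow> (nat \<Rightarrow> nat) \<Rightarrow> bool" where
  "bruhat m = (bruhat_step m)\<^sup>*\<^sup>*"

definition lam_minus :: "nat \<Rightarrow> nat list \<Rightarrow> nat \<Rightarrow> nat" where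
  "lam_minus m lam j = (if 1 \<le> j \<and> j \<le> m then part lam (m + 1 - j) else 0)"


section \<open>Staircase corners\<close>

type_synonym cell = "nat \<times> nat"

text \<open>A cell is \<open>(row, column)\<close>, both counted from 1; \<open>n j\<close> is the height of column \<open>j\<close>.\<close>

definition diagram :: "nat \<Rightarrow> (nat \<Rightarrow> nat) \<Rightarrow> cell set" where
  "diagram m n = {(i, j). 1 \<le> j \<and> j \<le> m \<and> 1 \<le> i \<and> i \<le> n j}"

definition free_rows :: "cell set \<Rightarrow> nat \<Rightarrow> nat set" where
  "free_rows S h = {i \<in> {1..h}. \<forall>l. (i, l) \<notin> S}"

primrec staircase :: "nat \<Rightarrow> (nat \<Rightarrow> nat) \<Rightarrow> cell set" where
  "staircase 0 n = {}"
| "staircase (Suc m) n =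
     (let S = staircase m n; R = free_rows S (n (Suc m))
      in if R = {} then S else insert (Max R, Suc m) S)"

definition cell_le :: "cell \<Rightarrow> cell \<Rightarrow> bool" where
  "cell_le s t \<longleftrightarrow> fst s \<le> fst t \<and> snd t \<le> snd s"

definition cell_less :: "cell \<Rightarrow> cell \<Rightarrow> bool" where
  "cell_less s t \<longleftrightarrow> cell_le s t \<and> s \<noteq> t"

text \<open>
  If \<open>j = p\<^sub>l\<close> is the \<open>l\<close>-th smallest column meeting the staircase, then \<open>l\<close> is the number
  of such columns that are at most \<open>j\<close>.
\<close>

definition lam_plus :: "nat \<Rightarrow> (nat \<Rightarrow> nat) \<Rightarrow> nat list \<Rightarrow> nat \<Rightarrow> nat" where
  "lam_plus m n lam j =
     (if j \<in> snd ` staircase m n then part lam (card {p \<in> snd ` staircase m n. p \<le> j}) else 0)"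

definition bruhat_interval :: "nat \<Rightarrow> (nat \<Rightarrow> nat) \<Rightarrow> nat list \<Rightarrow> (nat \<Rightarrow> nat) set" where
  "bruhat_interval m n lam =
     {d \<in> rearrangements m lam. bruhat m (lam_plus m n lam) d \<and> bruhat m d (lam_minus m lam)}"


section \<open>DL-dense arrays\<close>

text \<open>An array is a function on all pairs, extended by zero outside the diagram.\<close>

definition DL :: "nat \<Rightarrow> (nat \<Rightarrow> nat) \<Rightarrow> nat list \<Rightarrow> (cell \<Rightarrow> nat) set" where
  "DL m n lam = {A.
     (\<forall>s. s \<notin> staircase m n \<longrightarrow> A s = 0) \<and>
     (\<forall>s\<in>staircase m n. \<forall>t\<in>staircase m n. cell_less s t \<longrightarrow> A s \<le> A t) \<and>
     filter_mset (\<lambda>x. x \<noteq> 0) (image_mset A (mset_set (diagram m n))) = mset lam}"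

definition vrt :: "nat \<Rightarrow> (nat \<Rightarrow> nat) \<Rightarrow> (cell \<Rightarrow> nat) \<Rightarrow> nat \<Rightarrow> nat" where
  "vrt m n A j = (if 1 \<le> j \<and> j \<le> m then \<Sum>i = 1..n j. A (i, j) else 0)"

definition DL_le :: "nat \<Rightarrow> (nat \<Rightarrow> nat) \<Rightarrow> (cell \<Rightarrow> nat) \<Rightarrow> (cell \<Rightarrow> nat) \<Rightarrow> bool" where
  "DL_le m n A B \<longleftrightarrow> bruhat m (vrt m n A) (vrt m n B)"

fun minimal_disorder :: "nat \<Rightarrow> (nat \<Rightarrow> nat) \<Rightarrow> (cell \<Rightarrow> nat) \<Rightarrow> cell \<Rightarrow> cell \<Rightarrow> bool" where
  "minimal_disorder m n A (i, j) (i', j') \<longleftrightarrow>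
     (i, j) \<in> staircase m n \<and> (i', j') \<in> staircase m n \<and>
     i < i' \<and> j < j' \<and> A (i, j) > A (i', j') \<and>
     (\<forall>(k, l) \<in> staircase m n.
        ((k > i \<and> l < j \<or> k > i' \<and> l < j') \<longrightarrow> A (k, l) \<ge> A (i, j)) \<and>
        ((k < i \<and> l > j \<or> k < i' \<and> l > j') \<longrightarrow> A (k, l) \<le> A (i', j')) \<and>
        (i < k \<and> k < i' \<and> j < l \<and> l < j' \<longrightarrow> A (k, l) \<notin> {A (i', j')..A (i, j)}))"

definition disorder_swap :: "nat \<Rightarrow> (nat \<Rightarrow> nat) \<Rightarrow> (cell \<Rightarrow> nat) \<Rightarrow> (cell \<Rightarrow> nat) \<Rightarrow> bool" where
  "disorder_swap m n A B \<longleftrightarrow> (\<exists>s t. minimal_disorder m n A s t \<and> B = A \<circ> transpose s t)"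

text \<open>
  Replacing the \<open>l\<close>-th largest value by \<open>\<lambda>\<^sub>l\<close>. This is used on arrays with pairwise distinct
  values on the staircase, where the value at \<open>s\<close> is the \<open>l\<close>-th largest one for \<open>l\<close> the
  number of staircase cells with value at least \<open>A s\<close>.
\<close>

definition relabel :: "nat \<Rightarrow> (nat \<Rightarrow> nat) \<Rightarrow> nat list \<Rightarrow> (cell \<Rightarrow> nat) \<Rightarrow> cell \<Rightarrow> nat" where
  "relabel m n lam A s =
     (if s \<in> staircase m n then part lam (card {t \<in> staircase m n. A s \<le> A t}) else 0)"


section \<open>Bubble sort\<close>

definition dominant_at :: "nat \<Rightarrow> (nat \<Rightarrow> nat) \<Rightarrow> nat \<Rightarrow> (nat \<Rightarrow> nat) \<Rightarrow> bool" where
  "dominant_at m n l d \<longleftrightarrow>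
     (l \<notin> snd ` staircase m n \<longrightarrow> d l = 0) \<and>
     (\<forall>t\<in>staircase m n. snd t = l \<longrightarrow> (\<forall>s\<in>staircase m n. cell_less t s \<longrightarrow> d (snd s) \<ge> d l))"

definition maximal_cells :: "cell set \<Rightarrow> cell set" where
  "maximal_cells T = {s \<in> T. \<not> (\<exists>t\<in>T. cell_less s t)}"

text \<open>
  On the admissible vectors that are dominant in all columns before \<open>k\<close> the loop is well
  defined and terminates; elsewhere its value is irrelevant.
\<close>

definition bubble_column :: "nat \<Rightarrow> (nat \<Rightarrow> nat) \<Rightarrow> nat \<Rightarrow> (nat \<Rightarrow> nat) \<Rightarrow> (nat \<Rightarrow> nat)" where
  "bubble_column m n k =
     while (\<lambda>d. \<not> dominant_at m n k d)
       (\<lambda>d. let M = maximal_cells {s \<in> staircase m n. snd s < k \<and> d (snd s) < d k};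
                j = Max (snd ` M)
            in d \<circ> transpose j k)"

definition bubble_sort :: "nat \<Rightarrow> (nat \<Rightarrow> nat) \<Rightarrow> (nat \<Rightarrow> nat) \<Rightarrow> (nat \<Rightarrow> nat)" where
  "bubble_sort m n = fold (bubble_column m n) [1..<Suc m]"

end

theory Submission
  imports Defs
begin

text \<open>
  An array is encoded by its vector of column sums. The Bruhat order on vectors with the same
  content is characterised by counting the entries \<open>\<ge> v\<close> among the first \<open>k\<close> columns. Given
  dense vectors \<open>x < y\<close>, look at the first row in which they differ, say at column \<open>a\<close>, and at
  the first column \<open>q > a\<close> of a higher row with \<open>y a \<le> x q < x a\<close>: exchanging \<open>x a\<close> and \<open>x q\<close>
  keeps the vector dense and below \<open>y\<close>. Hence the order is generated by minimal disorders,
  and in the regular case labelling such an exchange by (row of \<open>a\<close>, \<open>q\<close>) makes the greedy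
  chain the unique increasing and lexicographically first one; gradedness follows since each
  exchange removes exactly one inversion. Bubble sort sends \<open>d\<close> to the largest dense vector
  below \<open>d\<close>; this uses that the rows of the staircase cells, read by columns, avoid the
  pattern 312, so the cells below a given one form a chain.
\<close>

section \<open>Counting entries in initial segments\<close>

text \<open>A Bruhat chain between two dense vectors may pass through vectors that are not dense, so
  exchanges within the dense vectors do not visibly generate the order; counting functions replace
  chains by inequalities between the endpoints. An exchange lowers the counting function by 1 on a
  rectangle of columns and values, and covering relations are settled by showing that the rectangles
  of two minimal disorders are never properly nested. The first differing row is taken, not the
  first column, because then all lower rows agree and density controls the higher rows to the left,
  so that a count inside a window of values decides everything. The setting of columns with attached
  rows is used twice: for the staircase, and for all of \<open>{1..m}\<close> with the identity as
  row function, where density is a mere support condition and the dense vectors of given content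
  form the whole orbit.\<close>

definition content :: "nat \<Rightarrow> (nat \<Rightarrow> nat) \<Rightarrow> nat multiset" where
  "content m d = image_mset d (mset_set {1..m})"

definition cnt :: "(nat \<Rightarrow> nat) \<Rightarrow> nat \<Rightarrow> nat \<Rightarrow> nat" where
  "cnt d k v = card {i \<in> {1..k}. v \<le> d i}"

text \<open>The counting form of the tableau criterion for Bruhat order. Going up moves large
  entries to the right, hence the reversed inequality.\<close>

definition dom_le :: "(nat \<Rightarrow> nat) \<Rightarrow> (nat \<Rightarrow> nat) \<Rightarrow> bool" where
  "dom_le a b \<longleftrightarrow> (\<forall>k v. cnt b k v \<le> cnt a k v)"

lemma dom_leD: "dom_le a b \<Longrightarrow> cnt b k v \<le> cnt a k v"
  by (simp add: dom_le_def)

lemma dom_le_refl [simp]: "dom_le a a"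
  by (simp add: dom_le_def)

lemma dom_le_trans: "dom_le a b \<Longrightarrow> dom_le b c \<Longrightarrow> dom_le a c"
  unfolding dom_le_def using le_trans by blast

lemma cnt_0 [simp]: "cnt d 0 v = 0"
  by (simp add: cnt_def)

lemma cnt_Suc: "cnt d (Suc k) v = cnt d k v + (if v \<le> d (Suc k) then 1 else 0)"
proof -
  have "{i \<in> {1..Suc k}. v \<le> d i} =
      (if v \<le> d (Suc k) then insert (Suc k) {i \<in> {1..k}. v \<le> d i} else {i \<in> {1..k}. v \<le> d i})"
    by (auto simp: le_Suc_eq)
  then show ?thesis
    by (simp add: cnt_def)
qed

lemma cnt_value_0 [simp]: "cnt d k 0 = k"
  by (induction k) (simp_all add: cnt_Suc)

text \<open>The increments of the count from one column to the next recover the entry. Column 0 is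
  never counted, so agreement there is a separate hypothesis.\<close>

lemma dom_le_antisym:
  assumes "dom_le a b" "dom_le b a" "a 0 = b 0"
  shows "a = b"
proof
  fix i
  have eq: "cnt a k v = cnt b k v" for k v
    using assms(1,2) by (simp add: dom_le_def le_antisym)
  show "a i = b i"
  proof (cases i)
    case 0
    then show ?thesis using assms(3) by simp
  next
    case (Suc k)
    have "v \<le> a i \<longleftrightarrow> v \<le> b i" for v
      using eq[of i v] eq[of k v] unfolding Suc by (simp add: cnt_Suc split: if_splits)
    then show ?thesis
      by (meson le_antisym order_refl)
  qed
qed

text \<open>The larger value leaves column \<open>c\<close> and reappears only at \<open>q\<close>,
  so one entry is missing exactly for the prefixes ending in between and for the levels separating
  the two values. This is the rectangle compared in later proofs.\<close>

lemma cnt_swap: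
  assumes "1 \<le> c" "c < q" "d q < d c"
  shows "cnt d k v = cnt (d \<circ> transpose c q) k v +
    (if c \<le> k \<and> k < q \<and> d q < v \<and> v \<le> d c then 1 else 0)"
proof (induction k)
  case 0
  then show ?case using assms by simp
next
  case (Suc k)
  consider "Suc k < c" | "Suc k = c" | "c < Suc k" "Suc k < q" | "Suc k = q" | "q < Suc k"
    by linarith
  then show ?case
  proof cases
    case 1
    then have "(d \<circ> transpose c q) (Suc k) = d (Suc k)" using assms by simp
    then show ?thesis using Suc 1 by (simp add: cnt_Suc del: comp_apply)
  next
    case 2
    then have "(d \<circ> transpose c q) (Suc k) = d q" by simp
    then show ?thesis using Suc 2 assms by (auto simp: cnt_Suc simp del: comp_apply)
  next
    case 3
    then have "(d \<circ> transpose c q) (Suc k) = d (Suc k)" by simp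
    then show ?thesis using Suc 3 by (simp add: cnt_Suc del: comp_apply)
  next
    case 4
    then have "(d \<circ> transpose c q) (Suc k) = d c" by simp
    then show ?thesis using Suc 4 assms by (auto simp: cnt_Suc simp del: comp_apply)
  next
    case 5
    then have "(d \<circ> transpose c q) (Suc k) = d (Suc k)" using assms by simp
    then show ?thesis using Suc 5 by (simp add: cnt_Suc del: comp_apply)
  qed
qed

lemma dom_le_swap:
  assumes "1 \<le> c" "c < q" "d q < d c"
  shows "dom_le d (d \<circ> transpose c q)"
  unfolding dom_le_def using cnt_swap[OF assms] by simp

lemma dom_le_swapI:
  assumes "1 \<le> c" "c < q" "d q < d c" "dom_le d y"
    and "\<And>k v. c \<le> k \<Longrightarrow> k < q \<Longrightarrow> d q < v \<Longrightarrow> v \<le> d c \<Longrightarrow> cnt y k v < cnt d k v"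
  shows "dom_le (d \<circ> transpose c q) y"
  unfolding dom_le_def
proof (intro allI)
  fix k v
  show "cnt y k v \<le> cnt (d \<circ> transpose c q) k v"
    using cnt_swap[OF assms(1-3), of k v] assms(5)[of k v] dom_leD[OF assms(4), of k v]
    by (auto split: if_splits)
qed

lemma cnt_split:
  assumes "j \<le> k"
  shows "cnt d k v = cnt d j v + card {i \<in> {Suc j..k}. v \<le> d i}"
proof -
  have "{i \<in> {1..k}. v \<le> d i} = {i \<in> {1..j}. v \<le> d i} \<union> {i \<in> {Suc j..k}. v \<le> d i}"
    using assms by auto
  then show ?thesis
    unfolding cnt_def by (simp add: card_Un_disjoint disjoint_iff)
qed

lemma cnt_split_value:
  assumes "w \<le> v"
  shows "cnt d k w = cnt d k v + card {i \<in> {1..k}. w \<le> d i \<and> d i < v}"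
proof -
  have "{i \<in> {1..k}. w \<le> d i} = {i \<in> {1..k}. v \<le> d i} \<union> {i \<in> {1..k}. w \<le> d i \<and> d i < v}"
    using assms by auto
  then show ?thesis
    unfolding cnt_def by (simp add: card_Un_disjoint disjoint_iff)
qed

lemma card_image_filter_mset:
  assumes "finite A"
  shows "card {i \<in> A. Q (d i)} = size (filter_mset Q (image_mset d (mset_set A)))"
  using assms by (simp add: filter_mset_image_mset)

lemma card_content_cong:
  assumes "content m x = content m y"
  shows "card {i \<in> {1..m}. Q (x i)} = card {i \<in> {1..m}. Q (y i)}"
proof -
  have "card {i \<in> {1..m}. Q (d i)} = size (filter_mset Q (content m d))" for d
    unfolding content_def by (rule card_image_filter_mset) simp
  then show ?thesis using assms by presburger
qed

lemma content_permute:
  assumes "p permutes {1..m}"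
  shows "content m (d \<circ> p) = content m d"
  unfolding content_def using permutes_implies_image_mset_eq[OF assms, of "d \<circ> p" d] by simp

lemma content_swap:
  assumes "c \<in> {1..m}" "q \<in> {1..m}"
  shows "content m (d \<circ> transpose c q) = content m d"
  using content_permute permutes_swap_id[OF assms] by blast

text \<open>The easy half of the tableau criterion, with the data that exchanges preserve. The
  converse for dense vectors of equal content is part of \<open>bruhat_iff_dom_le\<close>.\<close>

lemma bruhat_imp_dom_le:
  assumes "bruhat m a b"
  shows "dom_le a b \<and> content m a = content m b \<and> (\<forall>i. i \<notin> {1..m} \<longrightarrow> a i = b i)"
  using assms unfolding bruhat_def
proof (induction rule: rtranclp_induct)
  case base
  then show ?case by simp
next
  case (step b c)
  then obtain i j where ij: "1 \<le> i" "i < j" "j \<le> m" "b j < b i" "c = b \<circ> transpose i j"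
    unfolding bruhat_step_def by blast
  have "dom_le a c"
    using dom_le_swap[OF ij(1,2,4)] step.IH dom_le_trans ij(5) by blast
  moreover have "content m c = content m b"
    using content_swap[of i m j b] ij by simp
  moreover have "\<forall>k. k \<notin> {1..m} \<longrightarrow> b k = c k"
    using ij by (auto simp: transpose_def)
  ultimately show ?case using step.IH by auto
qed

text \<open>A nondecreasing map may merge the two exchanged values, and then the step becomes
  trivial; otherwise it stays a step.\<close>

lemma bruhat_comp_mono:
  assumes "bruhat m a b" "mono h"
  shows "bruhat m (h \<circ> a) (h \<circ> b)"
  using assms(1) unfolding bruhat_def
proof (induction rule: rtranclp_induct)
  case base
  then show ?case by simp
next
  case (step b c)
  then obtain i j where ij: "1 \<le> i" "i < j" "j \<le> m" "b j < b i" "c = b \<circ> transpose i j"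
    unfolding bruhat_step_def by blast
  have "h (b j) \<le> h (b i)"
    using ij(4) assms(2) by (simp add: monoD)
  then consider "h (b j) = h (b i)" | "h (b j) < h (b i)"
    by linarith
  then show ?case
  proof cases
    case 1
    then have "h \<circ> c = h \<circ> b"
      using ij(5) by (auto simp: fun_eq_iff transpose_def)
    then show ?thesis using step.IH by simp
  next
    case 2
    then have "bruhat_step m (h \<circ> b) (h \<circ> c)"
      unfolding bruhat_step_def using ij by (auto simp: comp_assoc)
    then show ?thesis using step.IH by (rule rtranclp.rtrancl_into_rtrancl[rotated])
  qed
qed

text \<open>Moving the larger of two entries to the right meets a smaller weight. This is the
  measure by which repeated exchanges terminate.\<close>

lemma weighted_sum_swap_less:
  fixes d :: "nat \<Rightarrow> nat"
  assumes "1 \<le> c" "c < q" "q \<le> m" "d q < d c"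
  shows "(\<Sum>i\<in>{1..m}. (m - i) * (d \<circ> transpose c q) i) < (\<Sum>i\<in>{1..m}. (m - i) * d i)"
proof -
  have *: "{1..m} = insert c (insert q ({1..m} - {c, q}))"
    using assms by auto
  have split: "(\<Sum>i\<in>{1..m}. g i) = g c + (g q + (\<Sum>i\<in>{1..m} - {c, q}. g i))" for g :: "nat \<Rightarrow> nat"
    using assms by (subst *) simp
  have rest: "(\<Sum>i\<in>{1..m} - {c, q}. (m - i) * (d \<circ> transpose c q) i)
      = (\<Sum>i\<in>{1..m} - {c, q}. (m - i) * d i)"
    by (rule sum.cong) (auto simp: transpose_def)
  obtain e where e: "d c = d q + Suc e"
    using assms(4) less_iff_Suc_add by auto
  obtain f where f: "m - c = (m - q) + Suc f"
    using assms(2,3) less_iff_Suc_add[of "m - q" "m - c"] by auto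
  have "(m - c) * d q + (m - q) * d c < (m - c) * d c + (m - q) * d q"
    unfolding e f by (simp add: algebra_simps)
  then show ?thesis
    unfolding split rest by simp
qed

section \<open>Dense vectors and their minimal disorders\<close>

text \<open>
  An array supported on cells in distinct rows and columns is encoded by the vector of its
  column sums: \<open>P\<close> is the set of columns of the cells, and \<open>\<rho> p\<close> the row of the cell in
  column \<open>p\<close>.
\<close>

locale rows =
  fixes m :: nat and P :: "nat set" and \<rho> :: "nat \<Rightarrow> nat"
  assumes P_sub: "P \<subseteq> {1..m}" and inj_rho: "inj_on \<rho> P"
begin

lemma finite_P [simp]: "finite P"
  using P_sub finite_subset by blast

lemma P_bounds: "p \<in> P \<Longrightarrow> 1 \<le> p \<and> p \<le> m"
  using P_sub by auto

lemma rho_eq_iff: "p \<in> P \<Longrightarrow> q \<in> P \<Longrightarrow> \<rho> p = \<rho> q \<longleftrightarrow> p = q"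
  using inj_rho by (auto simp: inj_on_def)

definition dense :: "(nat \<Rightarrow> nat) \<Rightarrow> bool" where
  "dense d \<longleftrightarrow> (\<forall>j. j \<notin> P \<longrightarrow> d j = 0) \<and>
     (\<forall>p\<in>P. \<forall>q\<in>P. p < q \<and> \<rho> q < \<rho> p \<longrightarrow> d q \<le> d p)"

text \<open>The minimal DL-disorder condition for the cells \<open>(\<rho> c, c)\<close> and
  \<open>(\<rho> q, q)\<close>, read off the vector of column sums; see
  \<open>minimal_disorder_iff\<close>.\<close>

definition disorder :: "(nat \<Rightarrow> nat) \<Rightarrow> nat \<Rightarrow> nat \<Rightarrow> bool" where
  "disorder d c q \<longleftrightarrow> c \<in> P \<and> q \<in> P \<and> \<rho> c < \<rho> q \<and> c < q \<and> d q < d c \<and>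
     (\<forall>p\<in>P. ((\<rho> c < \<rho> p \<and> p < c \<or> \<rho> q < \<rho> p \<and> p < q) \<longrightarrow> d c \<le> d p) \<and>
            ((\<rho> p < \<rho> c \<and> c < p \<or> \<rho> p < \<rho> q \<and> q < p) \<longrightarrow> d p \<le> d q) \<and>
            (\<rho> c < \<rho> p \<and> \<rho> p < \<rho> q \<and> c < p \<and> p < q \<longrightarrow> \<not> (d q \<le> d p \<and> d p \<le> d c)))"

definition disorder_step :: "(nat \<Rightarrow> nat) \<Rightarrow> (nat \<Rightarrow> nat) \<Rightarrow> bool" where
  "disorder_step x z \<longleftrightarrow> (\<exists>c q. disorder x c q \<and> z = x \<circ> transpose c q)"

definition lead :: "(nat \<Rightarrow> nat) \<Rightarrow> (nat \<Rightarrow> nat) \<Rightarrow> nat \<Rightarrow> nat \<Rightarrow> bool" where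
  "lead x y a q \<longleftrightarrow> a \<in> P \<and> x a \<noteq> y a \<and> (\<forall>p\<in>P. \<rho> p < \<rho> a \<longrightarrow> x p = y p) \<and>
     q \<in> P \<and> a < q \<and> \<rho> a < \<rho> q \<and> y a \<le> x q \<and> x q < x a \<and>
     (\<forall>p\<in>P. a < p \<and> p < q \<and> \<rho> a < \<rho> p \<longrightarrow> \<not> (y a \<le> x p \<and> x p < x a))"

lemma dense_support: "dense d \<Longrightarrow> j \<notin> P \<Longrightarrow> d j = 0"
  by (simp add: dense_def)

lemma denseD: "dense d \<Longrightarrow> p \<in> P \<Longrightarrow> q \<in> P \<Longrightarrow> p < q \<Longrightarrow> \<rho> q < \<rho> p \<Longrightarrow> d q \<le> d p"
  by (simp add: dense_def)

lemma dense_eqI: "dense x \<Longrightarrow> dense y \<Longrightarrow> (\<And>p. p \<in> P \<Longrightarrow> x p = y p) \<Longrightarrow> x = y"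
  by (metis dense_support ext)

lemma disorderD:
  assumes "disorder d c q"
  shows "c \<in> P" "q \<in> P" "\<rho> c < \<rho> q" "c < q" "d q < d c" "1 \<le> c" "q \<le> m"
    "\<And>p. p \<in> P \<Longrightarrow> \<rho> c < \<rho> p \<Longrightarrow> p < c \<Longrightarrow> d c \<le> d p"
    "\<And>p. p \<in> P \<Longrightarrow> \<rho> q < \<rho> p \<Longrightarrow> p < q \<Longrightarrow> d c \<le> d p"
    "\<And>p. p \<in> P \<Longrightarrow> \<rho> p < \<rho> c \<Longrightarrow> c < p \<Longrightarrow> d p \<le> d q"
    "\<And>p. p \<in> P \<Longrightarrow> \<rho> p < \<rho> q \<Longrightarrow> q < p \<Longrightarrow> d p \<le> d q"
    "\<And>p. p \<in> P \<Longrightarrow> \<rho> c < \<rho> p \<Longrightarrow> \<rho> p < \<rho> q \<Longrightarrow> c < p \<Longrightarrow> p < q \<Longrightarrow> d q \<le> d p \<Longrightarrow> d c < d p"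
  using assms P_bounds unfolding disorder_def by (auto simp: not_le)

lemma leadD:
  assumes "lead x y a q"
  shows "a \<in> P" "x a \<noteq> y a" "\<And>p. p \<in> P \<Longrightarrow> \<rho> p < \<rho> a \<Longrightarrow> x p = y p"
    "q \<in> P" "a < q" "\<rho> a < \<rho> q" "y a \<le> x q" "x q < x a"
    "\<And>p. p \<in> P \<Longrightarrow> a < p \<Longrightarrow> p < q \<Longrightarrow> \<rho> a < \<rho> p \<Longrightarrow> y a \<le> x p \<Longrightarrow> x a \<le> x p"
  using assms unfolding lead_def by (auto simp: not_less)

text \<open>Only comparisons involving \<open>c\<close> or \<open>q\<close> can be spoiled, and
  those are covered by the inequalities that a minimal disorder imposes on the cells above and below
  the two exchanged ones.\<close>

lemma swap_dense:
  assumes "dense d" "disorder d c q"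
  shows "dense (d \<circ> transpose c q)"
proof -
  note m = disorderD[OF assms(2)] and D = denseD[OF assms(1)]
  have "(d \<circ> transpose c q) s \<le> (d \<circ> transpose c q) p"
    if ps: "p \<in> P" "s \<in> P" "p < s" "\<rho> s < \<rho> p" for p s
  proof -
    consider "p = c" | "p = q" "s = c" | "p = q" "s \<noteq> c" | "p \<notin> {c, q}" "s = c"
      | "p \<notin> {c, q}" "s = q" | "p \<notin> {c, q}" "s \<notin> {c, q}"
      by blast
    then show ?thesis
    proof cases
      case 1
      with ps m have "s \<noteq> q" "s \<noteq> c" by auto
      then show ?thesis using 1 m(10)[of s] ps by (simp add: transpose_def)
    next
      case 2
      then show ?thesis using ps m by simp
    next
      case 3
      then have "d s \<le> d q" using m(11)[OF ps(2)] ps by simp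
      then have "d s \<le> d c" using m(5) by simp
      then show ?thesis using 3 ps by (simp add: transpose_def)
    next
      case 4
      then show ?thesis using m(5) m(8)[of p] ps by (auto simp: transpose_def)
    next
      case 5
      then show ?thesis using m(9)[of p] ps by (auto simp: transpose_def)
    next
      case 6
      then show ?thesis using D ps by (auto simp: transpose_def)
    qed
  qed
  moreover have "\<forall>j. j \<notin> P \<longrightarrow> (d \<circ> transpose c q) j = 0"
    using dense_support[OF assms(1)] m(1,2) by (auto simp: transpose_def)
  ultimately show ?thesis
    unfolding dense_def by blast
qed

lemma swap_content: "disorder d c q \<Longrightarrow> content m (d \<circ> transpose c q) = content m d"
  using content_swap[of c m q d] disorderD[of d c q] by simp

lemma swap_dom_le: "disorder d c q \<Longrightarrow> dom_le d (d \<circ> transpose c q)"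
  using dom_le_swap[of c q d] disorderD(4,5,6) by blast

lemma swap_neq:
  assumes "disorder d c q"
  shows "d \<circ> transpose c q \<noteq> d"
proof
  assume "d \<circ> transpose c q = d"
  then have "(d \<circ> transpose c q) c = d c" by simp
  with disorderD(5)[OF assms] show False by simp
qed

lemma disorder_stepD:
  assumes "disorder_step x z" "dense x"
  shows "dense z" "content m z = content m x" "dom_le x z" "z \<noteq> x"
  using assms swap_dense swap_content swap_dom_le swap_neq unfolding disorder_step_def by auto

section \<open>Finding a minimal disorder towards a larger dense vector\<close>

lemma first_difference_le:
  assumes "dense x" "dense y" "dom_le x y" "a \<in> P"
    and low: "\<And>p. p \<in> P \<Longrightarrow> \<rho> p < \<rho> a \<Longrightarrow> x p = y p"
  shows "y a \<le> x a"
proof (rule ccontr)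
  assume "\<not> y a \<le> x a"
  then have less: "x a < y a" by simp
  \<comment> \<open>Each entry of \<open>x\<close> reaching \<open>y a\<close> in the first
    \<open>a\<close> columns is matched by \<open>y\<close>: in lower rows the vectors agree, in
    higher rows density of \<open>y\<close> applies. Column \<open>a\<close> counts only for
    \<open>y\<close>, against dominance.\<close>
  have "y a \<le> y i" if i: "i \<in> {1..a}" "y a \<le> x i" for i
  proof (cases "i = a")
    case False
    have "i \<in> P" using i less dense_support[OF assms(1)] by fastforce
    then consider "\<rho> i < \<rho> a" | "\<rho> a < \<rho> i"
      using False assms(4) rho_eq_iff by (meson linorder_neqE_nat)
    then show ?thesis
      using i low[of i] denseD[OF assms(2) \<open>i \<in> P\<close> assms(4)] \<open>i \<in> P\<close> False by cases auto
  qed simp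
  then have "{i \<in> {1..a}. y a \<le> x i} \<subseteq> {i \<in> {1..a}. y a \<le> y i} - {a}"
    using less by auto
  moreover have "a \<in> {i \<in> {1..a}. y a \<le> y i}"
    using P_bounds assms(4) by auto
  ultimately have "cnt x a (y a) < cnt y a (y a)"
    unfolding cnt_def by (intro psubset_card_mono) auto
  then show False
    using dom_leD[OF assms(3), of a "y a"] by simp
qed

text \<open>Otherwise every column where \<open>x\<close> takes a value in the window from
  \<open>y a\<close> up to, but excluding, \<open>x a\<close> is one where \<open>y\<close> does so
  too, and \<open>a\<close> is an additional one for \<open>y\<close>; equal contents forbid
  this.\<close>

lemma ex_lead_target:
  assumes "dense x" "dense y" "dom_le x y" "content m x = content m y" "a \<in> P" "x a \<noteq> y a"
    and low: "\<And>p. p \<in> P \<Longrightarrow> \<rho> p < \<rho> a \<Longrightarrow> x p = y p"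
  shows "\<exists>q\<in>P. a < q \<and> \<rho> a < \<rho> q \<and> y a \<le> x q \<and> x q < x a"
proof (rule ccontr)
  assume no: "\<not> ?thesis"
  have less: "y a < x a"
    using first_difference_le[OF assms(1-3,5) low] assms(6) by auto
  have "y a \<le> y i \<and> y i < x a" if i: "i \<in> {1..m}" "y a \<le> x i" "x i < x a" for i
  proof (cases "i \<in> P")
    case True
    have "i \<noteq> a" using i by auto
    then consider "\<rho> i < \<rho> a" | "\<rho> a < \<rho> i"
      using assms(5) True rho_eq_iff by (meson linorder_neqE_nat)
    then show ?thesis
    proof cases
      case 1
      then show ?thesis using i low[OF True] by auto
    next
      case 2
      then have "\<not> a < i" using no i True by blast
      then show ?thesis
        using denseD[OF assms(1) True assms(5)] 2 i \<open>i \<noteq> a\<close> by auto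
    qed
  next
    case False
    then show ?thesis
      using i dense_support[OF assms(1) False] dense_support[OF assms(2) False] by simp
  qed
  then have "{i \<in> {1..m}. y a \<le> x i \<and> x i < x a} \<subseteq> {i \<in> {1..m}. y a \<le> y i \<and> y i < x a} - {a}"
    by auto
  moreover have "a \<in> {i \<in> {1..m}. y a \<le> y i \<and> y i < x a}"
    using P_bounds[OF assms(5)] less by auto
  ultimately have "card {i \<in> {1..m}. y a \<le> x i \<and> x i < x a}
      < card {i \<in> {1..m}. y a \<le> y i \<and> y i < x a}"
    by (intro psubset_card_mono) auto
  then show False
    using card_content_cong[OF assms(4), of "\<lambda>v. y a \<le> v \<and> v < x a"] by simp
qed

lemma ex_lead:
  assumes "dense x" "dense y" "dom_le x y" "content m x = content m y" "x \<noteq> y"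
  shows "\<exists>a q. lead x y a q"
proof -
  obtain p0 where "p0 \<in> P \<and> x p0 \<noteq> y p0"
    using assms(5) dense_eqI[OF assms(1,2)] by blast
  then obtain a where a: "a \<in> P" "x a \<noteq> y a"
    and min: "\<And>p. p \<in> P \<Longrightarrow> x p \<noteq> y p \<Longrightarrow> \<rho> a \<le> \<rho> p"
    using ex_has_least_nat[of "\<lambda>p. p \<in> P \<and> x p \<noteq> y p" p0 \<rho>] by blast
  have low: "x p = y p" if "p \<in> P" "\<rho> p < \<rho> a" for p
    using min that not_le by blast
  let ?Q = "\<lambda>q. q \<in> P \<and> a < q \<and> \<rho> a < \<rho> q \<and> y a \<le> x q \<and> x q < x a"
  define q where "q = (LEAST q. ?Q q)"
  have ex: "\<exists>q. ?Q q"
    using ex_lead_target[OF assms(1-4) a low] by blast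
  have "?Q q"
    unfolding q_def using LeastI_ex[OF ex] .
  moreover have "\<not> ?Q p" if "p < q" for p
    using not_less_Least[of p ?Q] that unfolding q_def by blast
  ultimately have "lead x y a q"
    unfolding lead_def using a low by auto
  then show ?thesis by blast
qed

text \<open>The window count of \<open>ex_lead_target\<close>, now over the first \<open>k\<close>
  columns and for values below \<open>v\<close>. As \<open>x\<close> has fewer entries in the window
  but at least as many from \<open>y a\<close> upwards, its surplus lies at level \<open>v\<close>
  and above.\<close>

lemma lead_gap:
  assumes "dense x" "dom_le x y" "dense y" "lead x y a q"
    and "a \<le> k" "k < q" "x q < v" "v \<le> x a"
  shows "cnt y k v < cnt x k v"
proof -
  note l = leadD[OF assms(4)]
  have "y a \<le> y i \<and> y i < v" if i: "i \<in> {1..k}" "y a \<le> x i" "x i < v" for i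
  proof (cases "i \<in> P")
    case True
    have "i \<noteq> a" using i assms(8) by auto
    then consider "\<rho> i < \<rho> a" | "\<rho> a < \<rho> i"
      using l(1) True rho_eq_iff by (meson linorder_neqE_nat)
    then show ?thesis
    proof cases
      case 1
      then show ?thesis using i l(3)[OF True] by auto
    next
      case 2
      then show ?thesis
        using denseD[OF assms(1) True l(1)] l(9)[OF True] i \<open>i \<noteq> a\<close> assms(6,8) by fastforce
    qed
  next
    case False
    then show ?thesis
      using i dense_support[OF assms(1) False] dense_support[OF assms(3) False] by simp
  qed
  then have "{i \<in> {1..k}. y a \<le> x i \<and> x i < v} \<subseteq> {i \<in> {1..k}. y a \<le> y i \<and> y i < v} - {a}"
    using assms(8) by auto
  moreover have "a \<in> {i \<in> {1..k}. y a \<le> y i \<and> y i < v}"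
    using P_bounds[OF l(1)] assms(5,7) l(7) by auto
  ultimately have "card {i \<in> {1..k}. y a \<le> x i \<and> x i < v}
      < card {i \<in> {1..k}. y a \<le> y i \<and> y i < v}"
    by (intro psubset_card_mono) auto
  moreover have "y a \<le> v" using assms(7) l(7) by simp
  ultimately show ?thesis
    using cnt_split_value[of "y a" v x k] cnt_split_value[of "y a" v y k]
      dom_leD[OF assms(2), of k "y a"] by linarith
qed

lemma lead_swap_dom_le:
  assumes "dense x" "dom_le x y" "dense y" "lead x y a q" "a \<le> c" "c < q" "x c = x a"
  shows "dom_le (x \<circ> transpose c q) y"
proof (rule dom_le_swapI)
  note l = leadD[OF assms(4)]
  show "1 \<le> c" using P_bounds[OF l(1)] assms(5) by simp
  show "c < q" "x q < x c" "dom_le x y" using assms l(8) by simp_all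
  show "cnt y k v < cnt x k v" if "c \<le> k" "k < q" "x q < v" "v \<le> x c" for k v
    using lead_gap[OF assms(1-4)] that assms(5,7) by simp
qed

text \<open>
  With repeated values the leading pair \<open>(a, q)\<close> need not be a minimal disorder; the last
  column with value \<open>x a\<close> inside the rectangle spanned by the two cells replaces \<open>a\<close>.
\<close>

lemma ex_disorder:
  assumes "dense x" "dense y" "dom_le x y" "content m x = content m y" "lead x y a q"
  shows "\<exists>c. a \<le> c \<and> x c = x a \<and> disorder x c q \<and> dom_le (x \<circ> transpose c q) y"
proof -
  note l = leadD[OF assms(5)] and D = denseD[OF assms(1)]
  define C where "C = {c \<in> P. a \<le> c \<and> c < q \<and> \<rho> a \<le> \<rho> c \<and> \<rho> c < \<rho> q \<and> x c = x a}"
  have "finite C" "a \<in> C" unfolding C_def using l by auto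
  define c where "c = Max C"
  have "c \<in> C" unfolding c_def using \<open>finite C\<close> \<open>a \<in> C\<close> Max_in by blast
  then have c: "c \<in> P" "a \<le> c" "c < q" "\<rho> a \<le> \<rho> c" "\<rho> c < \<rho> q" "x c = x a"
    unfolding C_def by auto
  have maxc: "p \<notin> C" if "c < p" for p
    using that Max_ge[OF \<open>finite C\<close>, of p] unfolding c_def by fastforce
  have "disorder x c q"
    unfolding disorder_def
  proof (intro conjI ballI impI)
    fix p assume p: "p \<in> P"
    show "x c \<le> x p" if h: "\<rho> c < \<rho> p \<and> p < c \<or> \<rho> q < \<rho> p \<and> p < q"
    proof -
      consider "\<rho> c < \<rho> p" "p < c" | "\<rho> q < \<rho> p" "p < q" "a < p" | "\<rho> q < \<rho> p" "p < q" "p \<le> a"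
        using h by linarith
      then show ?thesis
      proof cases
        case 1
        then show ?thesis using D p c by blast
      next
        case 2
        then have "x q \<le> x p" using D[OF p l(4)] by blast
        then show ?thesis using l(6,7) l(9)[OF p] 2 c(6) by auto
      next
        case 3
        then show ?thesis using D[OF p l(1)] l(6) c(6) by (cases "p = a") auto
      qed
    qed
    show "x p \<le> x q" if "\<rho> p < \<rho> c \<and> c < p \<or> \<rho> p < \<rho> q \<and> q < p"
    proof (cases "\<rho> p < \<rho> q \<and> q < p")
      case True
      then show ?thesis using D[OF l(4) p] by blast
    next
      case False
      with that have lt: "\<rho> p < \<rho> c" "c < p" by auto
      then consider "p = q" | "p < q" "\<rho> p < \<rho> a" | "p < q" "\<rho> a < \<rho> p"
        using False c(2,5) rho_eq_iff[OF p l(1)] by (metis less_trans linorder_neqE_nat not_le)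
      then show ?thesis
      proof cases
        case 2
        then have "y p \<le> y a" using denseD[OF assms(2) l(1) p] lt c(2) by auto
        then show ?thesis using l(3)[OF p] 2 l(7) by auto
      next
        case 3
        \<comment> \<open>The value at \<open>p\<close> is at most \<open>x a\<close> by density at
          \<open>c\<close> and differs from it by the choice of \<open>c\<close>. Since
          \<open>q\<close> is the first column to hit the window, a value below \<open>x a\<close>
          is even below \<open>y a\<close>, hence below \<open>x q\<close>.\<close>
        have "x p \<noteq> x a"
          using maxc[OF lt(2)] 3 p lt c(2,5) unfolding C_def by auto
        moreover have "x p \<le> x a"
          using D[OF c(1) p] lt c(6) by auto
        ultimately show ?thesis
          using l(7) l(9)[OF p] 3 lt c(2) by linarith
      qed auto
    qed
    show "\<not> (x q \<le> x p \<and> x p \<le> x c)" if "\<rho> c < \<rho> p \<and> \<rho> p < \<rho> q \<and> c < p \<and> p < q"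
    proof
      assume v: "x q \<le> x p \<and> x p \<le> x c"
      then have "x a \<le> x p" using l(7) l(9)[OF p] that c(2,4) by auto
      then have "x p = x a" using v c(6) by simp
      then show False using maxc[of p] that p c unfolding C_def by auto
    qed
  qed (use c l in auto)
  then show ?thesis
    using lead_swap_dom_le[OF assms(1,3,2,5) c(2,3,6)] c by blast
qed

lemma ex_disorder_step:
  assumes "dense x" "dense y" "dom_le x y" "content m x = content m y" "x \<noteq> y"
  shows "\<exists>z. disorder_step x z \<and> dom_le z y"
  using ex_lead[OF assms] ex_disorder[OF assms(1-4)] unfolding disorder_step_def by blast

lemma disorder_step_weight_less:
  assumes "disorder_step x z"
  shows "(\<Sum>i\<in>{1..m}. (m - i) * z i) < (\<Sum>i\<in>{1..m}. (m - i) * x i)"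
  using assms weighted_sum_swap_less disorderD(4,5,6,7) unfolding disorder_step_def by blast

lemma disorder_step_rtranclpI:
  assumes "dense x" "dense y" "dom_le x y" "content m x = content m y"
  shows "disorder_step\<^sup>*\<^sup>* x y"
  using assms
proof (induction "\<Sum>i\<in>{1..m}. (m - i) * x i" arbitrary: x rule: less_induct)
  case less
  show ?case
  proof (cases "x = y")
    case False
    then obtain z where z: "disorder_step x z" "dom_le z y"
      using ex_disorder_step less.prems by blast
    then have "disorder_step\<^sup>*\<^sup>* z y"
      using less.hyps[OF disorder_step_weight_less[OF z(1)]] disorder_stepD[OF z(1) less.prems(1)] less.prems
      by auto
    with z(1) show ?thesis by (rule converse_rtranclp_into_rtranclp)
  qed simp
qed

lemma disorder_step_imp_bruhat_step: "disorder_step x z \<Longrightarrow> bruhat_step m x z"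
  unfolding disorder_step_def bruhat_step_def using disorderD(4,5,6,7) by blast

lemma disorder_step_rtranclp_imp_bruhat: "disorder_step\<^sup>*\<^sup>* x z \<Longrightarrow> bruhat m x z"
  unfolding bruhat_def by (rule rtranclp_mono[THEN predicate2D]) (auto intro: disorder_step_imp_bruhat_step)

section \<open>Minimal disorders are the covering relations\<close>

lemma swap_rectangle_subset:
  assumes "disorder x c q" "disorder x c' q'" "dom_le (x \<circ> transpose c' q') (x \<circ> transpose c q)"
  shows "c \<le> c'" "q' \<le> q" "x q \<le> x q'" "x c' \<le> x c"
proof -
  note m = disorderD[OF assms(1)] and m' = disorderD[OF assms(2)]
  have *: "c \<le> k \<and> k < q \<and> x q < v \<and> v \<le> x c"
    if "c' \<le> k" "k < q'" "x q' < v" "v \<le> x c'" for k v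
    using dom_leD[OF assms(3), of k v] cnt_swap[where d = x and k = k and v = v, OF m(6,4,5)]
      cnt_swap[where d = x and k = k and v = v, OF m'(6,4,5)] that by (auto split: if_splits)
  \<comment> \<open>The inclusion is tested at corners of the inner rectangle. The last column is
    \<open>q' - 1\<close> and the first level \<open>Suc (x q')\<close>, because the rectangle
    contains neither the column \<open>q'\<close> nor the level \<open>x q'\<close>.\<close>
  show "c \<le> c'" using *[of c' "x c'"] m' by auto
  show "q' \<le> q" using *[of "q' - 1" "x c'"] m'(4,5) by linarith
  show "x q \<le> x q'" using *[of c' "Suc (x q')"] m' by auto
  show "x c' \<le> x c" using *[of c' "x c'"] m' by auto
qed

text \<open>If the rectangles are nested but different, a cell of the inner disorder stands strictly
  between the columns of the outer one, with a value that the outer minimality forbids, whatever its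
  row.\<close>

lemma disorder_rectangle_unique:
  assumes "disorder x c q" "disorder x c' q'" "dom_le (x \<circ> transpose c' q') (x \<circ> transpose c q)"
  shows "c' = c \<and> q' = q"
proof -
  note m = disorderD[OF assms(1)] and m' = disorderD[OF assms(2)]
  note r = swap_rectangle_subset[OF assms]
  have "c' = c"
  proof (rule ccontr)
    assume "c' \<noteq> c"
    then have "c < c'" "c' < q" using r m' by auto
    consider "\<rho> c' < \<rho> c" | "\<rho> c < \<rho> c'" "\<rho> c' < \<rho> q" | "\<rho> q < \<rho> c'"
      using rho_eq_iff[OF m'(1) m(1)] rho_eq_iff[OF m'(1) m(2)] \<open>c' \<noteq> c\<close> \<open>c' < q\<close>
      by (metis linorder_neqE_nat less_irrefl)
    then show False
    proof cases
      case 1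
      then show ?thesis using m(10)[OF m'(1)] \<open>c < c'\<close> m'(5) r(3) by auto
    next
      case 2
      then show ?thesis using m(12)[OF m'(1)] \<open>c < c'\<close> \<open>c' < q\<close> m'(5) r(3,4) by auto
    next
      case 3
      then have "\<rho> q < \<rho> q'" using m'(3) by simp
      then have "q' < q" using r(2) by (cases "q' = q") auto
      then show ?thesis using m(9)[OF m'(2) \<open>\<rho> q < \<rho> q'\<close>] m'(5) r(4) by auto
    qed
  qed
  moreover have "q' = q"
  proof (rule ccontr)
    assume "q' \<noteq> q"
    then have "q' < q" "c < q'" using r m' by auto
    consider "\<rho> q' < \<rho> q" | "\<rho> q < \<rho> q'"
      using rho_eq_iff[OF m'(2) m(2)] \<open>q' \<noteq> q\<close> by (metis linorder_neqE_nat)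
    then show False
    proof cases
      case 1
      then show ?thesis
        using m(12)[OF m'(2)] \<open>q' < q\<close> \<open>c < q'\<close> r(3) m'(3,5) \<open>c' = c\<close> by auto
    next
      case 2
      then show ?thesis using m(9)[OF m'(2)] \<open>q' < q\<close> m'(5) r(4) by auto
    qed
  qed
  ultimately show ?thesis by blast
qed

definition vecs :: "nat multiset \<Rightarrow> (nat \<Rightarrow> nat) set" where
  "vecs M = {d. dense d \<and> content m d = M}"

lemma vecs_iff: "d \<in> vecs M \<longleftrightarrow> dense d \<and> content m d = M"
  by (simp add: vecs_def)

lemma disorder_step_rtranclp_iff:
  assumes "x \<in> vecs M" "y \<in> vecs M"
  shows "disorder_step\<^sup>*\<^sup>* x y \<longleftrightarrow> dom_le x y"
proof
  assume "disorder_step\<^sup>*\<^sup>* x y"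
  then show "dom_le x y"
    by (blast dest: disorder_step_rtranclp_imp_bruhat bruhat_imp_dom_le)
next
  assume "dom_le x y"
  then show "disorder_step\<^sup>*\<^sup>* x y"
    by (intro disorder_step_rtranclpI) (use assms in \<open>simp_all add: vecs_iff\<close>)
qed

lemma bruhat_iff_dom_le:
  assumes "x \<in> vecs M" "y \<in> vecs M"
  shows "bruhat m x y \<longleftrightarrow> dom_le x y"
proof
  assume "bruhat m x y"
  then show "dom_le x y"
    by (blast dest: bruhat_imp_dom_le)
next
  assume "dom_le x y"
  then show "bruhat m x y"
    by (intro disorder_step_rtranclp_imp_bruhat) (simp add: disorder_step_rtranclp_iff[OF assms])
qed

lemma vecs_antisym: "x \<in> vecs M \<Longrightarrow> y \<in> vecs M \<Longrightarrow> dom_le x y \<Longrightarrow> dom_le y x \<Longrightarrow> x = y"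
  using dense_support[of x 0] dense_support[of y 0] P_bounds[of 0]
  by (cases "0 \<in> P") (auto simp: vecs_def intro: dom_le_antisym)

text \<open>Some minimal disorder always leads towards a given larger vector, so a cover must come
  from one. Conversely, an element between \<open>x\<close> and \<open>z\<close> lies above such an
  exchange \<open>u\<close>; the rectangles of \<open>u\<close> and \<open>z\<close> are nested,
  whence \<open>u = z\<close>.\<close>

lemma covers_vecs_iff:
  assumes x: "x \<in> vecs M"
  shows "covers (vecs M) (bruhat m) x z \<longleftrightarrow> disorder_step x z"
proof
  assume cov: "covers (vecs M) (bruhat m) x z"
  then have z: "z \<in> vecs M" "dom_le x z" "x \<noteq> z"
    using bruhat_iff_dom_le[OF x] unfolding covers_def by auto
  then obtain w where w: "disorder_step x w" "dom_le w z"
    using ex_disorder_step x unfolding vecs_def by auto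
  have wv: "w \<in> vecs M" "dom_le x w" "w \<noteq> x"
    using disorder_stepD[OF w(1)] x unfolding vecs_def by auto
  then have "w = z"
    using cov w(2) bruhat_iff_dom_le x z unfolding covers_def by blast
  then show "disorder_step x z" using w by simp
next
  assume z: "disorder_step x z"
  have zv: "z \<in> vecs M" "dom_le x z" "z \<noteq> x"
    using disorder_stepD[OF z] x unfolding vecs_def by auto
  have "w = z" if w: "w \<in> vecs M" "w \<noteq> x" "dom_le x w" "dom_le w z" for w
  proof -
    obtain u where u: "disorder_step x u" "dom_le u w"
      using ex_disorder_step[of x w] x w unfolding vecs_def by auto
    have "dom_le u z" using u w dom_le_trans by blast
    then have "u = z"
      using u(1) z disorder_rectangle_unique unfolding disorder_step_def by blast
    then show ?thesis using u(2) w zv vecs_antisym by blast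
  qed
  then show "covers (vecs M) (bruhat m) x z"
    using x zv bruhat_iff_dom_le unfolding covers_def by blast
qed

end

section \<open>Parts and ranks\<close>

lemma part_antimono:
  assumes "is_partition lam" "1 \<le> l" "l \<le> l'"
  shows "part lam l' \<le> part lam l"
proof (cases "l' \<le> length lam \<and> l < l'")
  case True
  then have "lam ! (l' - 1) \<le> lam ! (l - 1)"
    using assms sorted_wrt_nth_less[of "(\<ge>)" lam "l - 1" "l' - 1"]
    unfolding is_partition_def by auto
  then show ?thesis using True assms by (simp add: part_def)
next
  case False
  then show ?thesis using assms by (cases "l = l'") (auto simp: part_def)
qed

lemma part_strict_antimono:
  assumes "regular_partition mu" "1 \<le> l" "l < l'" "l' \<le> length mu"
  shows "part mu l' < part mu l"
  using assms sorted_wrt_nth_less[of "(>)" mu "l - 1" "l' - 1"]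
  unfolding regular_partition_def part_def by auto

lemma part_pos:
  assumes "is_partition lam" "1 \<le> l" "l \<le> length lam"
  shows "0 < part lam l"
proof -
  have "lam ! (l - 1) \<in> set lam" using assms by simp
  then show ?thesis
    using assms unfolding is_partition_def part_def by (metis neq0_conv)
qed

lemma image_part_mset: "image_mset (part lam) (mset_set {1..length lam}) = mset lam"
proof -
  have "mset_set {1..length lam} = image_mset Suc (mset_set {0..<length lam})"
    by (subst image_mset_mset_set) (simp_all add: image_Suc_atLeastLessThan atLeastLessThanSuc_atLeastAtMost)
  then have "image_mset (part lam) (mset_set {1..length lam})
      = image_mset (\<lambda>i. lam ! i) (mset_set {0..<length lam})"
    by (auto simp: part_def image_mset.compositionality intro!: image_mset_cong)
  also have "\<dots> = mset (map (\<lambda>i. lam ! i) [0..<length lam])"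
    by (simp only: mset_map mset_upt)
  finally show ?thesis by (simp add: map_nth)
qed

text \<open>Reaching level \<open>v\<close> thus becomes having small rank. The range is cut at
  \<open>N\<close> because every index reaches level 0.\<close>

lemma part_threshold:
  assumes "is_partition lam"
  shows "\<exists>t. \<forall>l\<in>{1..N}. v \<le> part lam l \<longleftrightarrow> l \<le> t"
proof (cases "\<exists>l\<in>{1..N}. \<not> v \<le> part lam l")
  case False
  then show ?thesis by (intro exI[of _ N]) auto
next
  case True
  define s where "s = (LEAST l. l \<in> {1..N} \<and> \<not> v \<le> part lam l)"
  have s: "s \<in> {1..N} \<and> \<not> v \<le> part lam s"
    unfolding s_def using True LeastI_ex[of "\<lambda>l. l \<in> {1..N} \<and> \<not> v \<le> part lam l"] by blast
  have "v \<le> part lam l" if "l \<in> {1..N}" "l < s" for l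
    using not_less_Least[of l "\<lambda>l. l \<in> {1..N} \<and> \<not> v \<le> part lam l"] that unfolding s_def by blast
  moreover have "\<not> v \<le> part lam l" if "l \<in> {1..N}" "s \<le> l" for l
    using part_antimono[OF assms, of s l] s that by auto
  ultimately have "v \<le> part lam l \<longleftrightarrow> l \<le> s - 1" if "l \<in> {1..N}" for l
    using s that by (cases "l < s") auto
  then show ?thesis by blast
qed

lemma dom_leI:
  assumes "\<And>i. i \<notin> {1..m} \<Longrightarrow> a i = 0" "\<And>i. i \<notin> {1..m} \<Longrightarrow> b i = 0"
    and "\<And>k v. k \<le> m \<Longrightarrow> 1 \<le> v \<Longrightarrow> cnt b k v \<le> cnt a k v"
  shows "dom_le a b"
  unfolding dom_le_def
proof (intro allI)
  fix k v
  have *: "cnt d k v = cnt d m v" if "m \<le> k" "1 \<le> v" "\<And>i. i \<notin> {1..m} \<Longrightarrow> d i = 0" for d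
  proof -
    have "{i \<in> {Suc m..k}. v \<le> d i} = {}" using that(2) that(3) by fastforce
    then show ?thesis using cnt_split[OF that(1), of d v] by simp
  qed
  show "cnt b k v \<le> cnt a k v"
  proof (cases "v = 0")
    case False
    then show ?thesis
      using assms(3)[of k v] assms(3)[of m v] *[of a, OF _ _ assms(1)] *[of b, OF _ _ assms(2)]
      by (cases "k \<le> m") simp_all
  qed simp
qed

section \<open>Writing the parts of a partition in a prescribed order\<close>

context rows
begin

definition rank :: "(nat \<Rightarrow> nat) \<Rightarrow> nat \<Rightarrow> nat" where
  "rank g j = card {p \<in> P. g j \<le> g p}"

text \<open>One construction for all vectors needed later: \<open>g j = m - j\<close> gives the
  least one, \<open>\<rho>\<close> the greatest, a vector with distinct entries its relabelling, and
  \<open>key\<close> the section of relabelling.\<close>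

definition fill :: "nat list \<Rightarrow> (nat \<Rightarrow> nat) \<Rightarrow> nat \<Rightarrow> nat" where
  "fill lam g j = (if j \<in> P then part lam (rank g j) else 0)"

lemma rank_less:
  assumes "p \<in> P" "g p < g q"
  shows "rank g q < rank g p"
  unfolding rank_def
proof (rule psubset_card_mono)
  have "{t \<in> P. g q \<le> g t} \<subseteq> {t \<in> P. g p \<le> g t} - {p}" using assms by auto
  moreover have "p \<in> {t \<in> P. g p \<le> g t}" using assms by simp
  ultimately show "{t \<in> P. g q \<le> g t} \<subset> {t \<in> P. g p \<le> g t}" by blast
qed simp

lemma rank_le_iff:
  assumes "p \<in> P" "q \<in> P"
  shows "rank g p \<le> rank g q \<longleftrightarrow> g q \<le> g p"
proof
  assume "g q \<le> g p"
  then show "rank g p \<le> rank g q"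
    unfolding rank_def by (intro card_mono) auto
qed (use rank_less[of p g q] assms(1) in \<open>force simp: not_le[symmetric]\<close>)

lemma rank_range:
  assumes "p \<in> P"
  shows "1 \<le> rank g p" "rank g p \<le> card P"
proof -
  have "card {p} \<le> rank g p" unfolding rank_def using assms by (intro card_mono) auto
  then show "1 \<le> rank g p" by simp
  show "rank g p \<le> card P" unfolding rank_def by (intro card_mono) auto
qed

lemma card_P_le: "card P \<le> m"
  using card_mono[OF _ P_sub] by simp

lemma bij_rank:
  assumes "inj_on g P"
  shows "bij_betw (rank g) P {1..card P}"
proof -
  have inj: "inj_on (rank g) P"
    using assms rank_le_iff unfolding inj_on_def by (metis order_refl le_antisym)
  moreover have "rank g ` P \<subseteq> {1..card P}" using rank_range by auto
  ultimately have "rank g ` P = {1..card P}"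
    by (intro card_subset_eq) (simp_all add: card_image)
  with inj show ?thesis by (simp add: bij_betw_def)
qed

lemma content_supported:
  assumes "\<And>j. j \<notin> P \<Longrightarrow> d j = 0"
  shows "content m d = image_mset d (mset_set P) + replicate_mset (m - card P) 0"
proof -
  have "{1..m} = P \<union> ({1..m} - P)" using P_sub by blast
  then have "content m d = image_mset d (mset_set P) + image_mset d (mset_set ({1..m} - P))"
    unfolding content_def by (metis Diff_disjoint finite_Diff finite_P finite_atLeastAtMost
        image_mset_union mset_set_Union)
  also have "image_mset d (mset_set ({1..m} - P)) = image_mset (\<lambda>_. 0) (mset_set ({1..m} - P))"
    by (rule image_mset_cong) (simp add: assms)
  finally show ?thesis
    using P_sub by (simp add: card_Diff_subset image_mset_const_eq)
qed

lemma content_part: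
  assumes "length lam \<le> card P"
  shows "content m (part lam)
    = image_mset (part lam) (mset_set {1..card P}) + replicate_mset (m - card P) 0"
proof -
  \<comment> \<open>\<open>part lam\<close> is itself a vector supported on the first
    \<open>card P\<close> columns, so \<open>content_supported\<close> applies with these in the
    role of \<open>P\<close>.\<close>
  interpret R: rows m "{1..card P}" id
    using card_P_le by unfold_locales auto
  have "image_mset (part lam) (mset_set {1..card P})
      = image_mset (\<lambda>j. if j \<in> {1..card P} then part lam j else 0) (mset_set {1..card P})"
    by (rule image_mset_cong) auto
  moreover have "content m (part lam) = content m (\<lambda>j. if j \<in> {1..card P} then part lam j else 0)"
    unfolding content_def using assms by (intro image_mset_cong) (auto simp: part_def)
  ultimately show ?thesis
    using R.content_supported[of "\<lambda>j. if j \<in> {1..card P} then part lam j else 0"] by (simp del: atLeastAtMost_iff)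
qed

abbreviation lvecs :: "nat list \<Rightarrow> (nat \<Rightarrow> nat) set" where
  "lvecs lam \<equiv> vecs (content m (part lam))"

text \<open>The sizes agree, so the nonzero entries determine the number of zeros as well. This
  links \<open>DL\<close>, which records nonzero values only, to orbits of padded
  partitions.\<close>

lemma content_iff:
  assumes "\<And>j. j \<notin> P \<Longrightarrow> d j = 0" "length lam \<le> card P" "is_partition lam"
  shows "content m d = content m (part lam) \<longleftrightarrow>
    filter_mset (\<lambda>x. x \<noteq> 0) (image_mset d (mset_set P)) = mset lam"
proof -
  have eqI: "M = M'" if "size M = size M'"
      "filter_mset (\<lambda>x. x \<noteq> 0) M = filter_mset (\<lambda>x. x \<noteq> 0) M'" for M M' :: "nat multiset"
  proof -
    have split: "M = filter_mset (\<lambda>x. x \<noteq> 0) M + replicate_mset (count M 0) 0"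
      for M :: "nat multiset"
      using multiset_partition[of M "\<lambda>x. x \<noteq> 0"] by (simp add: filter_eq_replicate_mset)
    have "count M 0 = count M' 0"
      using arg_cong[OF split[of M], of size] arg_cong[OF split[of M'], of size] that by simp
    then show ?thesis using split[of M] split[of M'] that(2) by simp
  qed
  have lam: "filter_mset (\<lambda>x. x \<noteq> 0) (mset lam) = mset lam"
    using assms(3) unfolding is_partition_def by (auto simp: filter_mset_eq_conv intro: gr0I)
  have "filter_mset (\<lambda>x. x \<noteq> 0) (image_mset (part lam) (mset_set {1..card P})) = mset lam"
  proof -
    interpret R: rows "card P" "{1..length lam}" id
      using assms(2) by unfold_locales auto
    have "content (card P) (part lam) = mset lam + replicate_mset (card P - length lam) 0"
      using R.content_part[of lam] by (simp add: image_part_mset[simplified])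
    then show ?thesis
      using lam unfolding content_def by simp
  qed
  moreover have "content m d = content m (part lam) \<longleftrightarrow>
      image_mset d (mset_set P) = image_mset (part lam) (mset_set {1..card P})"
    by (simp add: content_supported[OF assms(1)] content_part[OF assms(2)])
  ultimately show ?thesis
    using eqI[of "image_mset d (mset_set P)" "image_mset (part lam) (mset_set {1..card P})"]
    by auto
qed

lemma content_fill:
  assumes "inj_on g P" "length lam \<le> card P"
  shows "content m (fill lam g) = content m (part lam)"
proof -
  have "image_mset (fill lam g) (mset_set P) = image_mset (part lam) (image_mset (rank g) (mset_set P))"
    by (auto simp: fill_def image_mset.compositionality intro!: image_mset_cong)
  also have "image_mset (rank g) (mset_set P) = mset_set {1..card P}"
    using bij_rank[OF assms(1)] by (simp add: bij_betw_def image_mset_mset_set)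
  finally show ?thesis
    using content_supported[of "fill lam g"] content_part[OF assms(2)] by (simp add: fill_def[abs_def])
qed

lemma fill_mono:
  assumes "is_partition lam" "p \<in> P" "q \<in> P" "g p \<le> g q"
  shows "fill lam g p \<le> fill lam g q"
  using part_antimono[OF assms(1), of "rank g q" "rank g p"] rank_le_iff[of q p g] rank_range assms(2-4)
  by (simp add: fill_def)

lemma fill_in_lvecs:
  assumes "is_partition lam" "length lam \<le> card P" "inj_on g P"
    and "\<And>p q. p \<in> P \<Longrightarrow> q \<in> P \<Longrightarrow> p < q \<Longrightarrow> \<rho> q < \<rho> p \<Longrightarrow> g q \<le> g p"
  shows "fill lam g \<in> lvecs lam"
  unfolding vecs_iff dense_def
  using content_fill[OF assms(3,2)] fill_mono[OF assms(1)] assms(4) by (auto simp: fill_def)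

text \<open>Counting pins down the entry at \<open>j\<close> from both sides: all columns of rank up
  to that of \<open>j\<close> hold at least \<open>d j\<close>, and only columns of strictly smaller
  rank can hold more.\<close>

lemma fill_eqI:
  assumes "is_partition lam" "d \<in> lvecs lam"
    and mono: "\<And>p q. p \<in> P \<Longrightarrow> q \<in> P \<Longrightarrow> g p \<le> g q \<Longrightarrow> d p \<le> d q"
    and inj: "inj_on g P"
  shows "fill lam g = d"
proof
  fix j
  have d: "dense d" "content m d = content m (part lam)"
    using assms(2) by (auto simp: vecs_iff)
  show "fill lam g j = d j"
  proof (cases "j \<in> P")
    case True
    let ?l = "rank g j"
    have l: "1 \<le> ?l" "?l \<le> m" using rank_range[OF True] card_P_le le_trans by blast+
    have "\<not> part lam ?l < d j"
    proof
      assume less: "part lam ?l < d j"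
      have "?l \<le> card {i \<in> {1..m}. d j \<le> d i}"
        unfolding rank_def using P_sub mono True by (intro card_mono) auto
      also have "\<dots> = card {l \<in> {1..m}. d j \<le> part lam l}"
        by (rule card_content_cong[OF d(2)])
      also have "\<dots> \<le> card {1..<?l}"
      proof (rule card_mono)
        have "l < ?l" if "d j \<le> part lam l" for l
          using that less part_antimono[OF assms(1) l(1), of l] by (cases "l < ?l") simp_all
        then show "{l \<in> {1..m}. d j \<le> part lam l} \<subseteq> {1..<?l}" by auto
      qed simp
      finally show False using l by simp
    qed
    moreover have "\<not> d j < part lam ?l"
    proof
      assume less: "d j < part lam ?l"
      have "card {1..?l} \<le> card {l \<in> {1..m}. d j < part lam l}"
        using less part_antimono[OF assms(1)] l by (intro card_mono) (fastforce)+
      also have "\<dots> = card {i \<in> {1..m}. d j < d i}"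
        by (rule card_content_cong[OF d(2), symmetric])
      also have "\<dots> \<le> card ({p \<in> P. g j \<le> g p} - {j})"
      proof (rule card_mono)
        have "i \<in> P \<and> g j \<le> g i" if "d j < d i" for i
          using that dense_support[OF d(1), of i] mono[of i j] True by (metis nat_le_linear not_less_zero not_le)
        then show "{i \<in> {1..m}. d j < d i} \<subseteq> {p \<in> P. g j \<le> g p} - {j}" by auto
      qed simp
      also have "\<dots> < card {p \<in> P. g j \<le> g p}"
        using True by (intro card_Diff1_less) auto
      finally show False unfolding rank_def by simp
    qed
    ultimately show ?thesis using True by (simp add: fill_def)
  next
    case False
    then show ?thesis using dense_support[OF d(1)] by (simp add: fill_def)
  qed
qed

text \<open>The multiset of entries on \<open>P\<close> consists of \<open>card P\<close> distinct
  positive parts, which leaves room for neither a repetition nor a zero.\<close>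

lemma inj_on_regular:
  assumes "regular_partition mu" "length mu = card P" "d \<in> lvecs mu"
  shows "inj_on d P" "\<And>p. p \<in> P \<Longrightarrow> 0 < d p"
proof -
  have mu: "is_partition mu" using assms(1) by (simp add: regular_partition_def)
  have d: "dense d" "content m d = content m (part mu)"
    using assms(3) by (auto simp: vecs_iff)
  have "image_mset d (mset_set P) = image_mset (part mu) (mset_set {1..card P})"
    using d content_supported[OF dense_support[OF d(1)]] content_part[of mu] assms(2) by simp
  also have "\<dots> = mset_set (part mu ` {1..card P})"
  proof (rule image_mset_mset_set)
    show "inj_on (part mu) {1..card P}"
      by (rule linorder_inj_onI)
        (use part_strict_antimono[OF assms(1)] assms(2) in \<open>fastforce+\<close>)
  qed
  finally have eq: "image_mset d (mset_set P) = mset_set (part mu ` {1..card P})" .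
  have "d ` P = part mu ` {1..card P}"
    using arg_cong[OF eq, of set_mset] by simp
  moreover have "card (part mu ` {1..card P}) = card P"
    using arg_cong[OF eq, of size] by simp
  ultimately show "inj_on d P"
    by (intro eq_card_imp_inj_on) simp_all
  show "0 < d p" if "p \<in> P" for p
  proof -
    have "d p \<in> part mu ` {1..card P}"
      using \<open>d ` P = part mu ` {1..card P}\<close> that by blast
    then show ?thesis using part_pos[OF mu] assms(2) by auto
  qed
qed

lemma fill_self:
  assumes "regular_partition mu" "length mu = card P" "d \<in> lvecs mu"
  shows "fill mu d = d"
  using fill_eqI[OF _ assms(3)] inj_on_regular(1)[OF assms] assms(1)
  by (simp add: regular_partition_def)

lemma rank_fill:
  assumes "regular_partition mu" "length mu = card P" "inj_on g P" "j \<in> P"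
  shows "rank (fill mu g) j = rank g j"
proof -
  have mu: "is_partition mu" using assms(1) by (simp add: regular_partition_def)
  have "fill mu g j \<le> fill mu g p \<longleftrightarrow> g j \<le> g p" if "p \<in> P" for p
  proof
    assume le: "fill mu g j \<le> fill mu g p"
    show "g j \<le> g p"
    proof (rule ccontr)
      assume "\<not> g j \<le> g p"
      then have "rank g j < rank g p" using rank_less[OF that, of g j] by simp
      then have "fill mu g p < fill mu g j"
        using part_strict_antimono[OF assms(1)] rank_range that assms(2,4) by (simp add: fill_def)
      then show False using le by simp
    qed
  qed (use fill_mono[OF mu assms(4) that] in blast)
  then show ?thesis unfolding rank_def by (intro arg_cong[of _ _ card]) auto
qed

lemma fill_fill:
  assumes "regular_partition mu" "length mu = card P" "inj_on g P"
  shows "fill lam (fill mu g) = fill lam g"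
  using rank_fill[OF assms] by (auto simp: fill_def)

section \<open>The least and the greatest dense vector\<close>

lemma fill_bottom_dom_le:
  assumes "is_partition lam" "length lam \<le> card P" "x \<in> lvecs lam"
  shows "dom_le (fill lam (\<lambda>j. m - j)) x"
proof (rule dom_leI[of m])
  let ?g = "\<lambda>j. m - j" let ?B = "fill lam (\<lambda>j. m - j)"
  have inj: "inj_on ?g P"
  proof (rule inj_onI)
    fix a b assume "a \<in> P" "b \<in> P" "m - a = m - b"
    then show "a = b" using P_bounds[of a] P_bounds[of b] by linarith
  qed
  have x: "dense x" "content m x = content m ?B"
    using assms(3) content_fill[OF inj assms(2)] by (auto simp: vecs_iff)
  show "?B i = 0" "x i = 0" if "i \<notin> {1..m}" for i
    using subsetD[OF P_sub, of i] that dense_support[OF x(1), of i] by (auto simp: fill_def)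
  fix k v :: nat assume "1 \<le> v"
  have sub: "{i \<in> {1..k}. v \<le> x i} \<subseteq> {i \<in> P. i \<le> k \<and> v \<le> x i}"
    using \<open>1 \<le> v\<close> dense_support[OF x(1)] by fastforce
  show "cnt x k v \<le> cnt ?B k v"
  \<comment> \<open>The filling decreases along \<open>P\<close>. If it has dropped below
    \<open>v\<close> by column \<open>k\<close>, the prefix already contains all entries reaching
    \<open>v\<close>; otherwise every column of \<open>P\<close> in the prefix counts.\<close>
  proof (cases "\<exists>i\<in>P. i \<le> k \<and> ?B i < v")
    case True
    then obtain i where i: "i \<in> P" "i \<le> k" "?B i < v" by blast
    have "cnt x k v \<le> card {i \<in> {1..m}. v \<le> x i}"
      unfolding cnt_def using sub P_sub by (intro card_mono) auto
    also have "\<dots> = card {i \<in> {1..m}. v \<le> ?B i}"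
      by (rule card_content_cong[OF x(2)])
    also have "\<dots> \<le> cnt ?B k v"
      unfolding cnt_def
    proof (rule card_mono)
      have "j \<le> k" if "v \<le> ?B j" for j
      proof (rule ccontr)
        assume "\<not> j \<le> k"
        moreover have "j \<in> P" using that \<open>1 \<le> v\<close> by (cases "j \<in> P") (simp_all add: fill_def)
        ultimately have "?B j \<le> ?B i"
          using fill_mono[OF assms(1) _ i(1), of j ?g] i(2) by simp
        then show False using that i(3) by simp
      qed
      then show "{i \<in> {1..m}. v \<le> ?B i} \<subseteq> {i \<in> {1..k}. v \<le> ?B i}" by auto
    qed simp
    finally show ?thesis .
  next
    case False
    then show ?thesis
      unfolding cnt_def using sub by (intro card_mono) (auto simp: not_less)
  qed
qed

text \<open>A failure at \<open>(k, v)\<close> gives a column \<open>c\<close> up to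
  \<open>k\<close> where only the filling reaches \<open>v\<close> and, totals being equal, a column
  \<open>e\<close> beyond \<open>k\<close> where only \<open>x\<close> does. The filling grows with
  the rows, so \<open>e\<close> has the lower row, and density of \<open>x\<close> contradicts
  \<open>x c < v \<le> x e\<close>.\<close>

lemma fill_top_dom_le:
  assumes "is_partition lam" "length lam \<le> card P" "x \<in> lvecs lam"
  shows "dom_le x (fill lam \<rho>)"
proof (rule dom_leI[of m])
  let ?T = "fill lam \<rho>"
  have x: "dense x" "content m x = content m ?T"
    using assms(3) content_fill[OF inj_rho assms(2)] by (auto simp: vecs_iff)
  show "?T i = 0" "x i = 0" if "i \<notin> {1..m}" for i
    using subsetD[OF P_sub, of i] that dense_support[OF x(1), of i] by (auto simp: fill_def)
  fix k v :: nat assume "k \<le> m" "1 \<le> v"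
  show "cnt ?T k v \<le> cnt x k v"
  proof (rule ccontr)
    assume less: "\<not> ?thesis"
    have "\<not> {i \<in> {1..k}. v \<le> ?T i} \<subseteq> {i \<in> {1..k}. v \<le> x i}"
      using less card_mono[of "{i \<in> {1..k}. v \<le> x i}" "{i \<in> {1..k}. v \<le> ?T i}"]
      unfolding cnt_def by auto
    then obtain c where c: "c \<le> k" "v \<le> ?T c" "x c < v" by (auto simp flip: not_le)
    have "cnt ?T m v = cnt x m v"
      unfolding cnt_def by (rule card_content_cong[OF x(2), symmetric])
    then have "card {i \<in> {Suc k..m}. v \<le> ?T i} < card {i \<in> {Suc k..m}. v \<le> x i}"
      using less cnt_split[OF \<open>k \<le> m\<close>, of ?T v] cnt_split[OF \<open>k \<le> m\<close>, of x v] by linarith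
    then have "\<not> {i \<in> {Suc k..m}. v \<le> x i} \<subseteq> {i \<in> {Suc k..m}. v \<le> ?T i}"
      using card_mono[of "{i \<in> {Suc k..m}. v \<le> ?T i}" "{i \<in> {Suc k..m}. v \<le> x i}"] by auto
    then obtain e where e: "k < e" "v \<le> x e" "?T e < v" by (auto simp flip: not_le simp: Suc_le_eq)
    have P: "c \<in> P" "e \<in> P"
      using c(2) e(2) \<open>1 \<le> v\<close> dense_support[OF x(1), of e] by (auto simp: fill_def split: if_splits)
    have "\<rho> e < \<rho> c"
      using fill_mono[OF assms(1) P, of \<rho>] c(2) e(3) by linarith
    then have "x e \<le> x c" using denseD[OF x(1) P] c(1) e(1) by simp
    then show False using c(3) e(2) by simp
  qed
qed

text \<open>Lexicographic encoding in base \<open>Suc m\<close>, which exceeds the tie-breaker: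
  value first, and among equal values the left column is the larger. Density, too, wants the larger
  value on the left, so the tie-breaking never conflicts with it.\<close>

definition key :: "(nat \<Rightarrow> nat) \<Rightarrow> nat \<Rightarrow> nat" where
  "key d j = d j * Suc m + (m - j)"

lemma key_le_iff:
  assumes "p \<in> P" "q \<in> P"
  shows "key d p \<le> key d q \<longleftrightarrow> d p < d q \<or> d p = d q \<and> q \<le> p"
proof -
  have b: "p \<le> m" "q \<le> m" using P_bounds assms by auto
  have *: "key d i < key d j" if "d i < d j" for i j
  proof -
    have "Suc (d i) * Suc m \<le> d j * Suc m" using that by (intro mult_right_mono) auto
    then show ?thesis unfolding key_def by simp
  qed
  consider "d p < d q" | "d q < d p" | "d p = d q" by linarith
  then show ?thesis
  proof cases
    case 1
    then show ?thesis using *[OF 1] by simp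
  next
    case 2
    then show ?thesis using *[OF 2] by simp
  next
    case 3
    then show ?thesis using b unfolding key_def by auto
  qed
qed

lemma inj_key: "inj_on (key d) P"
proof (rule inj_onI)
  fix p q assume "p \<in> P" "q \<in> P" "key d p = key d q"
  then show "p = q"
    using key_le_iff[of p q d] key_le_iff[of q p d] by auto
qed

lemma fill_key_in_lvecs:
  assumes "is_partition mu" "length mu \<le> card P" "dense d"
  shows "fill mu (key d) \<in> lvecs mu"
proof (rule fill_in_lvecs[OF assms(1,2) inj_key])
  fix p q assume "p \<in> P" "q \<in> P" "p < q" "\<rho> q < \<rho> p"
  then show "key d q \<le> key d p"
    using denseD[OF assms(3)] key_le_iff[of q p d] by (auto simp: le_less)
qed

lemma fill_key:
  assumes "is_partition lam" "d \<in> lvecs lam"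
  shows "fill lam (key d) = d"
  using fill_eqI[OF assms _ inj_key] key_le_iff by (metis order.strict_implies_order order_refl)

lemma card_rank_le:
  assumes "inj_on g P" "N \<le> card P"
  shows "card {i \<in> P. rank g i \<le> N} = N"
proof -
  have "bij_betw (rank g) {i \<in> P. rank g i \<le> N} {1..N}"
  proof (rule bij_betw_subset[OF bij_rank[OF assms(1)]])
    show "rank g ` {i \<in> P. rank g i \<le> N} = {1..N}"
    proof
      show "{1..N} \<subseteq> rank g ` {i \<in> P. rank g i \<le> N}"
      proof
        fix l assume l: "l \<in> {1..N}"
        then have "l \<in> rank g ` P"
          using bij_rank[OF assms(1)] assms(2) by (auto simp: bij_betw_def)
        then show "l \<in> rank g ` {i \<in> P. rank g i \<le> N}" using l by auto
      qed
    qed (use rank_range in auto)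
  qed auto
  then show ?thesis using bij_betw_same_card by fastforce
qed

text \<open>
  The columns of the \<open>N\<close> largest entries, ties being broken from the left: the number of
  those among the first \<open>k\<close> columns is the minimum of two expressions that are monotone in
  the counting functions.
\<close>

lemma card_largest_mono:
  assumes "is_partition lam" "d \<in> lvecs lam" "d' \<in> lvecs lam" "dom_le d d'"
    "1 \<le> N" "N \<le> card P"
  shows "card {i \<in> P. i \<le> k \<and> rank (key d') i \<le> N} \<le> card {i \<in> P. i \<le> k \<and> rank (key d) i \<le> N}"
proof -
  define w where "w = part lam N"
  define L where "L e = {i \<in> P. rank (key e) i \<le> N}" for e
  define G where "G e = {i \<in> P. w < e i}" for e
  define K where "K = {..k}"
  have fin: "finite (L e)" "finite (G e)" for e unfolding L_def G_def by simp_all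
  have val: "part lam (rank (key e) i) = e i" if "e \<in> lvecs lam" "i \<in> P" for e i
    using fun_cong[OF fill_key[OF assms(1) that(1)], of i] that(2) by (simp add: fill_def)
  have GL: "G e \<subseteq> L e" if "e \<in> lvecs lam" for e
  proof
    fix i assume "i \<in> G e"
    then have i: "i \<in> P" "part lam N < part lam (rank (key e) i)"
      using val[OF that, of i] unfolding G_def w_def by auto
    then have "rank (key e) i \<le> N"
      using part_antimono[OF assms(1,5), of "rank (key e) i"] by linarith
    then show "i \<in> L e" using i unfolding L_def by simp
  qed
  have Lw: "w \<le> e i" if "e \<in> lvecs lam" "i \<in> L e" for e i
  proof -
    have i: "i \<in> P" "rank (key e) i \<le> N" using that(2) unfolding L_def by auto
    then show ?thesis
      using part_antimono[OF assms(1) rank_range(1)[OF i(1)] i(2)] val[OF that(1) i(1)]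
      unfolding w_def by simp
  qed
  have cnt: "card {i \<in> P. i \<le> k \<and> v \<le> e i} = cnt e k v" if "e \<in> lvecs lam" "1 \<le> v" for e v
  proof -
    have "{i \<in> P. i \<le> k \<and> v \<le> e i} = {i \<in> {1..k}. v \<le> e i}"
      using that P_bounds dense_support[of e] unfolding vecs_iff by fastforce
    then show ?thesis unfolding cnt_def by simp
  qed
  have "card (L d' \<inter> K) \<le> card (L d \<inter> K)"
  \<comment> \<open>Either the prefix keeps all its entries equal to \<open>w\<close>, and then its
    chosen columns are those reaching \<open>w\<close>; or one is left out, and as ties go to the
    left, every chosen column beyond \<open>k\<close> exceeds \<open>w\<close>, so the complement is
    counted.\<close>
  proof (cases "\<exists>i\<in>P. i \<le> k \<and> d i = w \<and> i \<notin> L d")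
    case False
    have "card (L d' \<inter> K) \<le> card {i \<in> P. i \<le> k \<and> w \<le> d' i}"
      using Lw[OF assms(3)] unfolding K_def by (intro card_mono) (auto simp: L_def)
    also have "\<dots> \<le> card {i \<in> P. i \<le> k \<and> w \<le> d i}"
    \<comment> \<open>At level 0 the two sets coincide, whereas \<open>cnt\<close> would also count
      columns outside \<open>P\<close>.\<close>
    proof (cases "w = 0")
      case False
      then show ?thesis using cnt assms(2,3) dom_leD[OF assms(4), of k w] by simp
    qed simp
    also have "\<dots> \<le> card (L d \<inter> K)"
    proof (rule card_mono)
      show "{i \<in> P. i \<le> k \<and> w \<le> d i} \<subseteq> L d \<inter> K"
      proof
        fix i assume i: "i \<in> {i \<in> P. i \<le> k \<and> w \<le> d i}"
        show "i \<in> L d \<inter> K"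
        proof (cases "d i = w")
          case True
          then show ?thesis using False i unfolding K_def by auto
        next
          case ne: False
          then have "i \<in> G d" using i unfolding G_def by auto
          then show ?thesis using GL[OF assms(2)] i unfolding K_def by auto
        qed
      qed
    qed (use fin in simp)
    finally show ?thesis .
  next
    case True
    then obtain i where i: "i \<in> P" "i \<le> k" "d i = w" "i \<notin> L d" by blast
    have "L d - K \<subseteq> G d - K"
    proof
      fix s assume s: "s \<in> L d - K"
      then have "s \<in> P" "rank (key d) s < rank (key d) i" "w \<le> d s" "i < s"
        using i Lw[OF assms(2), of s] unfolding L_def K_def by auto
      then have "\<not> key d s \<le> key d i"
        using rank_le_iff[OF i(1) \<open>s \<in> P\<close>, of "key d"] by simp
      then have "w < d s"
        using key_le_iff[OF \<open>s \<in> P\<close> i(1), of d] \<open>w \<le> d s\<close> \<open>i < s\<close> i(3) by auto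
      then show "s \<in> G d - K" using s \<open>s \<in> P\<close> unfolding G_def by simp
    qed
    then have 1: "card (L d - K) \<le> card (G d - K)" using fin by (intro card_mono) auto
    have 2: "card (G d' - K) \<le> card (L d' - K)"
      using GL[OF assms(3)] fin by (intro card_mono) auto
    have G: "card (G e) = card {l \<in> {1..m}. w < part lam l}" if "e \<in> lvecs lam" for e
    proof -
      have "G e = {i \<in> {1..m}. w < e i}"
        using that P_bounds dense_support[of e] unfolding vecs_iff G_def by fastforce
      then show ?thesis
        using card_content_cong[of m e "part lam" "\<lambda>v. w < v"] that by (simp add: vecs_iff)
    qed
    have GK: "card (G e \<inter> K) = cnt e k (Suc w)" if "e \<in> lvecs lam" for e
    proof -
      have "G e \<inter> K = {i \<in> P. i \<le> k \<and> Suc w \<le> e i}" unfolding G_def K_def by auto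
      then show ?thesis using cnt[OF that, of "Suc w"] by simp
    qed
    have "card (G d \<inter> K) + card (G d - K) = card (G d' \<inter> K) + card (G d' - K)"
      using card_Int_Diff[OF fin(2), of d K] card_Int_Diff[OF fin(2), of d' K] G assms(2,3) by simp
    moreover have "card (G d' \<inter> K) \<le> card (G d \<inter> K)"
      using GK assms(2,3) dom_leD[OF assms(4)] by simp
    moreover have "card (L d \<inter> K) + card (L d - K) = N" "card (L d' \<inter> K) + card (L d' - K) = N"
      using card_Int_Diff[OF fin(1), of d K] card_Int_Diff[OF fin(1), of d' K]
        card_rank_le[OF inj_key assms(6)] unfolding L_def by auto
    ultimately show ?thesis using 1 2 by linarith
  qed
  moreover have "{i \<in> P. i \<le> k \<and> rank (key e) i \<le> N} = L e \<inter> K" for e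
    unfolding L_def K_def by auto
  ultimately show ?thesis by simp
qed

lemma fill_key_mono:
  assumes "is_partition lam" "is_partition mu" "d \<in> lvecs lam" "d' \<in> lvecs lam" "dom_le d d'"
  shows "dom_le (fill mu (key d)) (fill mu (key d'))"
proof (rule dom_leI[of m])
  show "fill mu (key d) i = 0" "fill mu (key d') i = 0" if "i \<notin> {1..m}" for i
    using that P_sub by (auto simp: fill_def)
  fix k v :: nat assume "1 \<le> v"
  obtain t where t: "\<And>l. l \<in> {1..card P} \<Longrightarrow> v \<le> part mu l \<longleftrightarrow> l \<le> t"
    using part_threshold[OF assms(2), of "card P" v] by blast
  define N where "N = min t (card P)"
  have eq: "cnt (fill mu (key e)) k v = card {i \<in> P. i \<le> k \<and> rank (key e) i \<le> N}" for e
  proof -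
    have "{i \<in> {1..k}. v \<le> fill mu (key e) i} = {i \<in> P. i \<le> k \<and> rank (key e) i \<le> N}"
    proof (intro set_eqI)
      fix i
      show "i \<in> {i \<in> {1..k}. v \<le> fill mu (key e) i} \<longleftrightarrow> i \<in> {i \<in> P. i \<le> k \<and> rank (key e) i \<le> N}"
      proof (cases "i \<in> P")
        case True
        then show ?thesis
          using t[of "rank (key e) i"] rank_range[OF True, of "key e"] P_bounds[OF True]
          unfolding N_def by (simp add: fill_def)
      next
        case False
        then show ?thesis using \<open>1 \<le> v\<close> by (simp add: fill_def)
      qed
    qed
    then show ?thesis unfolding cnt_def by simp
  qed
  show "cnt (fill mu (key d')) k v \<le> cnt (fill mu (key d)) k v"
  \<comment> \<open>\<open>part lam 0\<close> is the default value 0 and not a bound for the parts,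
    so the empty selection is treated apart.\<close>
  proof (cases "N = 0")
    case True
    have "{i \<in> P. i \<le> k \<and> rank (key d') i \<le> 0} = {}"
      using rank_range(1)[where g = "key d'"] by force
    then show ?thesis unfolding eq True by (simp only: card.empty zero_le)
  next
    case False
    then show ?thesis
      unfolding eq using card_largest_mono[OF assms(1,3,4,5), of N k] by (simp add: N_def)
  qed
qed

end

section \<open>Graded posets and EL-labellings from a greedy choice of atoms\<close>

lemma maximal_chain_Cons:
  assumes "maximal_chain P le x y c" "x \<noteq> y"
  obtains z c' where "c = x # c'" "covers P le x z" "maximal_chain P le z y c'" "hd c' = z"
proof -
  have c: "c \<noteq> []" "set c \<subseteq> P" "hd c = x" "last c = y" "successively (covers P le) c"
    using assms(1) by (auto simp: maximal_chain_def)
  then obtain c' where c': "c = x # c'" by (metis list.collapse)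
  moreover have ne: "c' \<noteq> []" using c c' assms(2) by auto
  moreover have "covers P le x (hd c')" "successively (covers P le) c'"
    using c(5) c' ne by (cases c'; simp)+
  ultimately show thesis
    using that[of c' "hd c'"] c by (auto simp: maximal_chain_def)
qed

lemma maximal_chain_le:
  assumes "maximal_chain P le x y c" "x \<in> P" "reflp_on P le" "transp_on P le"
  shows "le x y"
  using assms(1,2)
proof (induction c arbitrary: x)
  case Nil
  then show ?case by (simp add: maximal_chain_def)
next
  case (Cons a c)
  show ?case
  proof (cases "x = y")
    case True
    then show ?thesis using assms(3) Cons.prems(2) by (simp add: reflp_on_def)
  next
    case False
    obtain z c' where z: "a # c = x # c'" "covers P le x z" "maximal_chain P le z y c'"
      by (rule maximal_chain_Cons[OF Cons.prems(1) False]) blast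
    have "y \<in> P"
      using Cons.prems(1) unfolding maximal_chain_def by (metis last_in_set subsetD)
    moreover have "le z y" using Cons.IH[of z] z by (auto simp: covers_def)
    ultimately show ?thesis
      using z(2) assms(4) Cons.prems(2) unfolding covers_def transp_on_def by blast
  qed
qed

text \<open>The rank \<open>h\<close> decreases upwards because it will be the number of
  inversions.\<close>

lemma maximal_chain_length:
  fixes h :: "'a \<Rightarrow> nat"
  assumes "maximal_chain P le x y c" "\<And>x z. covers P le x z \<Longrightarrow> h x = Suc (h z)"
  shows "length c + h y = Suc (h x)"
  using assms(1)
proof (induction c arbitrary: x)
  case Nil
  then show ?case by (simp add: maximal_chain_def)
next
  case (Cons a c)
  show ?case
  proof (cases "c = []")
    case True
    then show ?thesis using Cons.prems by (auto simp: maximal_chain_def)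
  next
    case False
    then have "covers P le x (hd c)" "maximal_chain P le (hd c) y c"
      using Cons.prems by (cases c; auto simp: maximal_chain_def)+
    then show ?thesis using Cons.IH assms(2) by fastforce
  qed
qed

lemma maximal_chain_same:
  fixes h :: "'a \<Rightarrow> nat"
  assumes "maximal_chain P le x x c" "\<And>x z. covers P le x z \<Longrightarrow> h x = Suc (h z)"
  shows "c = [x]"
proof -
  have "length c = 1" using maximal_chain_length[of P le x x c h] assms by simp
  then show ?thesis using assms(1) by (cases c) (auto simp: maximal_chain_def)
qed

lemma graded_posetI:
  fixes h :: "'a \<Rightarrow> nat"
  assumes "\<And>x z. covers P le x z \<Longrightarrow> h x = Suc (h z)"
  shows "graded_poset P le"
  unfolding graded_poset_def
proof (intro ballI allI impI)
  fix x y c c'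
  assume "le x y \<and> maximal_chain P le x y c \<and> maximal_chain P le x y c'"
  then have "length c + h y = Suc (h x)" "length c' + h y = Suc (h x)"
    using maximal_chain_length[of P le x y _ h] assms by blast+
  then show "length c = length c'" by simp
qed

lemma label_word_Cons: "c \<noteq> [] \<Longrightarrow> label_word f (x # c) = f x (hd c) # label_word f c"
  by (cases c) (simp_all add: label_word_def)

lemma label_word_eq_Cons:
  assumes "maximal_chain P le x y c" "x \<noteq> y" "c = x # c'" "hd c' = z"
  shows "label_word f c = f x z # label_word f c'"
proof -
  have "c' \<noteq> []" using assms by (auto simp: maximal_chain_def)
  then show ?thesis using assms label_word_Cons by metis
qed

text \<open>
  By induction, the increasing chain from any other atom \<open>z\<close> is the greedy one, so putting
  \<open>x\<close> in front of it creates a descent; hence only the greedy chain increases.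
\<close>

lemma EL_labelling_greedy:
  fixes f :: "'a \<Rightarrow> 'a \<Rightarrow> nat" and h :: "'a \<Rightarrow> nat"
  assumes refl: "reflp_on P le" and trans: "transp_on P le"
    and rank: "\<And>x z. covers P le x z \<Longrightarrow> h x = Suc (h z)"
    and atom: "\<And>x y. x \<in> P \<Longrightarrow> y \<in> P \<Longrightarrow> le x y \<Longrightarrow> x \<noteq> y \<Longrightarrow>
      covers P le x (g x y) \<and> le (g x y) y"
    and least: "\<And>x y z. covers P le x z \<Longrightarrow> y \<in> P \<Longrightarrow> le z y \<Longrightarrow> z \<noteq> g x y \<Longrightarrow>
      f x (g x y) < f x z"
    and descent: "\<And>x y z. covers P le x z \<Longrightarrow> y \<in> P \<Longrightarrow> le z y \<Longrightarrow> z \<noteq> g x y \<Longrightarrow>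
      z \<noteq> y \<Longrightarrow> f z (g z y) \<le> f x z"
    and ascent: "\<And>x y. x \<in> P \<Longrightarrow> y \<in> P \<Longrightarrow> le x y \<Longrightarrow> x \<noteq> y \<Longrightarrow> g x y \<noteq> y \<Longrightarrow>
      f x (g x y) < f (g x y) (g (g x y) y)"
  shows "EL_labelling P le less_than f"
proof -
  let ?inc = "\<lambda>c. sorted_wrt (\<lambda>a b. (a, b) \<in> less_than) (label_word f c)"
  \<comment> \<open>The last conjunct records that the chain starts with the greedy atom; the
    induction step needs it to know the first label of the increasing chain above an atom.\<close>
  let ?good = "\<lambda>x y c. maximal_chain P le x y c \<and> ?inc c \<and>
    (\<forall>c'. maximal_chain P le x y c' \<and> c' \<noteq> c \<longrightarrow>
      \<not> ?inc c' \<and> (label_word f c, label_word f c') \<in> lexord less_than) \<and>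
    (x \<noteq> y \<longrightarrow> c = x # tl c \<and> hd (tl c) = g x y)"
  have main: "\<exists>c. ?good x y c" if "x \<in> P" "y \<in> P" "le x y" for x y
    using that
  proof (induction "h x" arbitrary: x rule: less_induct)
    case less
    show ?case
    proof (cases "x = y")
      case True
      have "c' = [x]" if "maximal_chain P le x y c'" for c'
        using maximal_chain_same[of P le x c' h] that rank True by simp
      moreover have "maximal_chain P le x y [x]"
        using True less.prems by (simp add: maximal_chain_def)
      moreover have "?inc [x]" by (simp add: label_word_def)
      ultimately show ?thesis using True by blast
    next
      case False
      define z where "z = g x y"
      have z: "covers P le x z" "le z y" "z \<in> P"
        using atom[OF less.prems False] unfolding z_def covers_def by auto
      then obtain c0 where c0: "?good z y c0"
        using less.hyps[of z] rank less.prems by fastforce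
      have hd: "hd c0 = z" "c0 \<noteq> []" using c0 by (auto simp: maximal_chain_def)
      let ?c = "x # c0"
      have chain: "maximal_chain P le x y ?c"
        using c0 z hd less.prems False by (cases c0) (auto simp: maximal_chain_def)
      have swap_label: "label_word f ?c = f x z # label_word f c0"
        using label_word_Cons[OF hd(2)] hd by simp
      have "?inc ?c"
      proof (cases "z = y")
        case True
        then have "c0 = [y]" using maximal_chain_same[of P le y c0 h] c0 rank by simp
        then show ?thesis using swap_label by (simp add: label_word_def)
      next
        case ne: False
        have "f x z < f z (g z y)"
          using ascent[OF less.prems False] ne unfolding z_def by simp
        moreover have "label_word f c0 = f z (g z y) # label_word f (tl c0)"
          using label_word_eq_Cons[of P le z y c0 "tl c0" "g z y" f] c0 ne by blast
        ultimately show ?thesis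
          using swap_label c0 by auto
      qed
      moreover have "\<not> ?inc c' \<and> (label_word f ?c, label_word f c') \<in> lexord less_than"
        if c': "maximal_chain P le x y c'" "c' \<noteq> ?c" for c'
      proof -
        obtain z' c1 where c1: "c' = x # c1" "covers P le x z'" "maximal_chain P le z' y c1" "hd c1 = z'"
          by (rule maximal_chain_Cons[OF c'(1) False])
        have z': "z' \<in> P" "le z' y" "le x z'" "x \<noteq> z'"
          using c1(2) maximal_chain_le[OF c1(3) _ refl trans] by (auto simp: covers_def)
        have swap_label': "label_word f c' = f x z' # label_word f c1"
          using label_word_eq_Cons[OF c'(1) False c1(1,4)] .
        show ?thesis
        proof (cases "z' = z")
          case True
          then have "c1 \<noteq> c0" using c' c1 by auto
          then have "\<not> ?inc c1 \<and> (label_word f c0, label_word f c1) \<in> lexord less_than"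
            using c0 c1(3) True by blast
          then show ?thesis unfolding swap_label swap_label' using True by simp
        next
          case neq: False
          \<comment> \<open>Otherwise the greedy atom would lie strictly between \<open>x\<close>
            and its cover \<open>y\<close>.\<close>
          have ne: "z' \<noteq> y"
            using c1(2) z neq unfolding covers_def by auto
          have "f x z < f x z'"
            using least[OF c1(2) less.prems(2) z'(2)] neq unfolding z_def by simp
          moreover have "\<not> ?inc c'"
          proof
            assume inc: "?inc c'"
            obtain c2 where c2: "?good z' y c2"
              using less.hyps[of z'] rank[OF c1(2)] z' less.prems by fastforce
            have "?inc c1" using inc unfolding swap_label' by simp
            then have "c1 = c2" using c2 c1(3) by blast
            then have "label_word f c1 = f z' (g z' y) # label_word f (tl c1)"
              using label_word_eq_Cons[OF c1(3) ne, of "tl c1" "g z' y"] c2 ne by blast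
            then have "f x z' < f z' (g z' y)"
              using inc unfolding swap_label' by simp
            then show False
              using descent[OF c1(2) less.prems(2) z'(2)] neq ne unfolding z_def by simp
          qed
          ultimately show ?thesis unfolding swap_label swap_label' by simp
        qed
      qed
      ultimately show ?thesis
        using chain hd unfolding z_def by (intro exI[of _ ?c]) auto
    qed
  qed
  show ?thesis
    unfolding EL_labelling_def
  proof (intro conjI ballI impI)
    show "irrefl less_than" by (simp add: irrefl_def)
    show "trans less_than" by simp
    fix x y assume xy: "x \<in> P" "y \<in> P" "le x y \<and> x \<noteq> y"
    obtain c where "?good x y c" using main[OF xy(1,2)] xy(3) by blast
    then show "\<exists>c. maximal_chain P le x y c \<and> ?inc c \<and>
       (\<forall>c'. maximal_chain P le x y c' \<and> c' \<noteq> c \<longrightarrow>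
         \<not> ?inc c' \<and> (label_word f c, label_word f c') \<in> lexord less_than)" by blast
  qed
qed

section \<open>The regular case\<close>

context rows
begin

definition invs :: "(nat \<Rightarrow> nat) \<Rightarrow> (nat \<times> nat) set" where
  "invs d = {(u, v). u \<in> P \<and> v \<in> P \<and> u < v \<and> d v < d u}"

lemma finite_invs [simp]: "finite (invs d)"
  by (rule finite_subset[of _ "P \<times> P"]) (auto simp: invs_def)

text \<open>
  Apart from \<open>(c, q)\<close> itself, the pairs inside the interval from \<open>c\<close> to \<open>q\<close> keep their
  relative order, and the remaining ones are permuted by the transposition.
\<close>

lemma card_invs_swap:
  assumes "inj_on d P" "disorder d c q"
  shows "card (invs d) = Suc (card (invs (d \<circ> transpose c q)))"
proof -
  note m = disorderD[OF assms(2)]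
  let ?t = "transpose c q" let ?e = "d \<circ> transpose c q"
  define \<phi> where "\<phi> = (\<lambda>(u, v). if c \<le> u \<and> v \<le> q then (u, v) else (?t u, ?t v))"
  \<comment> \<open>With distinct values, the three conditions of a minimal disorder, one for each
    position of the row of \<open>p\<close>, merge into the usual covering criterion: no value
    between \<open>d q\<close> and \<open>d c\<close> occurs between the two columns.\<close>
  have gap: "d p < d q \<or> d c < d p" if p: "p \<in> P" "c < p" "p < q" for p
  proof -
    have "p \<noteq> c" "p \<noteq> q" using p by auto
    then have "d p \<noteq> d q" "d p \<noteq> d c" "\<rho> p \<noteq> \<rho> c" "\<rho> p \<noteq> \<rho> q"
      using assms(1) p(1) m(1,2) rho_eq_iff by (auto simp: inj_on_def)
    then show ?thesis using m(9,10,12)[OF p(1)] p(2,3) by linarith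
  qed
  have t: "?t u \<in> P \<longleftrightarrow> u \<in> P" for u
    using m(1,2) by (auto simp: transpose_def)
  have ordered: "?t u < ?t v \<and> \<not> (c \<le> ?t u \<and> ?t v \<le> q)"
    if "u < v" "\<not> (c \<le> u \<and> v \<le> q)" for u v
    using that m(4) by (auto simp: transpose_def)
  have 1: "\<phi> uv \<in> invs d - {(c, q)} \<and> \<phi> (\<phi> uv) = uv" if "uv \<in> invs ?e" for uv
  proof -
    obtain u v where uv: "uv = (u, v)" "u \<in> P" "v \<in> P" "u < v" "?e v < ?e u"
      using \<open>uv \<in> invs ?e\<close> unfolding invs_def by auto
    show ?thesis
    proof (cases "c \<le> u \<and> v \<le> q")
      case True
      consider "u = c" "v = q" | "u = c" "v < q" | "c < u" "v = q" | "c < u" "v < q"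
        using True by linarith
      then have "d v < d u \<and> (u, v) \<noteq> (c, q)"
        using uv gap[of u] gap[of v] m(5) by cases auto
      then show ?thesis using uv True unfolding \<phi>_def invs_def by auto
    next
      case False
      then have "\<phi> uv = (?t u, ?t v)" using uv(1) unfolding \<phi>_def by auto
      moreover have "(?t u, ?t v) \<in> invs d - {(c, q)}"
        using uv ordered[OF uv(4) False] t unfolding invs_def by auto
      moreover have "\<phi> (?t u, ?t v) = (u, v)"
        using ordered[OF uv(4) False] unfolding \<phi>_def by auto
      ultimately show ?thesis using uv(1) by simp
    qed
  qed
  have 2: "\<phi> uv \<in> invs ?e \<and> \<phi> (\<phi> uv) = uv" if "uv \<in> invs d - {(c, q)}" for uv
  proof -
    obtain u v where uv: "uv = (u, v)" "u \<in> P" "v \<in> P" "u < v" "d v < d u" "(u, v) \<noteq> (c, q)"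
      using \<open>uv \<in> invs d - {(c, q)}\<close> unfolding invs_def by auto
    show ?thesis
    proof (cases "c \<le> u \<and> v \<le> q")
      case True
      consider "u = c" "v < q" | "c < u" "v = q" | "c < u" "v < q"
        using True uv(6) by fastforce
      then have "?e v < ?e u"
        using uv gap[of u] gap[of v] m(5) by cases auto
      then show ?thesis using uv True unfolding \<phi>_def invs_def by auto
    next
      case False
      then have "\<phi> uv = (?t u, ?t v)" using uv(1) unfolding \<phi>_def by auto
      moreover have "(?t u, ?t v) \<in> invs ?e"
        using uv ordered[OF uv(4) False] t unfolding invs_def by auto
      moreover have "\<phi> (?t u, ?t v) = (u, v)"
        using ordered[OF uv(4) False] unfolding \<phi>_def by auto
      ultimately show ?thesis using uv(1) by simp
    qed
  qed
  have "bij_betw \<phi> (invs ?e) (invs d - {(c, q)})"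
  proof (rule bij_betw_byWitness[of _ \<phi>])
    show "\<forall>a\<in>invs ?e. \<phi> (\<phi> a) = a" using 1 by blast
    show "\<forall>a\<in>invs d - {(c, q)}. \<phi> (\<phi> a) = a" using 2 by blast
    show "\<phi> ` invs ?e \<subseteq> invs d - {(c, q)}" by (rule image_subsetI) (use 1 in blast)
    show "\<phi> ` (invs d - {(c, q)}) \<subseteq> invs ?e" by (rule image_subsetI) (use 2 in blast)
  qed
  then have "card (invs ?e) = card (invs d - {(c, q)})"
    by (rule bij_betw_same_card)
  moreover have "(c, q) \<in> invs d" using m unfolding invs_def by simp
  ultimately show ?thesis
    using card_Suc_Diff1[OF finite_invs, of "(c, q)" d] by simp
qed

text \<open>The two exchanged columns are recovered as the extreme columns where \<open>x\<close>
  and \<open>z\<close> differ. Columns are at most \<open>m\<close>, so base \<open>Suc m\<close>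
  makes the order of numbers lexicographic.\<close>

definition swap_label :: "(nat \<Rightarrow> nat) \<Rightarrow> (nat \<Rightarrow> nat) \<Rightarrow> nat" where
  "swap_label x z = \<rho> (Min {j. x j \<noteq> z j}) * Suc m + Max {j. x j \<noteq> z j}"

definition atom :: "(nat \<Rightarrow> nat) \<Rightarrow> (nat \<Rightarrow> nat) \<Rightarrow> nat \<Rightarrow> nat" where
  "atom x y = (THE z. \<exists>a q. lead x y a q \<and> z = x \<circ> transpose a q)"

lemma swap_label_swap:
  assumes "disorder x c q"
  shows "swap_label x (x \<circ> transpose c q) = \<rho> c * Suc m + q"
proof -
  note m = disorderD(4,5)[OF assms]
  have "{j. x j \<noteq> (x \<circ> transpose c q) j} = {c, q}"
    using m by (auto simp: transpose_def split: if_splits)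
  then show ?thesis using m(1) by (simp add: swap_label_def)
qed

lemma lead_unique:
  assumes "lead x y a q" "lead x y a' q'"
  shows "a' = a \<and> q' = q"
proof -
  note l = leadD[OF assms(1)] and l' = leadD[OF assms(2)]
  have "a' = a"
    using l(1,2,3) l'(1,2,3) rho_eq_iff by (meson linorder_neqE_nat)
  moreover have "\<not> q' < q" using l(9)[OF l'(4)] l'(5-8) \<open>a' = a\<close> by auto
  moreover have "\<not> q < q'" using l'(9)[OF l(4)] l(5-8) \<open>a' = a\<close> by auto
  ultimately show ?thesis by simp
qed

lemma atom_eq: "lead x y a q \<Longrightarrow> atom x y = x \<circ> transpose a q"
  unfolding atom_def using lead_unique by (intro the_equality) blast+

lemma lex_less:
  assumes "\<rho> a < \<rho> b \<or> a = b \<and> q < q'" "q \<le> m" "q' \<le> m"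
  shows "\<rho> a * Suc m + q < \<rho> b * Suc m + q'"
proof (cases "\<rho> a < \<rho> b")
  case True
  then have "Suc (\<rho> a) * Suc m \<le> \<rho> b * Suc m" by (intro mult_right_mono) auto
  then show ?thesis using assms(2) by simp
next
  case False
  then show ?thesis using assms(1) by auto
qed

end

section \<open>Comparing greedy exchanges with the others\<close>

locale regular_rows = rows +
  fixes M :: "nat multiset"
  assumes inj_vecs: "\<And>d. d \<in> vecs M \<Longrightarrow> inj_on d P"
begin

lemma ex_lead_disorder:
  assumes "x \<in> vecs M" "y \<in> vecs M" "dom_le x y" "x \<noteq> y"
  shows "\<exists>a q. lead x y a q \<and> disorder x a q \<and> dom_le (x \<circ> transpose a q) y"
proof -
  have d: "dense x" "dense y" "content m x = content m y"
    using assms by (auto simp: vecs_iff)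
  obtain a q where l: "lead x y a q" using ex_lead[OF d(1,2) assms(3) d(3) assms(4)] by blast
  obtain c where c: "x c = x a" "disorder x c q" "dom_le (x \<circ> transpose c q) y"
    using ex_disorder[OF d(1,2) assms(3) d(3) l] by blast
  have "c = a"
    using inj_onD[OF inj_vecs[OF assms(1)] c(1)] disorderD(1)[OF c(2)] leadD(1)[OF l] by simp
  then show ?thesis using l c by blast
qed

lemma vecs_swap: "x \<in> vecs M \<Longrightarrow> disorder x c q \<Longrightarrow> x \<circ> transpose c q \<in> vecs M"
  using swap_dense swap_content by (simp add: vecs_iff)

text \<open>An exchange starting in a lower row than \<open>a\<close> would push the entry at
  \<open>c\<close> under \<open>y c\<close>, contrary to \<open>first_difference_le\<close>. In the
  row of \<open>a\<close>, the value at \<open>p\<close> must lie in the window, so a column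
  \<open>p\<close> before \<open>q\<close> would have been found first.\<close>

lemma swap_label_cases:
  assumes x: "x \<in> vecs M" and y: "y \<in> vecs M" and l: "lead x y a q"
    and md: "disorder x c p" and le: "dom_le (x \<circ> transpose c p) y" and ne: "(c, p) \<noteq> (a, q)"
  shows "\<rho> a < \<rho> c \<or> a = c \<and> q < p"
proof (rule ccontr)
  assume no: "\<not> ?thesis"
  note ll = leadD[OF l] and mm = disorderD[OF md]
  let ?z = "x \<circ> transpose c p"
  have z: "?z \<in> vecs M" using vecs_swap[OF x md] .
  have "\<rho> c \<le> \<rho> a" using no by simp
  have low: "?z s = y s" if "s \<in> P" "\<rho> s < \<rho> c" for s
  proof -
    have "s \<noteq> c" "s \<noteq> p" using that mm(3) by auto
    then show ?thesis using ll(3)[OF that(1)] that(2) \<open>\<rho> c \<le> \<rho> a\<close> by simp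
  qed
  have "y c \<le> ?z c"
    using first_difference_le[OF _ _ le mm(1) low] z y unfolding vecs_iff by blast
  then have yc: "y c \<le> x p" by simp
  show False
  proof (cases "\<rho> c < \<rho> a")
    case True
    then show ?thesis using ll(3)[OF mm(1)] mm(5) yc by simp
  next
    case False
    then have "c = a" using \<open>\<rho> c \<le> \<rho> a\<close> rho_eq_iff[OF mm(1) ll(1)] by simp
    then have "p < q" using no ne by auto
    then show ?thesis using ll(9)[OF mm(2)] mm(3,4,5) yc \<open>c = a\<close> by simp
  qed
qed

text \<open>Lower rows stay settled. If the row of \<open>a\<close> is not yet settled, its entry is
  now \<open>x q\<close> and the window has shrunk: a target before \<open>q\<close> would have been
  one earlier, and \<open>q\<close> now holds \<open>x a\<close>.\<close>

lemma greedy_ascent: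
  assumes l: "lead x y a q" and l': "lead (x \<circ> transpose a q) y b p"
  shows "\<rho> a < \<rho> b \<or> a = b \<and> q < p"
proof -
  note ll = leadD[OF l] and ll' = leadD[OF l']
  let ?z = "x \<circ> transpose a q"
  have "\<not> \<rho> b < \<rho> a"
  proof
    assume "\<rho> b < \<rho> a"
    moreover from this have "b \<noteq> a" "b \<noteq> q" using ll(6) by auto
    ultimately show False using ll(3)[OF ll'(1)] ll'(2) by simp
  qed
  then consider "\<rho> a < \<rho> b" | "a = b"
    using rho_eq_iff[OF ll(1) ll'(1)] by linarith
  then show ?thesis
  proof cases
    case 2
    have za: "?z a = x q" "?z q = x a" by simp_all
    have "p \<noteq> q" using ll'(8) ll(8) za 2 by auto
    moreover have "\<not> p < q"
    proof
      assume "p < q"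
      moreover have "?z p = x p" using \<open>p < q\<close> ll'(5) 2 by simp
      ultimately show False
        using ll(9)[OF ll'(4)] ll'(5,6,7,8) 2 za ll(8) by simp
    qed
    ultimately show ?thesis using 2 by simp
  qed simp
qed

text \<open>If \<open>a\<close> has a lower row than \<open>c\<close>, it is untouched and still a
  difference, so the next greedy row is below that of \<open>c\<close>. If \<open>a = c\<close>,
  minimality of the disorder forces \<open>x q < x p\<close>, so the skipped column \<open>q\<close>
  remains a target at \<open>c\<close>.\<close>

lemma greedy_descent:
  assumes l: "lead x y a q" and md: "disorder x c p"
    and lt: "\<rho> a < \<rho> c \<or> a = c \<and> q < p" and l': "lead (x \<circ> transpose c p) y b s"
  shows "\<rho> b < \<rho> c \<or> b = c \<and> s < p"
proof -
  note ll = leadD[OF l] and ll' = leadD[OF l'] and mm = disorderD[OF md]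
  let ?z = "x \<circ> transpose c p"
  from lt show ?thesis
  proof
    assume "\<rho> a < \<rho> c"
    then have "a \<noteq> c" "a \<noteq> p" using mm(3) by auto
    then have "?z a \<noteq> y a" using ll(2) by simp
    then have "\<not> \<rho> a < \<rho> b" using ll'(3)[OF ll(1)] by blast
    then show ?thesis using \<open>\<rho> a < \<rho> c\<close> by simp
  next
    assume ac: "a = c \<and> q < p"
    have q: "q \<noteq> c" "q \<noteq> p" using ac ll(5) by auto
    have "x q < x p"
    proof (cases "\<rho> q < \<rho> p")
      case True
      then have "\<not> x p \<le> x q" using mm(12)[OF ll(4)] ll(5,6,8) ac by auto
      then show ?thesis by simp
    next
      case False
      then have "\<rho> p < \<rho> q" using rho_eq_iff[OF ll(4) mm(2)] q by linarith
      then show ?thesis using mm(9)[OF ll(4)] ac ll(8) by simp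
    qed
    then have zc: "?z c \<noteq> y c" using ll(7) ac by simp
    then have "\<not> \<rho> c < \<rho> b" using ll'(3)[OF mm(1)] by blast
    then consider "\<rho> b < \<rho> c" | "b = c" using rho_eq_iff[OF ll'(1) mm(1)] by linarith
    then show ?thesis
    proof cases
      case 2
      have "\<not> q < s"
      proof
        assume "q < s"
        moreover have "?z q = x q" using q by simp
        ultimately show False
          using ll'(9)[OF ll(4)] ll(5,6,7) ac 2 \<open>x q < x p\<close> by simp
      qed
      then show ?thesis using 2 ac by simp
    qed simp
  qed
qed

lemma card_invs_disorder_step: "x \<in> vecs M \<Longrightarrow> disorder_step x z \<Longrightarrow> card (invs x) = Suc (card (invs z))"
  using card_invs_swap inj_vecs unfolding disorder_step_def by blast

lemma atom_step:
  assumes "x \<in> vecs M" "y \<in> vecs M" "dom_le x y" "x \<noteq> y"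
  shows "disorder_step x (atom x y)" "dom_le (atom x y) y"
proof -
  obtain a q where "lead x y a q" "disorder x a q" "dom_le (x \<circ> transpose a q) y"
    using ex_lead_disorder[OF assms] by blast
  then show "disorder_step x (atom x y)" "dom_le (atom x y) y"
    using atom_eq[of x y a q] unfolding disorder_step_def by auto
qed

lemma atom_least:
  assumes "x \<in> vecs M" "y \<in> vecs M" "disorder_step x z" "dom_le z y" "z \<noteq> atom x y"
  shows "swap_label x (atom x y) < swap_label x z"
proof -
  obtain c p where c: "disorder x c p" "z = x \<circ> transpose c p" using assms(3) by (auto simp: disorder_step_def)
  have "dom_le x z" "x \<noteq> z" using disorder_stepD[OF assms(3)] assms(1) by (auto simp: vecs_iff)
  moreover have "z \<in> vecs M" using vecs_swap[OF assms(1) c(1)] c(2) by simp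
  ultimately have "dom_le x y" "x \<noteq> y"
    using assms(1,4) dom_le_trans vecs_antisym by blast+
  then obtain a q where a: "lead x y a q" "disorder x a q"
    using ex_lead_disorder[OF assms(1,2)] by blast
  have "\<rho> a < \<rho> c \<or> a = c \<and> q < p"
    using swap_label_cases[OF assms(1,2) a(1) c(1)] assms(4,5) c(2) atom_eq[OF a(1)] by auto
  then show ?thesis
    unfolding atom_eq[OF a(1)] c(2) swap_label_swap[OF a(2)] swap_label_swap[OF c(1)]
    using lex_less disorderD(7)[OF a(2)] disorderD(7)[OF c(1)] by blast
qed

lemma atom_descent:
  assumes "x \<in> vecs M" "y \<in> vecs M" "disorder_step x z" "dom_le z y" "z \<noteq> atom x y" "z \<noteq> y"
  shows "swap_label z (atom z y) \<le> swap_label x z"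
proof -
  obtain c p where c: "disorder x c p" "z = x \<circ> transpose c p" using assms(3) by (auto simp: disorder_step_def)
  have "dom_le x z" "x \<noteq> z" using disorder_stepD[OF assms(3)] assms(1) by (auto simp: vecs_iff)
  moreover have z: "z \<in> vecs M" using vecs_swap[OF assms(1) c(1)] c(2) by simp
  ultimately have "dom_le x y" "x \<noteq> y"
    using assms(1,4) dom_le_trans vecs_antisym by blast+
  then obtain a q where a: "lead x y a q" "disorder x a q"
    using ex_lead_disorder[OF assms(1,2)] by blast
  obtain b s where b: "lead z y b s" "disorder z b s"
    using ex_lead_disorder[OF z assms(2,4,6)] by blast
  have "\<rho> a < \<rho> c \<or> a = c \<and> q < p"
    using swap_label_cases[OF assms(1,2) a(1) c(1)] assms(4,5) c(2) atom_eq[OF a(1)] by auto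
  then have "\<rho> b < \<rho> c \<or> b = c \<and> s < p"
    using greedy_descent[OF a(1) c(1)] b(1) c(2) by blast
  then have "\<rho> b * Suc m + s < \<rho> c * Suc m + p"
    using lex_less disorderD(7)[OF b(2)] disorderD(7)[OF c(1)] by blast
  then show ?thesis
    using atom_eq[OF b(1)] swap_label_swap[OF b(2)] swap_label_swap[OF c(1)] c(2) by simp
qed

lemma atom_ascent:
  assumes "x \<in> vecs M" "y \<in> vecs M" "dom_le x y" "x \<noteq> y" "atom x y \<noteq> y"
  shows "swap_label x (atom x y) < swap_label (atom x y) (atom (atom x y) y)"
proof -
  obtain a q where a: "lead x y a q" "disorder x a q" "dom_le (x \<circ> transpose a q) y"
    using ex_lead_disorder[OF assms(1-4)] by blast
  let ?z = "x \<circ> transpose a q"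
  have eq: "atom x y = ?z" using atom_eq[OF a(1)] .
  obtain b s where b: "lead ?z y b s" "disorder ?z b s"
    using ex_lead_disorder[OF vecs_swap[OF assms(1) a(2)] assms(2) a(3)] assms(5) eq by auto
  show ?thesis
    unfolding eq atom_eq[OF b(1)] swap_label_swap[OF a(2)] swap_label_swap[OF b(2)]
    using lex_less[OF greedy_ascent[OF a(1) b(1)]] disorderD(7)[OF a(2)] disorderD(7)[OF b(2)] by blast
qed

end

section \<open>Bubble sort\<close>

locale forest_rows = rows +
  assumes no_312: "\<And>j t s. j \<in> P \<Longrightarrow> t \<in> P \<Longrightarrow> s \<in> P \<Longrightarrow> j < t \<Longrightarrow> t < s \<Longrightarrow>
    \<rho> t < \<rho> s \<Longrightarrow> \<rho> s < \<rho> j \<Longrightarrow> False"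
begin

definition dominant :: "nat \<Rightarrow> (nat \<Rightarrow> nat) \<Rightarrow> bool" where
  "dominant l d \<longleftrightarrow> (l \<notin> P \<longrightarrow> d l = 0) \<and>
     (l \<in> P \<longrightarrow> (\<forall>s\<in>P. s < l \<and> \<rho> l < \<rho> s \<longrightarrow> d l \<le> d s))"

text \<open>What the proofs use of the column chosen by the algorithm: among the earlier columns
  with smaller entry it has the highest row. \<open>Max_maximal_cells\<close> links this to the
  rightmost maximal cell.\<close>

definition bubble_target :: "nat \<Rightarrow> (nat \<Rightarrow> nat) \<Rightarrow> nat \<Rightarrow> bool" where
  "bubble_target k d j \<longleftrightarrow> j \<in> P \<and> j < k \<and> d j < d k \<and>
     (\<forall>s\<in>P. s < k \<and> \<rho> j < \<rho> s \<longrightarrow> d k \<le> d s)"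

text \<open>
  If \<open>A\<close> failed to lie below the swapped vector, then at some level \<open>v\<close> and column \<open>c\<close> the
  counts of \<open>A\<close> and \<open>d\<close> would agree. Comparing them at \<open>k\<close> gives a cell \<open>s\<close> below \<open>j\<close> with
  \<open>v \<le> A s\<close>; since the cells below \<open>j\<close> form a chain, \<open>A\<close> then has more large entries than
  \<open>d\<close> from \<open>j\<close> to \<open>c\<close>, hence fewer before \<open>j\<close>.
\<close>

lemma dom_le_bubble_step:
  assumes A: "dense A" "dom_le A d"
    and dom: "\<And>l. l < k \<Longrightarrow> dominant l d"
    and j: "bubble_target k d j"
    and k: "k \<in> P \<Longrightarrow> \<rho> k < \<rho> j"
  shows "dom_le A (d \<circ> transpose j k)"
proof -
  have j': "j \<in> P" "j < k" "d j < d k"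
    and top: "\<And>s. s \<in> P \<Longrightarrow> s < k \<Longrightarrow> \<rho> j < \<rho> s \<Longrightarrow> d k \<le> d s"
    using j by (auto simp: bubble_target_def)
  have j1: "1 \<le> j" using P_bounds[OF j'(1)] by simp
  let ?b = "d \<circ> transpose j k"
  have cnt_b: "cnt ?b c v = cnt d c v + (if j \<le> c \<and> c < k \<and> d j < v \<and> v \<le> d k then 1 else 0)"
    for c v
    using cnt_swap[OF j1 j'(2), of ?b c v] j'(3) by (simp add: comp_assoc)
  have strict: "cnt d c v < cnt A c v"
    if c: "j \<le> c" "c < k" and v: "d j < v" "v \<le> d k" for c v
  proof (rule ccontr)
    assume less: "\<not> ?thesis"
    have eq: "cnt A c v = cnt d c v" using less dom_leD[OF A(2), of c v] by simp
    have "\<not> {i \<in> {Suc c..k}. v \<le> A i} \<subseteq> {i \<in> {Suc c..k}. v \<le> d i} - {k}"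
    proof
      assume "{i \<in> {Suc c..k}. v \<le> A i} \<subseteq> {i \<in> {Suc c..k}. v \<le> d i} - {k}"
      moreover have "k \<in> {i \<in> {Suc c..k}. v \<le> d i}" using c v by simp
      ultimately have "card {i \<in> {Suc c..k}. v \<le> A i} < card {i \<in> {Suc c..k}. v \<le> d i}"
        by (intro psubset_card_mono) auto
      then show False
        using eq cnt_split[of c k A v] cnt_split[of c k d v] c(2) dom_leD[OF A(2), of k v] by simp
    qed
    then obtain s where s: "c < s" "s \<le> k" "v \<le> A s" "s = k \<or> d s < v"
      by (auto simp: Suc_le_eq simp flip: not_le)
    have sP: "s \<in> P" using dense_support[OF A(1), of s] s(3) v by fastforce
    have rs: "\<rho> s < \<rho> j"
    proof (cases "s = k")
      case True
      then show ?thesis using k sP by simp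
    next
      case False
      then have "\<not> \<rho> j < \<rho> s" using top[OF sP] s(2,4) v(2) by auto
      moreover have "\<rho> s \<noteq> \<rho> j" using rho_eq_iff[OF sP j'(1)] s(1) c(1) by simp
      ultimately show ?thesis by simp
    qed
    have Aj: "v \<le> A j" using denseD[OF A(1) j'(1) sP] rs s(1,3) c(1) by simp
    \<comment> \<open>Before \<open>k\<close>, \<open>d\<close> vanishes outside \<open>P\<close>,
      so \<open>t\<close> carries a cell. Were \<open>A t < v\<close>, density of \<open>A\<close>
      would put \<open>t\<close> in a lower row than \<open>s\<close>, and \<open>j\<close>,
      \<open>t\<close>, \<open>s\<close> would form the forbidden pattern.\<close>
    have "v \<le> A t" if t: "t \<in> {j..c}" "v \<le> d t" for t
    proof (rule ccontr)
      assume not: "\<not> v \<le> A t"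
      have "t \<noteq> j" using t(2) v(1) by auto
      then have lt: "j < t" "t < s" using t(1) s(1) by auto
      have tP: "t \<in> P"
        using dom[of t] t v(1) c(2) by (auto simp: dominant_def)
      have "\<not> \<rho> s < \<rho> t" using denseD[OF A(1) tP sP] lt(2) s(3) not by auto
      then have "\<rho> t < \<rho> s" using rho_eq_iff[OF sP tP] lt(2) by linarith
      then show False using no_312[OF j'(1) tP sP lt _ rs] by blast
    qed
    then have "{t \<in> {j..c}. v \<le> d t} \<subseteq> {t \<in> {j..c}. v \<le> A t} - {j}"
      using v(1) by auto
    moreover have "j \<in> {t \<in> {j..c}. v \<le> A t}" using Aj c(1) by simp
    ultimately have "card {t \<in> {j..c}. v \<le> d t} < card {t \<in> {j..c}. v \<le> A t}"
      by (intro psubset_card_mono) auto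
    then show False
      using eq cnt_split[of "j - 1" c A v] cnt_split[of "j - 1" c d v] c(1) j1
        dom_leD[OF A(2), of "j - 1" v] by simp
  qed
  show ?thesis
    unfolding dom_le_def
  proof (intro allI)
    fix c v
    show "cnt ?b c v \<le> cnt A c v"
      using cnt_b[of c v] strict[of c v] dom_leD[OF A(2), of c v] by (auto split: if_splits)
  qed
qed

text \<open>Raising the entry in column \<open>j\<close> endangers only its comparison with higher
  rows to the left, and these hold at least \<open>d k\<close> by the choice of
  \<open>j\<close>.\<close>

lemma bubble_step_dominant:
  assumes dom: "\<And>l. l < k \<Longrightarrow> dominant l d" and j: "bubble_target k d j" and "l < k"
  shows "dominant l (d \<circ> transpose j k)"
proof -
  have j': "j \<in> P" "j < k" "d j < d k"
    and top: "\<And>s. s \<in> P \<Longrightarrow> s < k \<Longrightarrow> \<rho> j < \<rho> s \<Longrightarrow> d k \<le> d s"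
    using j by (auto simp: bubble_target_def)
  let ?b = "d \<circ> transpose j k"
  have "?b l \<le> ?b s" if "l \<in> P" "s \<in> P" "s < l" "\<rho> l < \<rho> s" for s
  proof -
    have ds: "d l \<le> d s" using dom[OF assms(3)] that by (auto simp: dominant_def)
    consider "l = j" | "s = j" | "l \<noteq> j" "s \<noteq> j" by blast
    then show ?thesis
      using ds top[OF that(2)] that(3,4) assms(3) j'(3) by cases (auto simp: transpose_def)
  qed
  moreover have "?b l = 0" if "l \<notin> P"
    using dom[OF assms(3)] that assms(3) j'(1) by (auto simp: dominant_def transpose_def)
  ultimately show ?thesis unfolding dominant_def by blast
qed

text \<open>
  If \<open>k\<close> is not in \<open>P\<close>, the dense lower bound \<open>B\<close> limits the number of nonzero entries of
  \<open>d\<close> up to \<open>k\<close>, so the entries to the left cannot all be at least \<open>d k > 0\<close>.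
\<close>

lemma ex_bubble_source:
  assumes B: "dense B" "dom_le B d"
    and dom: "\<And>l. l < k \<Longrightarrow> dominant l d" and "\<not> dominant k d" "1 \<le> k"
  shows "\<exists>s\<in>P. s < k \<and> d s < d k \<and> (k \<in> P \<longrightarrow> \<rho> k < \<rho> s)"
proof (cases "k \<in> P")
  case True
  then show ?thesis using assms(4) unfolding dominant_def by (auto simp: not_le)
next
  case False
  then have pos: "0 < d k" using assms(4) by (simp add: dominant_def)
  show ?thesis
  proof (rule ccontr)
    assume no: "\<not> ?thesis"
    have "{i \<in> {1..k}. 1 \<le> B i} \<subseteq> {i \<in> {1..k}. 1 \<le> d i} - {k}"
    proof
      fix i assume i: "i \<in> {i \<in> {1..k}. 1 \<le> B i}"
      then have "i \<in> P" using dense_support[OF B(1), of i] by fastforce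
      moreover from this False have "i \<noteq> k" by blast
      ultimately show "i \<in> {i \<in> {1..k}. 1 \<le> d i} - {k}"
        using no i pos False by fastforce
    qed
    moreover have "k \<in> {i \<in> {1..k}. 1 \<le> d i}" using pos assms(5) by simp
    ultimately have "cnt B k 1 < cnt d k 1"
      unfolding cnt_def by (intro psubset_card_mono) auto
    then show False using dom_leD[OF B(2), of k 1] by simp
  qed
qed

text \<open>The last conjunct keeps every dense lower bound of the input, so the final vector, being
  dense, is the greatest one. It also carries along the lower bound that
  \<open>ex_bubble_source\<close> requires.\<close>

definition bubble_inv :: "nat \<Rightarrow> (nat \<Rightarrow> nat) \<Rightarrow> (nat \<Rightarrow> nat) \<Rightarrow> bool" where
  "bubble_inv k d0 d \<longleftrightarrow> (\<forall>l<k. dominant l d) \<and> (\<forall>i. i \<notin> {1..m} \<longrightarrow> d i = 0) \<and>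
     content m d = content m d0 \<and> bruhat m d d0 \<and>
     (\<forall>A. dense A \<and> dom_le A d0 \<longrightarrow> dom_le A d)"

lemma bubble_inv_step:
  assumes inv: "bubble_inv k d0 d" and k: "1 \<le> k" "k \<le> m" and j: "bubble_target k d j"
    and kj: "k \<in> P \<Longrightarrow> \<rho> k < \<rho> j"
  shows "bubble_inv k d0 (d \<circ> transpose j k)"
proof -
  let ?b = "d \<circ> transpose j k"
  have j': "j \<in> P" "j < k" "d j < d k" using j by (auto simp: bubble_target_def)
  have j1: "1 \<le> j" "j \<le> m" using P_bounds[OF j'(1)] by auto
  have dom: "\<And>l. l < k \<Longrightarrow> dominant l d" using inv by (simp add: bubble_inv_def)
  have "?b i = 0" if "i \<notin> {1..m}" for i
  proof -
    have "i \<noteq> j" "i \<noteq> k" using that k j1 by auto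
    then show ?thesis using inv that by (simp add: bubble_inv_def)
  qed
  moreover have "bruhat m ?b d0"
  proof -
    have "bruhat_step m ?b d"
      unfolding bruhat_step_def using j1 j' k
      by (intro exI[of _ j] exI[of _ k]) (simp add: comp_assoc)
    then show ?thesis
      using inv unfolding bubble_inv_def bruhat_def by (meson converse_rtranclp_into_rtranclp)
  qed
  moreover have "content m ?b = content m d0"
    using content_swap[of j m k d] inv j1 k by (simp add: bubble_inv_def)
  moreover have "dom_le A ?b" if "dense A" "dom_le A d0" for A
    using dom_le_bubble_step[OF that(1) _ dom j kj] inv that by (simp add: bubble_inv_def)
  moreover have "dominant l ?b" if "l < k" for l
    using bubble_step_dominant[OF dom j that] .
  ultimately show ?thesis unfolding bubble_inv_def by blast
qed

lemma dominant_all_dense: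
  assumes "\<forall>l<Suc m. dominant l d" "\<forall>i. i \<notin> {1..m} \<longrightarrow> d i = 0"
  shows "dense d"
  unfolding dense_def
proof (intro conjI allI ballI impI)
  show "d i = 0" if "i \<notin> P" for i
    using assms that by (cases "i \<in> {1..m}") (auto simp: dominant_def)
  show "d q \<le> d p" if "p \<in> P" "q \<in> P" "p < q \<and> \<rho> q < \<rho> p" for p q
    using assms(1) that P_bounds[OF that(2)] by (auto simp: dominant_def)
qed

lemma dense_dominant: "dense d \<Longrightarrow> dominant l d"
  using dense_support denseD unfolding dominant_def by blast

end

section \<open>The staircase as a forest of cells\<close>

lemma free_rows_Max:
  assumes "free_rows S h \<noteq> {}"
  shows "1 \<le> Max (free_rows S h)" "Max (free_rows S h) \<le> h" "(Max (free_rows S h), l) \<notin> S"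
    "\<And>i. Max (free_rows S h) < i \<Longrightarrow> i \<le> h \<Longrightarrow> \<exists>l. (i, l) \<in> S"
proof -
  have fin: "finite (free_rows S h)" by (simp add: free_rows_def)
  have "Max (free_rows S h) \<in> free_rows S h" by (rule Max_in[OF fin assms])
  then show "1 \<le> Max (free_rows S h)" "Max (free_rows S h) \<le> h" "(Max (free_rows S h), l) \<notin> S"
    unfolding free_rows_def by auto
  fix i assume i: "Max (free_rows S h) < i" "i \<le> h"
  then have "i \<notin> free_rows S h" using Max_ge[OF fin, of i] by auto
  then show "\<exists>l. (i, l) \<in> S" using i unfolding free_rows_def by auto
qed

lemma staircase_bounds: "(i, j) \<in> staircase m n \<Longrightarrow> 1 \<le> j \<and> j \<le> m \<and> 1 \<le> i \<and> i \<le> n j"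
proof (induction m)
  case (Suc m)
  then show ?case
    using free_rows_Max(1,2)[of "staircase m n" "n (Suc m)"] by (auto simp: Let_def split: if_splits)
qed simp

lemma finite_staircase [simp]: "finite (staircase m n)"
  by (induction m) (simp_all add: Let_def)

lemma staircase_same_col: "(i, j) \<in> staircase m n \<Longrightarrow> (i', j) \<in> staircase m n \<Longrightarrow> i = i'"
proof (induction m)
  case (Suc m)
  then show ?case
    using staircase_bounds[of _ "Suc m" m n] by (auto simp: Let_def split: if_splits)
qed simp

lemma staircase_same_row: "(i, j) \<in> staircase m n \<Longrightarrow> (i, j') \<in> staircase m n \<Longrightarrow> j = j'"
proof (induction m)
  case (Suc m)
  then show ?case
    using free_rows_Max(3)[of "staircase m n" "n (Suc m)"] by (auto simp: Let_def split: if_splits)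
qed simp

text \<open>The highest free row is chosen, so higher rows within the height of the column were
  taken by earlier columns.\<close>

lemma staircase_above_occupied:
  "(i, j) \<in> staircase m n \<Longrightarrow> i < i' \<Longrightarrow> i' \<le> n j \<Longrightarrow> \<exists>l\<le>j. (i', l) \<in> staircase m n"
proof (induction m)
  case (Suc m)
  let ?S = "staircase m n" let ?R = "free_rows ?S (n (Suc m))"
  have sub: "?S \<subseteq> staircase (Suc m) n" by (auto simp: Let_def)
  show ?case
  proof (cases "(i, j) \<in> ?S")
    case True
    then show ?thesis using Suc sub by blast
  next
    case False
    then have "?R \<noteq> {}" "i = Max ?R" "j = Suc m"
      using Suc.prems(1) by (auto simp: Let_def split: if_splits)
    then obtain l where "(i', l) \<in> ?S"
      using free_rows_Max(4)[of ?S "n (Suc m)" i'] Suc.prems(2,3) by blast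
    then show ?thesis
      using sub staircase_bounds[of i' l m n] \<open>j = Suc m\<close> by (intro exI[of _ l]) auto
  qed
qed simp

text \<open>Row \<open>i'\<close> is still free when column \<open>j\<close> is processed, so it
  would have been preferred to \<open>i\<close> if it fitted into that column.\<close>

lemma staircase_height_less:
  assumes "(i, j) \<in> staircase m n" "(i', j') \<in> staircase m n" "j < j'" "i < i'"
  shows "n j < i'"
proof (rule ccontr)
  assume "\<not> n j < i'"
  then obtain l where "l \<le> j" "(i', l) \<in> staircase m n"
    using staircase_above_occupied[OF assms(1,4)] by auto
  then show False using staircase_same_row[OF assms(2)] assms(3) by auto
qed

locale staircase_diagram =
  fixes m :: nat and n :: "nat \<Rightarrow> nat"
  assumes mono_n: "mono_on {1..m} n"
begin

definition cols :: "nat set" where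
  "cols = snd ` staircase m n"

definition row :: "nat \<Rightarrow> nat" where
  "row j = (THE i. (i, j) \<in> staircase m n)"

lemma row_eq: "(i, j) \<in> staircase m n \<Longrightarrow> row j = i"
  unfolding row_def using staircase_same_col by blast

lemma cell_iff: "(i, j) \<in> staircase m n \<longleftrightarrow> j \<in> cols \<and> i = row j"
proof
  assume "(i, j) \<in> staircase m n"
  then show "j \<in> cols \<and> i = row j" using row_eq unfolding cols_def by force
next
  assume "j \<in> cols \<and> i = row j"
  then show "(i, j) \<in> staircase m n" using row_eq unfolding cols_def by force
qed

lemma staircase_eq: "staircase m n = (\<lambda>j. (row j, j)) ` cols"
  using cell_iff by auto

lemma row_bounds: "j \<in> cols \<Longrightarrow> 1 \<le> row j \<and> row j \<le> n j"
  using staircase_bounds cell_iff by blast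

end

text \<open>A 312 pattern would give \<open>n t < row s < row j \<le> n j \<le> n t\<close>; the
  last inequality is the monotonicity of the heights.\<close>

sublocale staircase_diagram \<subseteq> forest_rows m cols row
proof
  show "cols \<subseteq> {1..m}"
    using staircase_bounds unfolding cols_def by fastforce
  show "inj_on row cols"
    using staircase_same_row cell_iff by (intro inj_onI) metis
  fix j t s assume *: "j \<in> cols" "t \<in> cols" "s \<in> cols" "j < t" "t < s"
    "row t < row s" "row s < row j"
  have "n t < row s"
    using staircase_height_less[of "row t" t m n "row s" s] * cell_iff by blast
  moreover have "row j \<le> n j"
    using staircase_bounds[of "row j" j m n] * cell_iff by blast
  moreover have "n j \<le> n t"
    using mono_onD[OF mono_n, of j t] staircase_bounds[of "row j" j m n]
      staircase_bounds[of "row t" t m n] * cell_iff by auto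
  ultimately show False using * by simp
qed

context staircase_diagram
begin

text \<open>With the identity as row function no cell lies above another, so the theory of dense
  vectors specialises to the whole orbit, and \<open>full.bruhat_iff_dom_le\<close> is the tableau
  criterion there.\<close>

sublocale full: rows m "{1..m}" id
  by unfold_locales auto

lemma full_dense_iff: "full.dense d \<longleftrightarrow> (\<forall>i. i \<notin> {1..m} \<longrightarrow> d i = 0)"
  unfolding full.dense_def by auto

lemma lvecs_sub_full: "d \<in> lvecs lam \<Longrightarrow> d \<in> full.lvecs lam"
  using dense_support[of d] P_sub unfolding vecs_iff full.vecs_iff full_dense_iff by blast

lemma card_staircase: "card (staircase m n) = card cols"
  unfolding staircase_eq by (rule card_image) (simp add: inj_on_def)


section \<open>Arrays and vectors\<close>

definition arr :: "(nat \<Rightarrow> nat) \<Rightarrow> cell \<Rightarrow> nat" where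
  "arr d s = (if s \<in> staircase m n then d (snd s) else 0)"

definition supported :: "(cell \<Rightarrow> nat) \<Rightarrow> bool" where
  "supported A \<longleftrightarrow> (\<forall>s. s \<notin> staircase m n \<longrightarrow> A s = 0)"

lemma supported_arr [simp]: "supported (arr d)"
  by (simp add: supported_def arr_def)

lemma vrt_eq:
  assumes "supported A"
  shows "vrt m n A j = (if j \<in> cols then A (row j, j) else 0)"
proof (cases "1 \<le> j \<and> j \<le> m")
  case True
  have *: "A (i, j) = (if i = row j then (if j \<in> cols then A (row j, j) else 0) else 0)" for i
    using assms cell_iff[of i j] unfolding supported_def by auto
  have "vrt m n A j = (\<Sum>i = 1..n j. A (i, j))"
    using True by (simp add: vrt_def)
  also have "\<dots> = (\<Sum>i = 1..n j. if i = row j then (if j \<in> cols then A (row j, j) else 0) else 0)"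
    by (rule sum.cong[OF refl *])
  also have "\<dots> = (if row j \<in> {1..n j} then (if j \<in> cols then A (row j, j) else 0) else 0)"
    by (rule sum.delta) simp
  finally show ?thesis using row_bounds[of j] by auto
next
  case False
  then show ?thesis using P_bounds[of j] by (auto simp: vrt_def)
qed

lemma vrt_arr: "(\<And>j. j \<notin> cols \<Longrightarrow> d j = 0) \<Longrightarrow> vrt m n (arr d) = d"
  using vrt_eq[OF supported_arr] cell_iff by (auto simp: arr_def fun_eq_iff)

lemma arr_vrt: "supported A \<Longrightarrow> arr (vrt m n A) = A"
  using cell_iff by (auto simp: arr_def fun_eq_iff vrt_eq supported_def)

lemma vrt_inj: "supported A \<Longrightarrow> supported B \<Longrightarrow> vrt m n A = vrt m n B \<Longrightarrow> A = B"
  by (metis arr_vrt)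

lemma cell_less_iff:
  assumes "p \<in> cols" "q \<in> cols"
  shows "cell_less (row q, q) (row p, p) \<longleftrightarrow> p < q \<and> row q < row p"
  using rho_eq_iff[OF assms] by (auto simp: cell_less_def cell_le_def le_less)

lemma dense_vrt_iff:
  assumes "supported A"
  shows "dense (vrt m n A) \<longleftrightarrow>
    (\<forall>s\<in>staircase m n. \<forall>t\<in>staircase m n. cell_less s t \<longrightarrow> A s \<le> A t)"
  unfolding staircase_eq dense_def using assms by (auto simp: vrt_eq cell_less_iff)

lemma mset_diagram:
  assumes "supported A"
  shows "filter_mset (\<lambda>x. x \<noteq> 0) (image_mset A (mset_set (diagram m n)))
    = filter_mset (\<lambda>x. x \<noteq> 0) (image_mset (vrt m n A) (mset_set cols))"
proof -
  have "diagram m n \<subseteq> (\<Union>j\<in>{1..m}. {1..n j} \<times> {j})" by (auto simp: diagram_def)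
  then have fin: "finite (diagram m n)" by (rule finite_subset) simp
  have sub: "staircase m n \<subseteq> diagram m n" using staircase_bounds by (auto simp: diagram_def)
  have "mset_set (diagram m n) = mset_set (staircase m n) + mset_set (diagram m n - staircase m n)"
    using mset_set_Union[of "staircase m n" "diagram m n - staircase m n"] fin sub
    by (simp add: Un_absorb1)
  moreover have "filter_mset (\<lambda>x. x \<noteq> 0) (image_mset A (mset_set (diagram m n - staircase m n))) = {#}"
    using assms fin by (auto simp: supported_def)
  moreover have "image_mset A (mset_set (staircase m n)) = image_mset (vrt m n A) (mset_set cols)"
  proof -
    have "mset_set (staircase m n) = image_mset (\<lambda>j. (row j, j)) (mset_set cols)"
      unfolding staircase_eq by (rule image_mset_mset_set[symmetric]) (simp add: inj_on_def)
    then show ?thesis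
      using assms by (auto simp: image_mset.compositionality vrt_eq intro!: image_mset_cong)
  qed
  ultimately show ?thesis by simp
qed

lemma DL_empty:
  assumes "card cols < length lam"
  shows "DL m n lam = {}"
proof (rule ccontr)
  assume "DL m n lam \<noteq> {}"
  then obtain A where A: "supported A"
      "filter_mset (\<lambda>x. x \<noteq> 0) (image_mset A (mset_set (diagram m n))) = mset lam"
    unfolding DL_def supported_def by blast
  then have "length lam = size (filter_mset (\<lambda>x. x \<noteq> 0) (image_mset (vrt m n A) (mset_set cols)))"
    using mset_diagram[OF A(1)] by (metis size_mset)
  also have "\<dots> \<le> card cols"
    using size_filter_mset_lesseq[of "\<lambda>x. x \<noteq> 0" "image_mset (vrt m n A) (mset_set cols)"] by simp
  finally show False using assms by simp
qed

lemma DL_iff: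
  assumes "is_partition lam" "length lam \<le> card cols"
  shows "A \<in> DL m n lam \<longleftrightarrow> supported A \<and> vrt m n A \<in> lvecs lam"
proof (cases "supported A")
  case True
  have "content m (vrt m n A) = content m (part lam) \<longleftrightarrow>
      filter_mset (\<lambda>x. x \<noteq> 0) (image_mset A (mset_set (diagram m n))) = mset lam"
    unfolding mset_diagram[OF True]
    by (rule content_iff) (use True assms in \<open>simp_all add: vrt_eq\<close>)
  then show ?thesis
    using True dense_vrt_iff[OF True] unfolding vecs_iff DL_def supported_def by auto
qed (auto simp: DL_def supported_def)

lemma minimal_disorder_iff:
  assumes "supported A"
  shows "minimal_disorder m n A s t \<longleftrightarrow>
    (\<exists>c q. s = (row c, c) \<and> t = (row q, q) \<and> disorder (vrt m n A) c q)"
proof -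
  have all: "(\<forall>(k, l)\<in>staircase m n. Q k l) \<longleftrightarrow> (\<forall>p\<in>cols. Q (row p) p)" for Q
    unfolding staircase_eq by simp
  have iff: "minimal_disorder m n A (row c, c) (row q, q) \<longleftrightarrow> disorder (vrt m n A) c q"
    if "c \<in> cols" "q \<in> cols" for c q
    unfolding minimal_disorder.simps all disorder_def
    using that cell_iff by (auto simp: vrt_eq[OF assms])
  show ?thesis
  proof
    assume md: "minimal_disorder m n A s t"
    then have "s \<in> staircase m n" "t \<in> staircase m n" by (cases s; cases t; simp)+
    then obtain c q where "c \<in> cols" "q \<in> cols" "s = (row c, c)" "t = (row q, q)"
      unfolding staircase_eq by blast
    then show "\<exists>c q. s = (row c, c) \<and> t = (row q, q) \<and> disorder (vrt m n A) c q"
      using md iff by blast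
  next
    assume "\<exists>c q. s = (row c, c) \<and> t = (row q, q) \<and> disorder (vrt m n A) c q"
    then show "minimal_disorder m n A s t"
      using iff disorderD(1,2) by blast
  qed
qed

lemma supported_swap:
  assumes "supported A" "c \<in> cols" "q \<in> cols"
  shows "supported (A \<circ> transpose (row c, c) (row q, q))"
    and "vrt m n (A \<circ> transpose (row c, c) (row q, q)) = vrt m n A \<circ> transpose c q"
proof -
  show *: "supported (A \<circ> transpose (row c, c) (row q, q))"
    using assms cell_iff unfolding supported_def by (auto simp: transpose_def)
  show "vrt m n (A \<circ> transpose (row c, c) (row q, q)) = vrt m n A \<circ> transpose c q"
    using assms by (auto simp: fun_eq_iff vrt_eq[OF *] vrt_eq[OF assms(1)] transpose_def)
qed

lemma disorder_swap_iff:
  assumes "supported A"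
  shows "disorder_swap m n A B \<longleftrightarrow> supported B \<and> disorder_step (vrt m n A) (vrt m n B)"
proof
  assume "disorder_swap m n A B"
  then obtain c q where m: "disorder (vrt m n A) c q"
    and B: "B = A \<circ> transpose (row c, c) (row q, q)"
    unfolding disorder_swap_def minimal_disorder_iff[OF assms] by blast
  show "supported B \<and> disorder_step (vrt m n A) (vrt m n B)"
    unfolding disorder_step_def B using supported_swap[OF assms disorderD(1,2)[OF m]] m by blast
next
  assume B: "supported B \<and> disorder_step (vrt m n A) (vrt m n B)"
  then obtain c q where m: "disorder (vrt m n A) c q" "vrt m n B = vrt m n A \<circ> transpose c q"
    unfolding disorder_step_def by blast
  have "B = A \<circ> transpose (row c, c) (row q, q)"
    by (rule vrt_inj) (use B m supported_swap[OF assms disorderD(1,2)[OF m(1)]] in simp_all)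
  then show "disorder_swap m n A B"
    unfolding disorder_swap_def minimal_disorder_iff[OF assms] using m(1) by blast
qed

lemma relabel_eq:
  assumes "supported A"
  shows "relabel m n lam A = arr (fill lam (vrt m n A))"
proof
  fix s
  show "relabel m n lam A s = arr (fill lam (vrt m n A)) s"
  proof (cases "s \<in> staircase m n")
    case True
    then obtain j where j: "j \<in> cols" "s = (row j, j)" unfolding staircase_eq by blast
    have "{t \<in> staircase m n. A s \<le> A t}
        = (\<lambda>p. (row p, p)) ` {p \<in> cols. vrt m n A j \<le> vrt m n A p}"
      unfolding staircase_eq using j by (auto simp: vrt_eq[OF assms])
    then have "card {t \<in> staircase m n. A s \<le> A t} = rank (vrt m n A) j"
      unfolding rank_def by (simp add: card_image inj_on_def)
    then show ?thesis using True j by (simp add: relabel_def arr_def fill_def)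
  qed (simp add: relabel_def arr_def)
qed

lemma vrt_arr_fill: "vrt m n (arr (fill lam g)) = fill lam g"
  by (rule vrt_arr) (simp add: fill_def)

lemma arr_fill_in_DL:
  assumes "is_partition lam" "length lam \<le> card cols" "fill lam g \<in> lvecs lam"
  shows "arr (fill lam g) \<in> DL m n lam"
  using DL_iff[OF assms(1,2)] assms(3) vrt_arr_fill by simp

text \<open>On these vectors relabelling is composition with a single nondecreasing function of the
  values, so \<open>bruhat_comp_mono\<close> applies.\<close>

lemma bruhat_fill_mono:
  assumes "is_partition lam" "x \<in> lvecs mu" "y \<in> lvecs mu"
    "\<And>p. p \<in> cols \<Longrightarrow> 0 < x p" "\<And>p. p \<in> cols \<Longrightarrow> 0 < y p" "bruhat m x y"
  shows "bruhat m (fill lam x) (fill lam y)"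
proof -
  \<comment> \<open>For values above all parts of \<open>mu\<close> the count is 0, and without
    \<open>max 1\<close> the default \<open>part lam 0 = 0\<close> would spoil monotonicity. The
    value 0 is kept for columns without a cell.\<close>
  define h where "h v = (if v = 0 then 0 else part lam (max 1 (card {l \<in> {1..m}. v \<le> part mu l})))"
    for v :: nat
  have "mono h"
  proof (rule monoI)
    fix v w :: nat assume "v \<le> w"
    then have "card {l \<in> {1..m}. w \<le> part mu l} \<le> card {l \<in> {1..m}. v \<le> part mu l}"
      by (intro card_mono) auto
    then show "h v \<le> h w"
      unfolding h_def using \<open>v \<le> w\<close> part_antimono[OF assms(1)] by (auto intro!: part_antimono[OF assms(1)])
  qed
  moreover have "fill lam d = h \<circ> d" if "d \<in> lvecs mu" "\<And>p. p \<in> cols \<Longrightarrow> 0 < d p" for d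
  proof
    fix j
    have d: "dense d" "content m d = content m (part mu)" using that by (auto simp: vecs_iff)
    show "fill lam d j = (h \<circ> d) j"
    proof (cases "j \<in> cols")
      case True
      have "{p \<in> cols. d j \<le> d p} = {i \<in> {1..m}. d j \<le> d i}"
        using that(2)[OF True] dense_support[OF d(1)] P_bounds by fastforce
      then have "rank d j = card {l \<in> {1..m}. d j \<le> part mu l}"
        unfolding rank_def using card_content_cong[OF d(2), of "\<lambda>v. d j \<le> v"] by simp
      then show ?thesis
        using rank_range(1)[OF True, of d] that(2)[OF True] True by (simp add: fill_def h_def max_def)
    next
      case False
      then show ?thesis using dense_support[OF d(1)] by (simp add: fill_def h_def)
    qed
  qed
  ultimately show ?thesis
    using bruhat_comp_mono[OF assms(6)] assms(2-5) by metis
qed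

section \<open>The Bruhat interval as a set of vectors\<close>

lemma rearrangements_eq:
  assumes "length lam \<le> m"
  shows "rearrangements m lam = full.lvecs lam"
proof
  have part0: "part lam i = 0" if "i \<notin> {1..m}" for i
    using that assms by (auto simp: part_def)
  show "rearrangements m lam \<subseteq> full.lvecs lam"
    unfolding rearrangements_def full.vecs_def full_dense_iff
    using part0 content_permute by (auto simp: permutes_not_in)
  show "full.lvecs lam \<subseteq> rearrangements m lam"
  proof
    fix d assume d: "d \<in> full.lvecs lam"
    then have "image_mset d (mset_set {1..m}) = image_mset (part lam) (mset_set {1..m})"
      unfolding full.vecs_iff content_def by blast
    then obtain \<sigma> where \<sigma>: "\<sigma> permutes {1..m}" "\<forall>x\<in>{1..m}. part lam x = d (\<sigma> x)"
      using image_mset_eq_implies_permutes[of "{1..m}" "part lam" d] by auto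
    have "d = part lam \<circ> inv \<sigma>"
    proof
      fix i
      show "d i = (part lam \<circ> inv \<sigma>) i"
      proof (cases "i \<in> {1..m}")
        case True
        then have "inv \<sigma> i \<in> {1..m}" using permutes_in_image[OF permutes_inv[OF \<sigma>(1)]] by blast
        then show ?thesis using \<sigma> by (simp add: permutes_inverses(1)[OF \<sigma>(1)])
      next
        case False
        then show ?thesis
          using d part0 permutes_not_in[OF permutes_inv[OF \<sigma>(1)], of i]
          unfolding full.vecs_iff full_dense_iff by simp
      qed
    qed
    then show "d \<in> rearrangements m lam"
      unfolding rearrangements_def using permutes_inv[OF \<sigma>(1)] by blast
  qed
qed

lemma lam_plus_eq: "lam_plus m n lam = fill lam (\<lambda>j. m - j)"
proof
  fix j
  have "{p \<in> cols. m - j \<le> m - p} = {p \<in> cols. p \<le> j}" if "j \<in> cols"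
    using P_bounds P_bounds[OF that] by (auto simp: diff_le_mono2 dest: le_diff_iff'[THEN iffD1, rotated 2])
  then show "lam_plus m n lam j = fill lam (\<lambda>j. m - j) j"
    unfolding lam_plus_def fill_def rank_def cols_def[symmetric] by simp
qed

lemma lam_minus_eq: "lam_minus m lam = full.fill lam id"
proof
  fix j
  have "{p \<in> {1..m}. j \<le> p} = {j..m}" if "1 \<le> j" using that by auto
  then show "lam_minus m lam j = full.fill lam id j"
    unfolding lam_minus_def full.fill_def full.rank_def by simp
qed

lemma inj_on_minus: "inj_on (\<lambda>j. m - j) cols"
proof (rule inj_onI)
  fix a b assume "a \<in> cols" "b \<in> cols" "m - a = m - b"
  then show "a = b" using P_bounds[of a] P_bounds[of b] by linarith
qed

lemma lam_plus_in_lvecs: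
  assumes "is_partition lam" "length lam \<le> card cols"
  shows "lam_plus m n lam \<in> lvecs lam"
  unfolding lam_plus_eq by (rule fill_in_lvecs[OF assms inj_on_minus]) simp

text \<open>The upper bound holds on the whole orbit, and the lower one turns into dominance by the
  tableau criterion.\<close>

lemma bruhat_interval_iff:
  assumes "is_partition lam" "length lam \<le> card cols"
  shows "d \<in> bruhat_interval m n lam \<longleftrightarrow> d \<in> full.lvecs lam \<and> dom_le (lam_plus m n lam) d"
proof -
  have len: "length lam \<le> m" using assms(2) card_P_le by simp
  have plus: "lam_plus m n lam \<in> full.lvecs lam"
    using lvecs_sub_full lam_plus_in_lvecs[OF assms] by blast
  have "full.fill lam id \<in> full.lvecs lam"
    by (rule full.fill_in_lvecs[OF assms(1)]) (use len in auto)
  then have "d \<in> full.lvecs lam \<Longrightarrow> bruhat m d (lam_minus m lam)"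
    unfolding lam_minus_eq
    using full.bruhat_iff_dom_le full.fill_top_dom_le[OF assms(1)] len by simp
  then show ?thesis
    unfolding bruhat_interval_def rearrangements_eq[OF len]
    using full.bruhat_iff_dom_le[OF plus] by blast
qed

lemma lvecs_interval:
  assumes "is_partition lam" "length lam \<le> card cols" "d \<in> lvecs lam"
  shows "d \<in> bruhat_interval m n lam"
  using bruhat_interval_iff[OF assms(1,2)] lvecs_sub_full[OF assms(3)]
    fill_bottom_dom_le[OF assms] lam_plus_eq by simp


section \<open>Bubble sort computes the largest dense vector below\<close>

lemma dominant_at_iff: "dominant_at m n l d \<longleftrightarrow> dominant l d"
proof -
  have "snd ` (\<lambda>j. (row j, j)) ` cols = cols" by (simp add: image_image)
  then show ?thesis
    unfolding dominant_at_def dominant_def staircase_eq by (auto simp: cell_less_iff)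
qed

text \<open>Take a cell in the highest row. Rows of distinct cells differ, so nothing lies above it;
  a maximal cell further right would be in a row no higher, hence below it.\<close>

lemma Max_maximal_cells:
  assumes X: "X \<subseteq> staircase m n" "X \<noteq> {}"
  obtains j where "j = Max (snd ` maximal_cells X)" "(row j, j) \<in> X"
    "\<And>s. s \<in> X \<Longrightarrow> fst s \<le> row j"
proof -
  have fin: "finite X" using X(1) finite_subset[OF _ finite_staircase] by blast
  then have "finite (fst ` X)" by simp
  then have "Max (fst ` X) \<in> fst ` X" using X(2) by (intro Max_in) auto
  then obtain s0 where s0: "s0 \<in> X" "fst s0 = Max (fst ` X)" by auto
  have max: "fst s \<le> fst s0" if "s \<in> X" for s
    using Max_ge[OF \<open>finite (fst ` X)\<close>, of "fst s"] that s0(2) by simp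
  obtain j where j: "j \<in> cols" "s0 = (row j, j)" using s0(1) X(1) staircase_eq by blast
  have "s0 \<in> maximal_cells X"
    unfolding maximal_cells_def
  proof (intro CollectI conjI notI)
    assume "\<exists>t\<in>X. cell_less s0 t"
    then obtain t where t: "t \<in> X" "cell_less s0 t" by blast
    then obtain p where p: "p \<in> cols" "t = (row p, p)" using X(1) staircase_eq by blast
    then show False using max[OF t(1)] t(2) j cell_less_iff[OF p(1) j(1)] by simp
  qed (rule s0(1))
  moreover have "snd t \<le> snd s0" if "t \<in> maximal_cells X" for t
  proof (rule ccontr)
    assume "\<not> snd t \<le> snd s0"
    then have "cell_less t s0"
      using max[of t] that unfolding maximal_cells_def cell_less_def cell_le_def by auto
    then show False using that s0(1) unfolding maximal_cells_def by blast
  qed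
  moreover have "finite (maximal_cells X)"
    using fin unfolding maximal_cells_def by simp
  ultimately have "Max (snd ` maximal_cells X) = snd s0"
    by (intro Max_eqI) auto
  then show thesis using that[of j] s0(1) j max by auto
qed

lemma bubble_column_inv:
  assumes inv: "bubble_inv k d0 d" and k: "1 \<le> k" "k \<le> m" and B: "dense B" "dom_le B d0"
  shows "bubble_inv (Suc k) d0 (bubble_column m n k d)"
  unfolding bubble_column_def
\<comment> \<open>Each exchange puts a smaller entry into column \<open>k\<close>, so that entry
  measures termination.\<close>
proof (rule while_rule[where P = "bubble_inv k d0" and r = "measure (\<lambda>d. d k)"])
  let ?X = "\<lambda>d. {s \<in> staircase m n. snd s < k \<and> d (snd s) < d k}"
  let ?c = "\<lambda>d. let M = maximal_cells (?X d); j = Max (snd ` M) in d \<circ> transpose j k"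
  have step: "bubble_inv k d0 (?c e) \<and> ?c e k < e k"
    if e: "bubble_inv k d0 e" "\<not> dominant_at m n k e" for e
  proof -
    have dom: "\<And>l. l < k \<Longrightarrow> dominant l e" and "dom_le B e"
      using e(1) B by (auto simp: bubble_inv_def)
    then obtain s where s: "s \<in> cols" "s < k" "e s < e k" "k \<in> cols \<longrightarrow> row k < row s"
      using ex_bubble_source[OF B(1) _ dom] e(2) k(1) dominant_at_iff by blast
    then have "(row s, s) \<in> ?X e" using cell_iff by simp
    then obtain j where j: "j = Max (snd ` maximal_cells (?X e))" "(row j, j) \<in> ?X e"
      and max: "\<And>s. s \<in> ?X e \<Longrightarrow> fst s \<le> row j"
      using Max_maximal_cells[of "?X e"] by blast
    have jc: "j \<in> cols" "j < k" "e j < e k" using j(2) cell_iff by auto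
    have tgt: "bubble_target k e j"
      unfolding bubble_target_def
    proof (intro conjI ballI impI)
      fix t assume t: "t \<in> cols" "t < k \<and> row j < row t"
      then have "(row t, t) \<notin> ?X e" using max[of "(row t, t)"] by auto
      then show "e k \<le> e t" using t cell_iff by auto
    qed (use jc in auto)
    have "row k < row j" if "k \<in> cols"
      using max[OF \<open>(row s, s) \<in> ?X e\<close>] s(4) that by simp
    then have "bubble_inv k d0 (e \<circ> transpose j k)"
      using bubble_inv_step[OF e(1) k tgt] by blast
    then show ?thesis using jc j(1) by (simp add: Let_def)
  qed
  show "bubble_inv k d0 d" by fact
  show "bubble_inv k d0 (?c e)" if "bubble_inv k d0 e" "\<not> dominant_at m n k e" for e
    using step[OF that] by blast
  show "(?c e, e) \<in> measure (\<lambda>d. d k)" if "bubble_inv k d0 e" "\<not> dominant_at m n k e" for e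
    using step[OF that] by simp
  show "bubble_inv (Suc k) d0 e" if "bubble_inv k d0 e" "\<not> \<not> dominant_at m n k e" for e
    using that by (auto simp: bubble_inv_def dominant_at_iff less_Suc_eq)
qed simp

lemma bubble_sort_prefix_inv:
  assumes "\<forall>i. i \<notin> {1..m} \<longrightarrow> d0 i = 0" "dense B" "dom_le B d0" "k \<le> m"
  shows "bubble_inv (Suc k) d0 (fold (bubble_column m n) [1..<Suc k] d0)"
  using assms(4)
proof (induction k)
  case 0
  \<comment> \<open>The invariant for \<open>Suc 0\<close> includes dominance at index 0, which is
    not a column and only has to carry 0.\<close>
  have "dominant 0 d0"
    using assms(1) P_bounds[of 0] by (auto simp: dominant_def)
  then show ?case using assms(1) by (simp add: bubble_inv_def bruhat_def)
next
  case (Suc k)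
  then have "bubble_inv (Suc (Suc k)) d0
      (bubble_column m n (Suc k) (fold (bubble_column m n) [1..<Suc k] d0))"
    by (intro bubble_column_inv[OF _ _ _ assms(2,3)]) simp_all
  then show ?case by simp
qed

lemma bubble_sort_greatest:
  assumes "is_partition lam" "length lam \<le> card cols" "d \<in> bruhat_interval m n lam"
  shows "bubble_sort m n d \<in> lvecs lam" "bruhat m (bubble_sort m n d) d"
    "\<And>A. A \<in> lvecs lam \<Longrightarrow> dom_le A d \<Longrightarrow> dom_le A (bubble_sort m n d)"
proof -
  have d: "\<forall>i. i \<notin> {1..m} \<longrightarrow> d i = 0" "content m d = content m (part lam)"
    "dom_le (lam_plus m n lam) d"
    using assms(3) bruhat_interval_iff[OF assms(1,2)] full.vecs_iff full_dense_iff by auto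
  \<comment> \<open>This is the dense lower bound that guarantees an exchange partner throughout the
    run.\<close>
  have "dense (lam_plus m n lam)"
    using lam_plus_in_lvecs[OF assms(1,2)] by (simp add: vecs_iff)
  then have inv: "bubble_inv (Suc m) d (bubble_sort m n d)"
    unfolding bubble_sort_def using bubble_sort_prefix_inv[OF d(1) _ d(3) order_refl] by blast
  then show "bubble_sort m n d \<in> lvecs lam"
    using dominant_all_dense d(2) by (simp add: bubble_inv_def vecs_iff)
  show "bruhat m (bubble_sort m n d) d"
    "\<And>A. A \<in> lvecs lam \<Longrightarrow> dom_le A d \<Longrightarrow> dom_le A (bubble_sort m n d)"
    using inv by (auto simp: bubble_inv_def vecs_iff)
qed

lemma bubble_sort_dense:
  assumes "dense d"
  shows "bubble_sort m n d = d"
proof -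
  have "bubble_column m n k d = d" for k
    unfolding bubble_column_def
    using dense_dominant[OF assms] dominant_at_iff by (subst while_unfold) simp
  then have "fold (bubble_column m n) ks d = d" for ks
    by (induction ks) simp_all
  then show ?thesis by (simp add: bubble_sort_def)
qed

end

section \<open>The poset of DL-dense arrays\<close>

context staircase_diagram
begin

context
  fixes lam :: "nat list"
  assumes part_lam: "is_partition lam" and len_lam: "length lam \<le> card cols"
begin

lemma DL_D:
  assumes "A \<in> DL m n lam"
  shows "supported A" "vrt m n A \<in> lvecs lam"
  using assms DL_iff[OF part_lam len_lam] by auto

lemma DL_le_iff: "A \<in> DL m n lam \<Longrightarrow> B \<in> DL m n lam \<Longrightarrow>
    DL_le m n A B \<longleftrightarrow> dom_le (vrt m n A) (vrt m n B)"
  unfolding DL_le_def using bruhat_iff_dom_le DL_D(2) by blast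

lemma arr_in_DL: "d \<in> lvecs lam \<Longrightarrow> arr d \<in> DL m n lam \<and> vrt m n (arr d) = d"
  using DL_iff[OF part_lam len_lam, of "arr d"] vrt_arr[of d] dense_support[of d]
  by (auto simp: vecs_iff)

lemma vrt_image_DL: "vrt m n ` DL m n lam = lvecs lam"
  using arr_in_DL DL_D(2) by (auto simp: image_iff) metis

lemma vrt_iso: "order_iso_on (DL m n lam) (DL_le m n) (vrt m n ` DL m n lam) (bruhat m) (vrt m n)"
  unfolding order_iso_on_def DL_le_def
  using DL_D(1) vrt_inj by (auto simp: bij_betw_def inj_on_def)

lemma poset_DL: "poset_on (DL m n lam) (DL_le m n)"
  unfolding poset_on_def
proof (intro conjI)
  show "reflp_on (DL m n lam) (DL_le m n)"
    by (rule reflp_onI) (simp add: DL_le_def bruhat_def)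
  show "transp_on (DL m n lam) (DL_le m n)"
    by (rule transp_onI) (auto simp: DL_le_def bruhat_def)
  show "antisymp_on (DL m n lam) (DL_le m n)"
  proof (rule antisymp_onI)
    fix A B assume "A \<in> DL m n lam" "B \<in> DL m n lam" "DL_le m n A B" "DL_le m n B A"
    then show "A = B"
      using vecs_antisym[OF DL_D(2) DL_D(2)] DL_le_iff vrt_inj DL_D(1) by metis
  qed
qed

lemma disorder_swap_DL:
  assumes "A \<in> DL m n lam"
  shows "disorder_swap m n A B \<longleftrightarrow> B \<in> DL m n lam \<and> disorder_step (vrt m n A) (vrt m n B)"
  unfolding disorder_swap_iff[OF DL_D(1)[OF assms]] DL_iff[OF part_lam len_lam]
  using disorder_stepD(1,2)[of "vrt m n A" "vrt m n B"] DL_D(2)[OF assms] by (auto simp: vecs_iff)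

lemma covers_DL_iff:
  assumes A: "A \<in> DL m n lam"
  shows "covers (DL m n lam) (DL_le m n) A B \<longleftrightarrow> disorder_swap m n A B"
proof (cases "B \<in> DL m n lam")
  case True
  have "covers (DL m n lam) (DL_le m n) A B \<longleftrightarrow>
      covers (lvecs lam) (bruhat m) (vrt m n A) (vrt m n B)"
    unfolding covers_def vrt_image_DL[symmetric] DL_le_def
    using A True DL_D(1) vrt_inj by (auto simp: image_iff)
  then show ?thesis
    unfolding disorder_swap_DL[OF A] covers_vecs_iff[OF DL_D(2)[OF A]] using True by simp
next
  case False
  then show ?thesis unfolding disorder_swap_DL[OF A] covers_def by simp
qed

lemma disorder_swap_rtranclp_iff:
  assumes A: "A \<in> DL m n lam" and B: "B \<in> DL m n lam"
  shows "DL_le m n A B \<longleftrightarrow> (disorder_swap m n)\<^sup>*\<^sup>* A B"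
proof
  assume "DL_le m n A B"
  then have "disorder_step\<^sup>*\<^sup>* (vrt m n A) (vrt m n B)"
    using DL_le_iff[OF A B] disorder_step_rtranclp_iff[OF DL_D(2)[OF A] DL_D(2)[OF B]] by simp
  moreover have "(disorder_swap m n)\<^sup>*\<^sup>* A (arr y) \<and> y \<in> lvecs lam"
    if "disorder_step\<^sup>*\<^sup>* (vrt m n A) y" for y
    using that
  proof (induction rule: rtranclp_induct)
    case base
    then show ?case using arr_vrt[OF DL_D(1)[OF A]] DL_D(2)[OF A] by simp
  next
    case (step y z)
    then have y: "arr y \<in> DL m n lam" "vrt m n (arr y) = y" using arr_in_DL by blast+
    have z: "z \<in> lvecs lam" using disorder_stepD(1,2)[OF step.hyps(2)] step.IH by (simp add: vecs_iff)
    then have "disorder_swap m n (arr y) (arr z)"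
      using disorder_swap_DL[OF y(1)] y(2) arr_in_DL step.hyps(2) by simp
    then show ?case using step.IH z by (meson rtranclp.rtrancl_into_rtrancl)
  qed
  ultimately show "(disorder_swap m n)\<^sup>*\<^sup>* A B"
    using arr_vrt[OF DL_D(1)[OF B]] by metis
next
  assume "(disorder_swap m n)\<^sup>*\<^sup>* A B"
  then have "DL_le m n A B \<and> B \<in> DL m n lam"
  proof (induction rule: rtranclp_induct)
    case base
    then show ?case using A by (simp add: DL_le_def bruhat_def)
  next
    case (step B C)
    then have "bruhat_step m (vrt m n B) (vrt m n C)" "C \<in> DL m n lam"
      using disorder_swap_DL disorder_step_imp_bruhat_step by blast+
    then show ?case
      using step.IH unfolding DL_le_def bruhat_def by (meson rtranclp.rtrancl_into_rtrancl)
  qed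
  then show "DL_le m n A B" by blast
qed

text \<open>A greatest dense lower bound is an interior operator: for \<open>d\<close> below
  \<open>e\<close>, the output for \<open>d\<close> is a dense vector below \<open>e\<close>, hence
  below the output for \<open>e\<close>, and dense vectors are fixed.\<close>

lemma bubble_sort_interval:
  shows "monotone_idempotent_on (bruhat_interval m n lam) (bruhat m) (bubble_sort m n)"
    and "\<And>d. d \<in> bruhat_interval m n lam \<Longrightarrow> bruhat m (bubble_sort m n d) d"
    and "bubble_sort m n ` bruhat_interval m n lam = vrt m n ` DL m n lam"
proof -
  let ?I = "bruhat_interval m n lam"
  note greatest = bubble_sort_greatest[OF part_lam len_lam]
  note sub = lvecs_interval[OF part_lam len_lam]
  have fixed: "bubble_sort m n d = d" if "d \<in> lvecs lam" for d
    using bubble_sort_dense that by (simp add: vecs_iff)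
  show "bruhat m (bubble_sort m n d) d" if "d \<in> ?I" for d
    using greatest(2) that .
  show "bubble_sort m n ` ?I = vrt m n ` DL m n lam"
    unfolding vrt_image_DL using greatest(1) fixed sub by force
  have "bruhat m (bubble_sort m n d) (bubble_sort m n e)"
    if de: "d \<in> ?I" "e \<in> ?I" "bruhat m d e" for d e
  proof -
    have "dom_le (bubble_sort m n d) e"
      using bruhat_imp_dom_le[OF de(3)] bruhat_imp_dom_le[OF greatest(2)[OF de(1)]]
        dom_le_trans by blast
    then show ?thesis
      using greatest(3)[OF de(2) greatest(1)[OF de(1)]]
        bruhat_iff_dom_le[OF greatest(1)[OF de(1)] greatest(1)[OF de(2)]] by simp
  qed
  then show "monotone_idempotent_on ?I (bruhat m) (bubble_sort m n)"
    unfolding monotone_idempotent_on_def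
    using greatest(1) sub fixed by (auto intro!: monotone_onI)
qed

end

section \<open>Arrays with pairwise distinct values\<close>

context
  fixes mu :: "nat list"
  assumes reg: "regular_partition mu" and len_mu: "length mu = card cols"
begin

lemma part_mu: "is_partition mu" "length mu \<le> card cols"
  using reg len_mu by (simp_all add: regular_partition_def)

lemma regular_rows_mu: "regular_rows m cols row (content m (part mu))"
  by unfold_locales (rule inj_on_regular(1)[OF reg len_mu])

lemma relabel_regular:
  assumes lam: "is_partition lam" "length lam \<le> card cols" and A: "A \<in> DL m n mu"
  shows "relabel m n lam A \<in> DL m n lam" "vrt m n (relabel m n lam A) = fill lam (vrt m n A)"
proof -
  note D = DL_D[OF part_mu A]
  have "fill lam (vrt m n A) \<in> lvecs lam"
    by (rule fill_in_lvecs[OF lam inj_on_regular(1)[OF reg len_mu D(2)]])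
      (use D(2) denseD in \<open>auto simp: vecs_iff\<close>)
  then show "relabel m n lam A \<in> DL m n lam"
    using arr_fill_in_DL[OF lam] relabel_eq[OF D(1)] by simp
  show "vrt m n (relabel m n lam A) = fill lam (vrt m n A)"
    unfolding relabel_eq[OF D(1)] by (rule vrt_arr_fill)
qed

lemma relabel_mono:
  assumes lam: "is_partition lam" "length lam \<le> card cols"
  shows "monotone_on (DL m n mu) (DL_le m n) (DL_le m n) (relabel m n lam)"
proof (rule monotone_onI)
  fix A B assume AB: "A \<in> DL m n mu" "B \<in> DL m n mu" "DL_le m n A B"
  note D = DL_D(2)[OF part_mu]
  show "DL_le m n (relabel m n lam A) (relabel m n lam B)"
    unfolding DL_le_def relabel_regular(2)[OF lam AB(1)] relabel_regular(2)[OF lam AB(2)]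
    by (rule bruhat_fill_mono[OF lam(1) D[OF AB(1)] D[OF AB(2)]])
      (use inj_on_regular(2)[OF reg len_mu] D AB in \<open>auto simp: DL_le_def\<close>)
qed

lemma bounded_DL: "bounded_poset (DL m n mu) (DL_le m n)"
  unfolding bounded_poset_def
proof (intro conjI)
  note P = part_mu
  have plus: "fill mu (\<lambda>j. m - j) \<in> lvecs mu"
    using lam_plus_in_lvecs[OF P] lam_plus_eq by simp
  have top: "fill mu row \<in> lvecs mu"
    by (rule fill_in_lvecs[OF P inj_rho]) simp
  note arrs = arr_in_DL[OF P plus] arr_in_DL[OF P top]
  show "\<exists>b\<in>DL m n mu. \<forall>x\<in>DL m n mu. DL_le m n b x"
    using arrs(1) DL_le_iff[OF P] fill_bottom_dom_le[OF P DL_D(2)[OF P]]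
    by (intro bexI[of _ "arr (fill mu (\<lambda>j. m - j))"]) auto
  show "\<exists>t\<in>DL m n mu. \<forall>x\<in>DL m n mu. DL_le m n x t"
    using arrs(2) DL_le_iff[OF P] fill_top_dom_le[OF P DL_D(2)[OF P]]
    by (intro bexI[of _ "arr (fill mu row)"]) auto
qed

lemma covers_regular:
  assumes "covers (DL m n mu) (DL_le m n) A B"
  shows "A \<in> DL m n mu" "B \<in> DL m n mu" "disorder_step (vrt m n A) (vrt m n B)"
proof -
  show A: "A \<in> DL m n mu" and "B \<in> DL m n mu" using assms by (auto simp: covers_def)
  then show "disorder_step (vrt m n A) (vrt m n B)"
    using assms covers_DL_iff[OF part_mu A] disorder_swap_DL[OF part_mu A] by blast
qed

lemma invs_covers:
  assumes "covers (DL m n mu) (DL_le m n) A B"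
  shows "card (invs (vrt m n A)) = Suc (card (invs (vrt m n B)))"
  using regular_rows.card_invs_disorder_step[OF regular_rows_mu] covers_regular[OF assms]
    DL_D(2)[OF part_mu] by blast

lemma graded_DL: "graded_poset (DL m n mu) (DL_le m n)"
  by (rule graded_posetI[where h = "\<lambda>A. card (invs (vrt m n A))"]) (rule invs_covers)

lemma EL_shellable_DL: "EL_shellable (DL m n mu) (DL_le m n)"
  unfolding EL_shellable_def
proof (intro exI)
  interpret R: regular_rows m cols row "content m (part mu)" by (rule regular_rows_mu)
  let ?P = "DL m n mu" let ?le = "DL_le m n" let ?v = "vrt m n"
  let ?f = "\<lambda>A B. swap_label (?v A) (?v B)" and ?g = "\<lambda>A B. arr (atom (?v A) (?v B))"
  note P = part_mu
  note v = DL_D(2)[OF P]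
  have le: "?le A B \<longleftrightarrow> dom_le (?v A) (?v B)" if "A \<in> ?P" "B \<in> ?P" for A B
    using DL_le_iff[OF P that] .
  have eqv: "?v A = ?v B \<longleftrightarrow> A = B" if "A \<in> ?P" "B \<in> ?P" for A B
    using vrt_inj DL_D(1)[OF P] that by blast
  have step: "disorder_step (?v A) (atom (?v A) (?v B))" "dom_le (atom (?v A) (?v B)) (?v B)"
      "?g A B \<in> ?P" "?v (?g A B) = atom (?v A) (?v B)"
    if AB: "A \<in> ?P" "B \<in> ?P" "?le A B" "A \<noteq> B" for A B
  proof -
    note a = R.atom_step[OF v[OF AB(1)] v[OF AB(2)]]
    show ms: "disorder_step (?v A) (atom (?v A) (?v B))" and "dom_le (atom (?v A) (?v B)) (?v B)"
      using a AB le eqv by auto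
    have "atom (?v A) (?v B) \<in> lvecs mu"
      using disorder_stepD(1,2)[OF ms] v[OF AB(1)] by (simp add: vecs_iff)
    then show "?g A B \<in> ?P" "?v (?g A B) = atom (?v A) (?v B)" using arr_in_DL[OF P] by blast+
  qed
  have above: "?le A B \<and> A \<noteq> B"
    if "covers ?P ?le A C" "B \<in> ?P" "?le C B" for A B C
  proof -
    have AC: "A \<in> ?P" "C \<in> ?P" "?le A C" "A \<noteq> C" using that(1) by (auto simp: covers_def)
    then show ?thesis
      using that(2,3) poset_DL[OF P] unfolding poset_on_def antisymp_on_def transp_on_def by blast
  qed
  show "EL_labelling ?P ?le less_than ?f"
  proof (rule EL_labelling_greedy[where g = ?g and h = "\<lambda>A. card (invs (?v A))"])
    show "reflp_on ?P ?le" "transp_on ?P ?le" using poset_DL[OF P] by (auto simp: poset_on_def)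
    show "card (invs (?v A)) = Suc (card (invs (?v B)))" if "covers ?P ?le A B" for A B
      using invs_covers[OF that] .
  next
    fix A B assume AB: "A \<in> ?P" "B \<in> ?P" "?le A B" "A \<noteq> B"
    note s = step[OF AB]
    have "disorder_swap m n A (?g A B)"
      using disorder_swap_DL[OF P AB(1)] s by simp
    then show "covers ?P ?le A (?g A B) \<and> ?le (?g A B) B"
      using covers_DL_iff[OF P AB(1)] le[OF s(3) AB(2)] s by simp
  next
    fix A B C assume *: "covers ?P ?le A C" "B \<in> ?P" "?le C B" "C \<noteq> ?g A B"
    note c = covers_regular[OF *(1)]
    note s = step[OF c(1) *(2)] above[OF *(1-3)]
    have d: "dom_le (?v C) (?v B)" "?v C \<noteq> atom (?v A) (?v B)"
      using *(3,4) le[OF c(2) *(2)] eqv[OF c(2)] s by metis+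
    show "?f A (?g A B) < ?f A C"
      using R.atom_least[OF v[OF c(1)] v[OF *(2)] c(3) d] s by simp
    show "?f C (?g C B) \<le> ?f A C" if "C \<noteq> B"
      using R.atom_descent[OF v[OF c(1)] v[OF *(2)] c(3) d] step(4)[OF c(2) *(2,3) that]
        eqv[OF c(2) *(2)] that by simp
  next
    fix A B assume AB: "A \<in> ?P" "B \<in> ?P" "?le A B" "A \<noteq> B" "?g A B \<noteq> B"
    note s = step[OF AB(1-4)]
    have "dom_le (?v A) (?v B)" "?v A \<noteq> ?v B" "atom (?v A) (?v B) \<noteq> ?v B"
      using AB le eqv s(3,4) by metis+
    then have "swap_label (?v A) (atom (?v A) (?v B))
        < swap_label (atom (?v A) (?v B)) (atom (atom (?v A) (?v B)) (?v B))"
      using R.atom_ascent[OF v[OF AB(1)] v[OF AB(2)]] by blast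
    moreover have "?v (?g (?g A B) B) = atom (?v (?g A B)) (?v B)"
      using step(4)[OF s(3) AB(2) _ AB(5)] le[OF s(3) AB(2)] s(2,4) by simp
    ultimately show "?f A (?g A B) < ?f (?g A B) (?g (?g A B) B)"
      using s(4) by simp
  qed
qed

text \<open>The section of relabelling: equal entries on the staircase, zeros included, become
  distinct parts of \<open>mu\<close>, the larger ones to the left.\<close>

definition lift :: "(cell \<Rightarrow> nat) \<Rightarrow> cell \<Rightarrow> nat" where
  "lift A = arr (fill mu (key (vrt m n A)))"

lemma lift_DL:
  assumes lam: "is_partition lam" "length lam \<le> card cols" and A: "A \<in> DL m n lam"
  shows "lift A \<in> DL m n mu" "vrt m n (lift A) = fill mu (key (vrt m n A))"
    "relabel m n lam (lift A) = A"
proof -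
  note D = DL_D[OF lam A]
  have "dense (vrt m n A)" using D(2) by (simp add: vecs_iff)
  then show *: "lift A \<in> DL m n mu"
    unfolding lift_def using arr_fill_in_DL[OF part_mu] fill_key_in_lvecs[OF part_mu] by blast
  show **: "vrt m n (lift A) = fill mu (key (vrt m n A))"
    unfolding lift_def by (rule vrt_arr_fill)
  have "vrt m n (relabel m n lam (lift A)) = vrt m n A"
    using relabel_regular(2)[OF lam *] ** fill_fill[OF reg len_mu inj_key] fill_key[OF lam(1) D(2)]
    by simp
  then show "relabel m n lam (lift A) = A"
    using vrt_inj D(1) DL_D(1)[OF lam relabel_regular(1)[OF lam *]] by blast
qed

lemma lift_mono:
  assumes lam: "is_partition lam" "length lam \<le> card cols"
    and AB: "A \<in> DL m n lam" "B \<in> DL m n lam" "DL_le m n A B"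
  shows "DL_le m n (lift A) (lift B)"
  unfolding DL_le_iff[OF part_mu lift_DL(1)[OF lam AB(1)] lift_DL(1)[OF lam AB(2)]]
    lift_DL(2)[OF lam AB(1)] lift_DL(2)[OF lam AB(2)]
  by (rule fill_key_mono[OF lam(1) part_mu(1)])
    (use DL_D(2)[OF lam] DL_le_iff[OF lam] AB in auto)

text \<open>Relabelling after \<open>lift\<close> is the identity, so the composite in the other
  order is idempotent, and both maps being monotone, its image is a copy of
  \<open>DL m n lam\<close>.\<close>

lemma relabel_retraction:
  assumes lam: "is_partition lam" "length lam \<le> card cols"
  shows "relabel m n lam ` DL m n mu = DL m n lam"
    and "\<exists>\<tau>. \<tau> \<in> DL m n lam \<rightarrow> DL m n mu \<and>
      monotone_on (DL m n lam) (DL_le m n) (DL_le m n) \<tau> \<and>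
      (\<forall>A\<in>DL m n lam. relabel m n lam (\<tau> A) = A) \<and>
      monotone_idempotent_on (DL m n mu) (DL_le m n) (\<tau> \<circ> relabel m n lam) \<and>
      order_iso_on (DL m n lam) (DL_le m n)
        ((\<tau> \<circ> relabel m n lam) ` DL m n mu) (DL_le m n) \<tau>"
proof -
  note lift = lift_DL[OF lam] and down = relabel_regular(1)[OF lam]
  note up_mono = lift_mono[OF lam] and down_mono = monotone_onD[OF relabel_mono[OF lam]]
  show image: "relabel m n lam ` DL m n mu = DL m n lam"
  proof
    show "DL m n lam \<subseteq> relabel m n lam ` DL m n mu"
      using lift(1,3) by (metis image_eqI subsetI)
  qed (use down in blast)
  have "lift \<in> DL m n lam \<rightarrow> DL m n mu" using lift(1) by blast
  moreover have "monotone_on (DL m n lam) (DL_le m n) (DL_le m n) lift"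
    using up_mono by (auto intro: monotone_onI)
  moreover have "monotone_idempotent_on (DL m n mu) (DL_le m n) (lift \<circ> relabel m n lam)"
    unfolding monotone_idempotent_on_def
    using lift down up_mono down_mono by (auto intro!: monotone_onI)
  moreover have "order_iso_on (DL m n lam) (DL_le m n)
      ((lift \<circ> relabel m n lam) ` DL m n mu) (DL_le m n) lift"
    unfolding order_iso_on_def image_comp[symmetric] image
  proof (intro conjI ballI)
    have "inj_on lift (DL m n lam)"
      by (rule inj_on_inverseI[of _ "relabel m n lam"]) (rule lift(3))
    then show "bij_betw lift (DL m n lam) (lift ` DL m n lam)" by (simp add: bij_betw_def)
    fix A B assume AB: "A \<in> DL m n lam" "B \<in> DL m n lam"
    show "DL_le m n A B \<longleftrightarrow> DL_le m n (lift A) (lift B)"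
      using up_mono[OF AB] down_mono[OF lift(1)[OF AB(1)] lift(1)[OF AB(2)]]
        lift(3)[OF AB(1)] lift(3)[OF AB(2)] by auto
  qed
  ultimately show "\<exists>\<tau>. \<tau> \<in> DL m n lam \<rightarrow> DL m n mu \<and>
      monotone_on (DL m n lam) (DL_le m n) (DL_le m n) \<tau> \<and>
      (\<forall>A\<in>DL m n lam. relabel m n lam (\<tau> A) = A) \<and>
      monotone_idempotent_on (DL m n mu) (DL_le m n) (\<tau> \<circ> relabel m n lam) \<and>
      order_iso_on (DL m n lam) (DL_le m n)
        ((\<tau> \<circ> relabel m n lam) ` DL m n mu) (DL_le m n) \<tau>"
    using lift(3) by blast
qed

end

text \<open>Regular relabelling keeps all ranks, and writing the parts of \<open>mu\<close> in the
  order of an array that already carries them changes nothing.\<close>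

lemma relabel_relabel:
  assumes mu: "regular_partition mu" "length mu = card cols"
    and nu: "regular_partition nu" "length nu = card cols" and A: "A \<in> DL m n mu"
  shows "relabel m n mu (relabel m n nu A) = A"
proof -
  note P = part_mu[OF mu] and Q = part_mu[OF nu]
  have B: "relabel m n nu A \<in> DL m n nu" using relabel_regular(1)[OF mu Q A] .
  have "vrt m n (relabel m n mu (relabel m n nu A)) = vrt m n A"
    using relabel_regular(2)[OF nu P B] relabel_regular(2)[OF mu Q A]
      fill_fill[OF nu inj_on_regular(1)[OF mu DL_D(2)[OF P A]]] fill_self[OF mu DL_D(2)[OF P A]]
    by simp
  then show ?thesis
    using vrt_inj DL_D(1)[OF P A] DL_D(1)[OF P relabel_regular(1)[OF nu P B]] by blast
qed

lemma relabel_iso: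
  assumes mu: "regular_partition mu" "length mu = card cols"
    and nu: "regular_partition nu" "length nu = card cols"
  shows "order_iso_on (DL m n mu) (DL_le m n) (DL m n nu) (DL_le m n) (relabel m n nu)"
  unfolding order_iso_on_def
proof (intro conjI ballI)
  note P = part_mu[OF mu] and Q = part_mu[OF nu]
  note fwd = relabel_regular(1)[OF mu Q] and bwd = relabel_regular(1)[OF nu P]
  show "bij_betw (relabel m n nu) (DL m n mu) (DL m n nu)"
    by (rule bij_betw_byWitness[of _ "relabel m n mu"])
      (use relabel_relabel[OF mu nu] relabel_relabel[OF nu mu] fwd bwd in auto)
  fix A B assume AB: "A \<in> DL m n mu" "B \<in> DL m n mu"
  show "DL_le m n A B \<longleftrightarrow> DL_le m n (relabel m n nu A) (relabel m n nu B)"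
    using monotone_onD[OF relabel_mono[OF mu Q] AB]
      monotone_onD[OF relabel_mono[OF nu P] fwd[OF AB(1)] fwd[OF AB(2)]]
      relabel_relabel[OF mu nu AB(1)] relabel_relabel[OF mu nu AB(2)] by auto
qed

end

theorem theoremL:
  fixes m r :: nat and n :: "nat \<Rightarrow> nat" and lam :: "nat list"
  assumes "1 \<le> m" and "0 < n 1" and "mono_on {1..m} n"
    and "r = card (staircase m n)"
    and "is_partition lam"
  shows
    "(length lam > r \<longrightarrow> DL m n lam = {}) \<and>
     (regular_partition lam \<and> length lam = r \<longrightarrow>
        poset_on (DL m n lam) (DL_le m n) \<and>
        (\<forall>mu. regular_partition mu \<and> length mu = r \<longrightarrow>
           order_iso_on (DL m n lam) (DL_le m n) (DL m n mu) (DL_le m n) (relabel m n mu)) \<and>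
        bounded_poset (DL m n lam) (DL_le m n) \<and>
        graded_poset (DL m n lam) (DL_le m n) \<and>
        EL_shellable (DL m n lam) (DL_le m n)) \<and>
     (length lam \<le> r \<longrightarrow>
        poset_on (DL m n lam) (DL_le m n) \<and>
        ((\<forall>A\<in>DL m n lam. \<forall>B. covers (DL m n lam) (DL_le m n) A B \<longleftrightarrow> disorder_swap m n A B) \<and>
         (\<forall>A\<in>DL m n lam. \<forall>B\<in>DL m n lam. DL_le m n A B \<longleftrightarrow> (disorder_swap m n)\<^sup>*\<^sup>* A B)) \<and>
        (monotone_idempotent_on (bruhat_interval m n lam) (bruhat m) (bubble_sort m n) \<and>
         (\<forall>d\<in>bruhat_interval m n lam. bruhat m (bubble_sort m n d) d) \<and>
         bubble_sort m n ` bruhat_interval m n lam = vrt m n ` DL m n lam \<and>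
         order_iso_on (DL m n lam) (DL_le m n) (vrt m n ` DL m n lam) (bruhat m) (vrt m n)) \<and>
        (\<forall>mu. regular_partition mu \<and> length mu = r \<longrightarrow>
           relabel m n lam ` DL m n mu = DL m n lam \<and>
           monotone_on (DL m n mu) (DL_le m n) (DL_le m n) (relabel m n lam) \<and>
           (\<exists>\<tau>. \<tau> \<in> DL m n lam \<rightarrow> DL m n mu \<and>
                monotone_on (DL m n lam) (DL_le m n) (DL_le m n) \<tau> \<and>
                (\<forall>A\<in>DL m n lam. relabel m n lam (\<tau> A) = A) \<and>
                monotone_idempotent_on (DL m n mu) (DL_le m n) (\<tau> \<circ> relabel m n lam) \<and>
                order_iso_on (DL m n lam) (DL_le m n)
                  ((\<tau> \<circ> relabel m n lam) ` DL m n mu) (DL_le m n) \<tau>)))"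
proof -
  interpret staircase_diagram m n by unfold_locales (rule assms(3))
  have r: "r = card cols" using assms(4) card_staircase by simp
  note lam = assms(5)
  show ?thesis
    unfolding r
  proof (intro conjI impI allI)
    show "DL m n lam = {}" if "card cols < length lam" using DL_empty[OF that] .
  next
    assume reg: "regular_partition lam \<and> length lam = card cols"
    then have reg': "regular_partition lam" "length lam = card cols" by auto
    note P = part_mu[OF reg']
    show "poset_on (DL m n lam) (DL_le m n)" using poset_DL[OF P] .
    show "order_iso_on (DL m n lam) (DL_le m n) (DL m n mu) (DL_le m n) (relabel m n mu)"
      if "regular_partition mu \<and> length mu = card cols" for mu
      using relabel_iso[OF reg'] that by blast
    show "bounded_poset (DL m n lam) (DL_le m n)" using bounded_DL[OF reg'] .
    show "graded_poset (DL m n lam) (DL_le m n)" using graded_DL[OF reg'] .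
    show "EL_shellable (DL m n lam) (DL_le m n)" using EL_shellable_DL[OF reg'] .
  next
    assume len: "length lam \<le> card cols"
    note P = lam len
    show "poset_on (DL m n lam) (DL_le m n)" using poset_DL[OF P] .
    show "\<forall>A\<in>DL m n lam. \<forall>B. covers (DL m n lam) (DL_le m n) A B \<longleftrightarrow> disorder_swap m n A B"
      using covers_DL_iff[OF P] by blast
    show "\<forall>A\<in>DL m n lam. \<forall>B\<in>DL m n lam. DL_le m n A B \<longleftrightarrow> (disorder_swap m n)\<^sup>*\<^sup>* A B"
      using disorder_swap_rtranclp_iff[OF P] by blast
    show "monotone_idempotent_on (bruhat_interval m n lam) (bruhat m) (bubble_sort m n)"
      using bubble_sort_interval(1)[OF P] .
    show "\<forall>d\<in>bruhat_interval m n lam. bruhat m (bubble_sort m n d) d"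
      using bubble_sort_interval(2)[OF P] by blast
    show "bubble_sort m n ` bruhat_interval m n lam = vrt m n ` DL m n lam"
      using bubble_sort_interval(3)[OF P] .
    show "order_iso_on (DL m n lam) (DL_le m n) (vrt m n ` DL m n lam) (bruhat m) (vrt m n)"
      using vrt_iso[OF P] .
    fix mu assume "regular_partition mu \<and> length mu = card cols"
    then have mu: "regular_partition mu" "length mu = card cols" by auto
    show "relabel m n lam ` DL m n mu = DL m n lam" using relabel_retraction(1)[OF mu P] .
    show "monotone_on (DL m n mu) (DL_le m n) (DL_le m n) (relabel m n lam)"
      using relabel_mono[OF mu P] .
    show "\<exists>\<tau>. \<tau> \<in> DL m n lam \<rightarrow> DL m n mu \<and>
        monotone_on (DL m n lam) (DL_le m n) (DL_le m n) \<tau> \<and>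
        (\<forall>A\<in>DL m n lam. relabel m n lam (\<tau> A) = A) \<and>
        monotone_idempotent_on (DL m n mu) (DL_le m n) (\<tau> \<circ> relabel m n lam) \<and>
        order_iso_on (DL m n lam) (DL_le m n)
          ((\<tau> \<circ> relabel m n lam) ` DL m n mu) (DL_le m n) \<tau>"
      using relabel_retraction(2)[OF mu P] .
  qed
qed

end
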